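(* Let $(N^{n+1},g)$ be a spacetime. Every $p\in N$ has a neighborhood $U_p\subset N$ with the property that each point $q\in U_p$ has a Temple chart $\Phi_{q,\eta}:W_q\to\Phi_{q,\eta}(W_q)$ that covers $U_p$, i.e. $$U_p\subseteq \Phi_{q,\eta}(W_q).$$ Here each $\eta=\eta_q$ with $\eta(0)=q$ is a member of a smooth collection of timelike geodesics perpendicular to a fixed spacelike hypersurface $\Sigma_p$ that contains $p$ (the hypersurface and the collection of geodesics depend on $p$ but not on $q\in U_p$).
   Context: A spacetime $(N^{n+1},g)$, $n\ge 1$, is a smooth connected time-oriented Lorentzian manifold with $g$ of signature $(-,+,\ldots,+)$; $\exp$ denotes its exponential map. Temple chart: given $q\in N$ and a unit speed future timelike geodesic $\eta:(-\epsilon,\epsilon)\to N$ with $\eta(0)=q$, put $e_0=\dot\eta(0)$ and let $e_1,\ldots,e_n\in T_qN$ be an orthonormal collection of spacelike vectors such that each $e_i+e_0$ is future null. Extend $e_0,\ldots,e_n$ along $\eta$ by parallel transport (so $e_0=\dot\eta(t)$ at $\eta(t)$). Define $$\Phi_{q,\eta}(t,\vec x)=\exp_{\eta(t)}\Big(|\vec x|e_0+\sum_{i=1}^n x^ie_i\Big),\qquad (t,\vec x)\in\mathbb R\times\mathbb R^n.$$ A Temple chart at $q$ is such a map $\Phi_{q,\eta}:W_q\to\Phi_{q,\eta}(W_q)$ on an open cylinder $W_q\subset\mathbb R^{n+1}$ about $\vec 0$ with central axis $(-\epsilon,\epsilon)\times\{\vec 0\}$, on which it is a homeomorphism onto its image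 and a smooth diffeomorphism onto its image away from the central axis. The members of the collection of geodesics are considered up to a shift of the parameter, so that $\eta_q(0)=q$ although $q$ need not lie on $\Sigma_p$. *)

theory Defs
  imports "HOL-Analysis.Analysis"
begin

section \<open>Smooth maps between Euclidean spaces\<close>

text \<open>Only used on open sets, where the derivatives \<open>at x\<close> and \<open>at x within S\<close> agree.\<close>

primrec Ck_on :: "nat \<Rightarrow> 'a::euclidean_space set \<Rightarrow> ('a \<Rightarrow> 'b::euclidean_space) \<Rightarrow> bool" where
  "Ck_on 0 S f \<longleftrightarrow> continuous_on S f"
| "Ck_on (Suc k) S f \<longleftrightarrow>
     (\<forall>x\<in>S. f differentiable at x) \<and> (\<forall>v. Ck_on k S (\<lambda>x. frechet_derivative f (at x) v))"

definition smooth_on :: "'a::euclidean_space set \<Rightarrow> ('a \<Rightarrow> 'b::euclidean_space) \<Rightarrow> bool" where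
  "smooth_on S f \<longleftrightarrow> (\<forall>k. Ck_on k S f)"


section \<open>Smooth manifolds of dimension n + 1\<close>

text \<open>The model space is \<open>\<real> \<times> \<real>\<^sup>n\<close> with \<open>n = CARD('n) \<ge> 1\<close>.  The manifold itself is the whole
  type \<open>'m\<close>.  A chart is a pair of its domain and its coordinate map; the values of the coordinate
  map outside the domain are irrelevant.\<close>

type_synonym 'n model = "real \<times> (real ^ 'n)"
type_synonym ('m, 'n) chart = "'m set \<times> ('m \<Rightarrow> 'n model)"

definition chart_inv :: "('m, 'n) chart \<Rightarrow> 'n model \<Rightarrow> 'm" where
  "chart_inv c = inv_into (fst c) (snd c)"

definition is_chart :: "('m::topological_space, 'n::finite) chart \<Rightarrow> bool" where
  "is_chart c \<longleftrightarrow> open (fst c) \<and> open (snd c ` fst c) \<and>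
     homeomorphism (fst c) (snd c ` fst c) (snd c) (chart_inv c)"

definition transition :: "('m, 'n) chart \<Rightarrow> ('m, 'n) chart \<Rightarrow> 'n model \<Rightarrow> 'n model" where
  "transition c c' = snd c' \<circ> chart_inv c"

definition compatible :: "('m, 'n::finite) chart \<Rightarrow> ('m, 'n) chart \<Rightarrow> bool" where
  "compatible c c' \<longleftrightarrow>
     smooth_on (snd c ` (fst c \<inter> fst c')) (transition c c') \<and>
     smooth_on (snd c' ` (fst c \<inter> fst c')) (transition c' c)"

locale smooth_manifold =
  fixes A :: "('m::{t2_space, second_countable_topology}, 'n::finite) chart set"
  assumes charts: "c \<in> A \<Longrightarrow> is_chart c"
    and cover: "(\<Union>c\<in>A. fst c) = UNIV"
    and compat: "c \<in> A \<Longrightarrow> c' \<in> A \<Longrightarrow> compatible c c'"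

definition maximal_atlas ::
    "('m::topological_space, 'n::finite) chart set \<Rightarrow> ('m, 'n) chart set" where
  "maximal_atlas A = {c. is_chart c \<and> (\<forall>c'\<in>A. compatible c c')}"

definition smooth_into ::
    "('m::topological_space, 'n::finite) chart set \<Rightarrow> 'a::euclidean_space set \<Rightarrow> ('a \<Rightarrow> 'm) \<Rightarrow> bool"
  where
  "smooth_into A S f \<longleftrightarrow>
     continuous_on S f \<and> (\<forall>c\<in>A. smooth_on {x\<in>S. f x \<in> fst c} (snd c \<circ> f))"

definition smooth_from ::
    "('m, 'n::finite) chart set \<Rightarrow> 'm set \<Rightarrow> ('m \<Rightarrow> 'a::euclidean_space) \<Rightarrow> bool" where
  "smooth_from A V h \<longleftrightarrow> (\<forall>c\<in>A. smooth_on (snd c ` (V \<inter> fst c)) (h \<circ> chart_inv c))"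

definition diffeomorphism_onto_image ::
    "('m::topological_space, 'n::finite) chart set \<Rightarrow> 'n model set \<Rightarrow> ('n model \<Rightarrow> 'm) \<Rightarrow> bool" where
  "diffeomorphism_onto_image A S f \<longleftrightarrow>
     inj_on f S \<and> open (f ` S) \<and> smooth_into A S f \<and> smooth_from A (f ` S) (inv_into S f)"


section \<open>Tangent vectors\<close>

text \<open>Each tangent space is identified with the model space by means of a chart at the base point,
  chosen once and for all: a vector \<open>v\<close> of the model space stands for the tangent vector at \<open>p\<close>
  whose components with respect to \<open>chart_at A p\<close> are \<open>v\<close>.  Its components in any other chart
  are given by the usual transformation law, and fields of tangent vectors are called continuous or
  smooth if their components in the charts of the atlas are.\<close>

definition chart_at :: "('m, 'n) chart set \<Rightarrow> 'm \<Rightarrow> ('m, 'n) chart" where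
  "chart_at A p = (SOME c. c \<in> A \<and> p \<in> fst c)"

definition components ::
    "('m, 'n::finite) chart set \<Rightarrow> ('m, 'n) chart \<Rightarrow> 'm \<Rightarrow> 'n model \<Rightarrow> 'n model" where
  "components A c p v =
     frechet_derivative (transition (chart_at A p) c) (at (snd (chart_at A p) p)) v"

text \<open>Conversely, the tangent vector at \<open>p\<close> with given components \<open>u\<close> in the chart \<open>c\<close>:\<close>

definition from_components ::
    "('m, 'n::finite) chart set \<Rightarrow> ('m, 'n) chart \<Rightarrow> 'm \<Rightarrow> 'n model \<Rightarrow> 'n model" where
  "from_components A c p u =
     frechet_derivative (transition c (chart_at A p)) (at (snd c p)) u"

definition velocity :: "('m, 'n::finite) chart set \<Rightarrow> (real \<Rightarrow> 'm) \<Rightarrow> real \<Rightarrow> 'n model" where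
  "velocity A \<gamma> t = vector_derivative (snd (chart_at A (\<gamma> t)) \<circ> \<gamma>) (at t)"


section \<open>Lorentzian metrics and spacetimes\<close>

type_synonym ('m, 'n) metric_field = "'m \<Rightarrow> 'n model \<Rightarrow> 'n model \<Rightarrow> real"
type_synonym ('m, 'n) vector_field = "'m \<Rightarrow> 'n model"

definition lorentz_form :: "('n::finite model \<Rightarrow> 'n model \<Rightarrow> real) \<Rightarrow> bool" where
  "lorentz_form B \<longleftrightarrow> bilinear B \<and> (\<forall>u v. B u v = B v u) \<and>
     (\<exists>L :: 'n model \<Rightarrow> 'n model. linear L \<and> bij L \<and>
       (\<forall>u v. B (L u) (L v) = - (fst u * fst v) + snd u \<bullet> snd v))"

definition metric_in_chart ::
    "('m, 'n::finite) chart set \<Rightarrow> ('m, 'n) metric_field \<Rightarrow> ('m, 'n) chart \<Rightarrow>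
     'n model \<Rightarrow> 'n model \<Rightarrow> 'n model \<Rightarrow> real" where
  "metric_in_chart A g c y u v =
     (let p = chart_inv c y in g p (from_components A c p u) (from_components A c p v))"

locale lorentzian_manifold = smooth_manifold A
  for A :: "('m::{t2_space, second_countable_topology}, 'n::finite) chart set" +
  fixes g :: "('m, 'n) metric_field"
  assumes lorentz: "lorentz_form (g p)"
    and smooth_metric: "c \<in> A \<Longrightarrow> smooth_on (snd c ` fst c) (\<lambda>y. metric_in_chart A g c y u v)"

text \<open>The time orientation is given by a continuous timelike vector field \<open>T\<close>, declared to be
  future.\<close>

locale spacetime = lorentzian_manifold A g
  for A :: "('m::{t2_space, second_countable_topology}, 'n::finite) chart set"
    and g :: "('m, 'n) metric_field" +
  fixes T :: "('m, 'n) vector_field"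
  assumes connected: "connected (UNIV :: 'm set)"
    and T_continuous: "c \<in> A \<Longrightarrow> continuous_on (fst c) (\<lambda>p. components A c p (T p))"
    and T_timelike: "g p (T p) (T p) < 0"

definition future_timelike ::
    "('m, 'n) metric_field \<Rightarrow> ('m, 'n) vector_field \<Rightarrow> 'm \<Rightarrow> 'n::finite model \<Rightarrow> bool" where
  "future_timelike g T p v \<longleftrightarrow> g p v v < 0 \<and> g p v (T p) < 0"

definition future_null ::
    "('m, 'n) metric_field \<Rightarrow> ('m, 'n) vector_field \<Rightarrow> 'm \<Rightarrow> 'n::finite model \<Rightarrow> bool" where
  "future_null g T p v \<longleftrightarrow> v \<noteq> 0 \<and> g p v v = 0 \<and> g p v (T p) < 0"


section \<open>Levi-Civita connection, geodesics and the exponential map\<close>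

text \<open>\<open>christoffel A g c y u v\<close> is the vector with components
  \<open>\<Gamma>\<^sup>k\<^sub>i\<^sub>j u\<^sup>i v\<^sup>j\<close> in the chart \<open>c\<close>, that is
  \<open>g\<^sub>k\<^sub>l \<Gamma>\<^sup>k\<^sub>i\<^sub>j = (\<partial>\<^sub>i g\<^sub>j\<^sub>l + \<partial>\<^sub>j g\<^sub>i\<^sub>l - \<partial>\<^sub>l g\<^sub>i\<^sub>j) / 2\<close>; it is
  unique since the metric is nondegenerate.\<close>

definition metric_deriv ::
    "('m, 'n::finite) chart set \<Rightarrow> ('m, 'n) metric_field \<Rightarrow> ('m, 'n) chart \<Rightarrow>
     'n model \<Rightarrow> 'n model \<Rightarrow> 'n model \<Rightarrow> 'n model \<Rightarrow> real" where
  "metric_deriv A g c y u v w =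
     frechet_derivative (\<lambda>z. metric_in_chart A g c z v w) (at y) u"

definition christoffel ::
    "('m, 'n::finite) chart set \<Rightarrow> ('m, 'n) metric_field \<Rightarrow> ('m, 'n) chart \<Rightarrow>
     'n model \<Rightarrow> 'n model \<Rightarrow> 'n model \<Rightarrow> 'n model" where
  "christoffel A g c y u v =
     (THE z. \<forall>w. metric_in_chart A g c y z w =
        (metric_deriv A g c y u v w + metric_deriv A g c y v u w - metric_deriv A g c y w u v) / 2)"

definition parallel_along ::
    "('m, 'n::finite) chart set \<Rightarrow> ('m, 'n) metric_field \<Rightarrow> real set \<Rightarrow> (real \<Rightarrow> 'm) \<Rightarrow>
     (real \<Rightarrow> 'n model) \<Rightarrow> bool" where
  "parallel_along A g J \<gamma> V \<longleftrightarrow>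
     (\<forall>c\<in>A. \<forall>t\<in>J. \<gamma> t \<in> fst c \<longrightarrow>
        ((\<lambda>s. components A c (\<gamma> s) (V s)) has_vector_derivative
           - christoffel A g c (snd c (\<gamma> t))
               (components A c (\<gamma> t) (velocity A \<gamma> t)) (components A c (\<gamma> t) (V t))) (at t))"

definition geodesic ::
    "('m::topological_space, 'n::finite) chart set \<Rightarrow> ('m, 'n) metric_field \<Rightarrow> real set \<Rightarrow>
     (real \<Rightarrow> 'm) \<Rightarrow> bool" where
  "geodesic A g J \<gamma> \<longleftrightarrow> open J \<and> is_interval J \<and> smooth_into A J \<gamma> \<and>
     parallel_along A g J \<gamma> (velocity A \<gamma>)"

definition unit_future_geodesic ::
    "('m::topological_space, 'n::finite) chart set \<Rightarrow> ('m, 'n) metric_field \<Rightarrow>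
     ('m, 'n) vector_field \<Rightarrow> real set \<Rightarrow> (real \<Rightarrow> 'm) \<Rightarrow> bool" where
  "unit_future_geodesic A g T J \<gamma> \<longleftrightarrow> geodesic A g J \<gamma> \<and>
     (\<forall>t\<in>J. g (\<gamma> t) (velocity A \<gamma> t) (velocity A \<gamma> t) = - 1 \<and>
             future_timelike g T (\<gamma> t) (velocity A \<gamma> t))"

definition exp_rel ::
    "('m::topological_space, 'n::finite) chart set \<Rightarrow> ('m, 'n) metric_field \<Rightarrow>
     'm \<Rightarrow> 'n model \<Rightarrow> 'm \<Rightarrow> bool" where
  "exp_rel A g p v q \<longleftrightarrow>
     (\<exists>\<gamma> J. geodesic A g J \<gamma> \<and> {0..1} \<subseteq> J \<and> \<gamma> 0 = p \<and> velocity A \<gamma> 0 = v \<and> \<gamma> 1 = q)"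

definition exp_domain ::
    "('m::topological_space, 'n::finite) chart set \<Rightarrow> ('m, 'n) metric_field \<Rightarrow> 'm \<Rightarrow> 'n model set"
  where
  "exp_domain A g p = {v. \<exists>q. exp_rel A g p v q}"

definition exp_map ::
    "('m::topological_space, 'n::finite) chart set \<Rightarrow> ('m, 'n) metric_field \<Rightarrow> 'm \<Rightarrow> 'n model \<Rightarrow> 'm"
  where
  "exp_map A g p v = (THE q. exp_rel A g p v q)"


section \<open>Spacelike hypersurfaces and their normal geodesics\<close>

definition slice_chart ::
    "('m::topological_space, 'n::finite) chart set \<Rightarrow> 'm set \<Rightarrow> ('m, 'n) chart \<Rightarrow> bool" where
  "slice_chart A S c \<longleftrightarrow> c \<in> maximal_atlas A \<and> (\<forall>x\<in>fst c. x \<in> S \<longleftrightarrow> fst (snd c x) = 0)"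

definition tangent_to ::
    "('m::topological_space, 'n::finite) chart set \<Rightarrow> 'm set \<Rightarrow> 'm \<Rightarrow> 'n model \<Rightarrow> bool" where
  "tangent_to A S x v \<longleftrightarrow> (\<exists>c. slice_chart A S c \<and> x \<in> fst c \<and> fst (components A c x v) = 0)"

definition spacelike_hypersurface ::
    "('m::topological_space, 'n::finite) chart set \<Rightarrow> ('m, 'n) metric_field \<Rightarrow> 'm set \<Rightarrow> bool" where
  "spacelike_hypersurface A g S \<longleftrightarrow>
     (\<forall>x\<in>S. (\<exists>c. slice_chart A S c \<and> x \<in> fst c) \<and>
             (\<forall>v. tangent_to A S x v \<longrightarrow> v \<noteq> 0 \<longrightarrow> g x v v > 0))"

text \<open>A smooth collection of unit speed future timelike geodesics \<open>F x\<close> for \<open>x \<in> S\<close>, defined on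
  the common interval \<open>(-\<delta>, \<delta>)\<close>, where \<open>F x\<close> starts at \<open>x\<close> perpendicularly to \<open>S\<close>.  Smoothness is
  that of the map \<open>(x, t) \<mapsto> F x t\<close> on \<open>S \<times> (-\<delta>, \<delta>)\<close>, expressed in the coordinates of \<open>S\<close> that are
  induced by slice charts.\<close>

definition normal_geodesic_family ::
    "('m::topological_space, 'n::finite) chart set \<Rightarrow> ('m, 'n) metric_field \<Rightarrow>
     ('m, 'n) vector_field \<Rightarrow> 'm set \<Rightarrow> real \<Rightarrow> ('m \<Rightarrow> real \<Rightarrow> 'm) \<Rightarrow> bool" where
  "normal_geodesic_family A g T S \<delta> F \<longleftrightarrow> \<delta> > 0 \<and>
     (\<forall>x\<in>S. unit_future_geodesic A g T {-\<delta><..<\<delta>} (F x) \<and> F x 0 = x \<and>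
             (\<forall>v. tangent_to A S x v \<longrightarrow> g x (velocity A (F x) 0) v = 0)) \<and>
     (\<forall>c. slice_chart A S c \<longrightarrow>
        smooth_into A {(y, t). (0, y) \<in> snd c ` fst c \<and> t \<in> {-\<delta><..<\<delta>}}
          (\<lambda>(y, t). F (chart_inv c (0, y)) t))"


section \<open>Temple charts\<close>

definition temple_vector ::
    "('m, 'n::finite) chart set \<Rightarrow> (real \<Rightarrow> 'm) \<Rightarrow> ('n \<Rightarrow> real \<Rightarrow> 'n model) \<Rightarrow> 'n model \<Rightarrow> 'n model"
  where
  "temple_vector A \<eta> e = (\<lambda>(t, x). norm x *\<^sub>R velocity A \<eta> t + (\<Sum>i\<in>UNIV. x $ i *\<^sub>R e i t))"

definition temple_map ::
    "('m::topological_space, 'n::finite) chart set \<Rightarrow> ('m, 'n) metric_field \<Rightarrow> (real \<Rightarrow> 'm) \<Rightarrow>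
     ('n \<Rightarrow> real \<Rightarrow> 'n model) \<Rightarrow> 'n model \<Rightarrow> 'm" where
  "temple_map A g \<eta> e z = exp_map A g (\<eta> (fst z)) (temple_vector A \<eta> e z)"

definition cylinder :: "real \<Rightarrow> real \<Rightarrow> 'n::finite model set" where
  "cylinder \<epsilon> r = {-\<epsilon><..<\<epsilon>} \<times> ball 0 r"

text \<open>Here \<open>e i t\<close> is the parallel transport of \<open>e i 0\<close> along \<open>\<eta>\<close>; the vector \<open>e\<^sub>0\<close> at \<open>\<eta> t\<close> is
  the velocity of \<open>\<eta>\<close>.\<close>

definition temple_chart ::
    "('m::topological_space, 'n::finite) chart set \<Rightarrow> ('m, 'n) metric_field \<Rightarrow>
     ('m, 'n) vector_field \<Rightarrow> 'm \<Rightarrow> (real \<Rightarrow> 'm) \<Rightarrow> ('n \<Rightarrow> real \<Rightarrow> 'n model) \<Rightarrow> real \<Rightarrow> real \<Rightarrow> bool"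
  where
  "temple_chart A g T q \<eta> e \<epsilon> r \<longleftrightarrow> \<epsilon> > 0 \<and> r > 0 \<and>
     unit_future_geodesic A g T {-\<epsilon><..<\<epsilon>} \<eta> \<and> \<eta> 0 = q \<and>
     (\<forall>i j. g q (e i 0) (e j 0) = (if i = j then 1 else 0)) \<and>
     (\<forall>i. future_null g T q (e i 0 + velocity A \<eta> 0)) \<and>
     (\<forall>i. parallel_along A g {-\<epsilon><..<\<epsilon>} \<eta> (e i)) \<and>
     (\<forall>z\<in>cylinder \<epsilon> r. temple_vector A \<eta> e z \<in> exp_domain A g (\<eta> (fst z))) \<and>
     (\<exists>\<Psi>. homeomorphism (cylinder \<epsilon> r) (temple_map A g \<eta> e ` cylinder \<epsilon> r)
       (temple_map A g \<eta> e) \<Psi>) \<and>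
     diffeomorphism_onto_image A (cylinder \<epsilon> r - {-\<epsilon><..<\<epsilon>} \<times> {0}) (temple_map A g \<eta> e)"

end

theory Submission
  imports Defs
begin

text \<open>The whole argument takes place in one chart around \<open>p\<close> whose coordinates make the metric
  at \<open>p\<close> the Minkowski metric. There the hypersurface is the coordinate slice of vanishing time,
  its geodesics start with the future unit normal vectors of the slice, and a frame that is
  orthonormal on the slice is transported in parallel along them. With \<open>Y a\<close>, \<open>V a\<close>, \<open>E i a\<close> for
  the point, the velocity and the frame at time \<open>fst a\<close> on the geodesic that starts at the slice
  point \<open>snd a\<close>, put \<open>K (a, b) = exp (fst b V a + sum of snd b $ i E i a)\<close>, the exponential map
  being taken at \<open>Y a\<close>. This is a smooth map of \<open>a\<close> and \<open>b\<close> whose differential at the origin is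
  \<open>(a, b) \<mapsto> a + b\<close>, and the Temple map of the geodesic through \<open>x\<close>, started at time \<open>\<tau>\<close>, is
  \<open>(t, z) \<mapsto> K ((t + \<tau>, x), (|z|, z))\<close>.\<close>

text \<open>If \<open>K\<close> were exactly \<open>a + b\<close>, the Temple map would be a translate of the shear
  \<open>(t, z) \<mapsto> (t + |z|, z)\<close>, which is a bi-Lipschitz homeomorphism, smooth off the axis. Near the
  origin \<open>K - (a + b)\<close> has a Lipschitz constant as small as desired, uniformly in all arguments.
  So the Temple map, composed with the inverse shear, differs from a translation by a map of
  Lipschitz constant \<open>1/2\<close>: it is injective and expanding up to a factor, and by the contraction
  principle its image contains a ball of a radius that depends on neither \<open>x\<close> nor \<open>\<tau>\<close>. This
  uniformity lets all the Temple charts near \<open>p\<close> cover one neighbourhood (\<open>near_additive\<close>,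
  \<open>temple_kernel\<close>, \<open>covering_temple_chart\<close>).\<close>

text \<open>Three supporting theories carry this. The flow of a smooth vector field depends smoothly
  on time and initial value (\<open>smooth_local_flow\<close>); it yields the exponential map, the geodesics
  and the frames. The inverse of a smooth map with injective derivatives is smooth
  (\<open>Ck_on_inverse_function\<close>), because its derivative solves a linear equation with smooth
  coefficients (\<open>Ck_on_linear_solve\<close>). Finally, the transformation law of the Christoffel
  symbols (\<open>christoffel_transformation\<close>) reduces statements about all charts of the atlas, as in
  the definitions of parallel fields and of geodesics, to the chosen chart, and
  \<open>geodesic_unique\<close> identifies the exponential map with the one built from the flow.\<close>

section \<open>Calculus of maps with continuous iterated derivatives\<close>

abbreviation fderiv :: "('a::euclidean_space \<Rightarrow> 'b::euclidean_space) \<Rightarrow> 'a \<Rightarrow> 'a \<Rightarrow> 'b" where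
  "fderiv f x \<equiv> frechet_derivative f (at x)"

lemma fderiv_eq: "(f has_derivative f') (at x) \<Longrightarrow> fderiv f x = f'"
  by (metis frechet_derivative_at)

lemma fderiv_cong:
  assumes "open S" "x \<in> S" "\<And>y. y \<in> S \<Longrightarrow> f y = g y"
  shows "f differentiable at x \<longleftrightarrow> g differentiable at x" "fderiv f x = fderiv g x"
proof -
  have *: "(f has_derivative D) (at x) \<longleftrightarrow> (g has_derivative D) (at x)" for D
    using assms has_derivative_transform_within_open[of f D x UNIV S g]
      has_derivative_transform_within_open[of g D x UNIV S f] by auto
  then show "f differentiable at x \<longleftrightarrow> g differentiable at x" "fderiv f x = fderiv g x"
    by (auto simp: differentiable_def frechet_derivative_def)
qed

lemma Ck_on_cong:
  "open S \<Longrightarrow> (\<And>x. x \<in> S \<Longrightarrow> f x = g x) \<Longrightarrow> Ck_on k S f \<longleftrightarrow> Ck_on k S g"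
proof (induction k arbitrary: f g)
  case 0
  then show ?case by (auto cong: continuous_on_cong)
next
  case (Suc k)
  have "fderiv f x v = fderiv g x v" "f differentiable at x \<longleftrightarrow> g differentiable at x" if "x \<in> S" for x v
    using fderiv_cong[OF Suc.prems(1) that, of f g] Suc.prems(2) by simp_all
  then show ?case
    using Suc.IH[OF Suc.prems(1), of "\<lambda>x. fderiv f x v" "\<lambda>x. fderiv g x v" for v] by auto
qed

lemma Ck_on_SucI:
  assumes "open S" "\<And>x. x \<in> S \<Longrightarrow> (f has_derivative f' x) (at x)"
    "\<And>v. Ck_on k S (\<lambda>x. f' x v)"
  shows "Ck_on (Suc k) S f"
proof -
  have "Ck_on k S (\<lambda>x. fderiv f x v)" for v
    using assms(3)[of v] Ck_on_cong[OF assms(1), of "\<lambda>x. fderiv f x v" "\<lambda>x. f' x v"] fderiv_eq[OF assms(2)]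
    by auto
  then show ?thesis using assms(2) by (auto simp: differentiable_def)
qed

lemma Ck_on_has_derivative: "Ck_on (Suc k) S f \<Longrightarrow> x \<in> S \<Longrightarrow> (f has_derivative fderiv f x) (at x)"
  by (auto simp: frechet_derivative_works)

lemma Ck_on_continuous: "Ck_on k S f \<Longrightarrow> continuous_on S f"
  by (cases k) (auto intro!: continuous_at_imp_continuous_on differentiable_imp_continuous_within)

lemma Ck_on_pred: "Ck_on (Suc k) S f \<Longrightarrow> Ck_on k S f"
proof (induction k arbitrary: f)
  case 0
  then show ?case using Ck_on_continuous[OF 0] by simp
next
  case (Suc k)
  then show ?case by (metis Ck_on.simps(2))
qed

lemma Ck_on_subset: "Ck_on k S f \<Longrightarrow> T \<subseteq> S \<Longrightarrow> Ck_on k T f"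
  by (induction k arbitrary: f) (auto intro: continuous_on_subset)

lemma Ck_on_local:
  assumes "\<And>x. x \<in> S \<Longrightarrow> \<exists>T. open T \<and> x \<in> T \<and> Ck_on k T f"
  shows "Ck_on k S f"
  using assms
proof (induction k arbitrary: f)
  case 0
  have "isCont f x" if "x \<in> S" for x
    using 0[OF that] by (auto simp: continuous_on_eq_continuous_at)
  then show ?case by (simp add: continuous_at_imp_continuous_on)
next
  case (Suc k)
  have "Ck_on k S (\<lambda>x. fderiv f x v)" for v
    by (rule Suc.IH) (use Suc.prems in force)
  moreover have "f differentiable at x" if "x \<in> S" for x
    using Suc.prems[OF that] by auto
  ultimately show ?case by simp
qed

lemma Ck_on_const [simp]: "Ck_on k S (\<lambda>x. c)"
  by (induction k arbitrary: c) auto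

lemma Ck_on_bounded_linear: "bounded_linear f \<Longrightarrow> Ck_on k S f"
proof (cases k)
  case 0
  then show "bounded_linear f \<Longrightarrow> Ck_on k S f" by (simp add: linear_continuous_on)
next
  case (Suc j)
  show "Ck_on k S f" if "bounded_linear f"
  proof -
    have "fderiv f x v = f v" for x v using fderiv_eq[OF bounded_linear_imp_has_derivative[OF that]] by metis
    then show ?thesis using Suc bounded_linear_imp_differentiable[OF that] by simp
  qed
qed

lemma Ck_on_add:
  assumes "open S"
  shows "Ck_on k S f \<Longrightarrow> Ck_on k S g \<Longrightarrow> Ck_on k S (\<lambda>x. f x + g x)"
proof (induction k arbitrary: f g)
  case 0
  then show ?case by (simp add: continuous_on_add)
next
  case (Suc k)
  have d: "Ck_on k S (\<lambda>x. fderiv f x v)" "Ck_on k S (\<lambda>x. fderiv g x v)" for v using Suc.prems by auto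
  show ?case
    by (rule Ck_on_SucI[OF assms, of _ "\<lambda>x v. fderiv f x v + fderiv g x v"])
      (auto intro!: has_derivative_add Ck_on_has_derivative[OF Suc.prems(1)] Ck_on_has_derivative[OF Suc.prems(2)] Suc.IH d)
qed

lemma Ck_on_bilinear:
  assumes "open S" "bounded_bilinear h"
  shows "Ck_on k S f \<Longrightarrow> Ck_on k S g \<Longrightarrow> Ck_on k S (\<lambda>x. h (f x) (g x))"
proof (induction k arbitrary: f g)
  case 0
  then show ?case by (simp add: bounded_bilinear.continuous_on[OF assms(2)])
next
  case (Suc k)
  have p: "Ck_on k S f" "Ck_on k S g" using Suc.prems Ck_on_pred by blast+
  have d: "Ck_on k S (\<lambda>x. fderiv f x v)" "Ck_on k S (\<lambda>x. fderiv g x v)" for v using Suc.prems by auto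
  show ?case
    by (rule Ck_on_SucI[OF assms(1), of _ "\<lambda>x v. h (f x) (fderiv g x v) + h (fderiv f x v) (g x)"])
     (auto intro!: bounded_bilinear.FDERIV[OF assms(2)] Ck_on_has_derivative[OF Suc.prems(1)] Ck_on_has_derivative[OF Suc.prems(2)]
        Ck_on_add[OF assms(1)] Suc.IH p d)
qed

lemma Ck_on_scaleR: "open S \<Longrightarrow> Ck_on k S f \<Longrightarrow> Ck_on k S g \<Longrightarrow> Ck_on k S (\<lambda>x. f x *\<^sub>R g x)"
  by (rule Ck_on_bilinear[OF _ bounded_bilinear_scaleR])

lemma Ck_on_inner: "open S \<Longrightarrow> Ck_on k S f \<Longrightarrow> Ck_on k S g \<Longrightarrow> Ck_on k S (\<lambda>x. f x \<bullet> g x)"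
  by (rule Ck_on_bilinear[OF _ bounded_bilinear_inner])

lemma Ck_on_mult:
  fixes f g :: "'a::euclidean_space \<Rightarrow> real"
  shows "open S \<Longrightarrow> Ck_on k S f \<Longrightarrow> Ck_on k S g \<Longrightarrow> Ck_on k S (\<lambda>x. f x * g x)"
  by (rule Ck_on_bilinear[OF _ bounded_bilinear_mult])

lemma Ck_on_sum: "open S \<Longrightarrow> (\<And>i. i \<in> I \<Longrightarrow> Ck_on k S (f i)) \<Longrightarrow> Ck_on k S (\<lambda>x. \<Sum>i\<in>I. f i x)"
  by (induction I rule: infinite_finite_induct) (auto intro: Ck_on_add)

lemma linear_basis_sum:
  fixes f :: "'a::euclidean_space \<Rightarrow> 'b::real_vector"
  assumes "linear f" shows "f x = (\<Sum>b\<in>Basis. (x \<bullet> b) *\<^sub>R f b)"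
proof -
  have "f x = f (\<Sum>b\<in>Basis. (x \<bullet> b) *\<^sub>R b)" by (simp add: euclidean_representation)
  also have "\<dots> = (\<Sum>b\<in>Basis. (x \<bullet> b) *\<^sub>R f b)" by (simp add: linear_sum[OF assms] linear_cmul[OF assms])
  finally show ?thesis .
qed

text \<open>In the standard basis the chain rule expresses a directional derivative of the composition
  through products of directional derivatives of the factors. All of these are maps between the
  spaces at hand, so the induction on the order never leaves the given types.\<close>

lemma Ck_on_compose:
  assumes "open S" "open T"
  shows "Ck_on k T f \<Longrightarrow> Ck_on k S g \<Longrightarrow> g ` S \<subseteq> T \<Longrightarrow> Ck_on k S (\<lambda>x. f (g x))"
proof (induction k arbitrary: f g)
  case 0
  then show ?case by (simp add: continuous_on_compose2[of T f S g])
next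
  case (Suc k)
  have p: "Ck_on k T f" "Ck_on k S g" using Suc.prems Ck_on_pred by blast+
  have d: "Ck_on k T (\<lambda>x. fderiv f x w)" "Ck_on k S (\<lambda>x. fderiv g x v)" for v w using Suc.prems by auto
  have hf: "(f has_derivative fderiv f (g x)) (at (g x))" if "x \<in> S" for x
    using Ck_on_has_derivative[OF Suc.prems(1)] Suc.prems(3) that by auto
  show ?case
  proof (rule Ck_on_SucI[OF assms(1)])
    show "((\<lambda>x. f (g x)) has_derivative (\<lambda>v. \<Sum>b\<in>Basis. (fderiv g x v \<bullet> b) *\<^sub>R fderiv f (g x) b)) (at x)" if "x \<in> S" for x
    proof -
      have 1: "((\<lambda>x. f (g x)) has_derivative (\<lambda>v. fderiv f (g x) (fderiv g x v))) (at x)"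
        using has_derivative_compose[OF Ck_on_has_derivative[OF Suc.prems(2) that] hf[OF that]] .
      have "fderiv f (g x) w = (\<Sum>b\<in>Basis. (w \<bullet> b) *\<^sub>R fderiv f (g x) b)" for w
        by (rule linear_basis_sum[OF has_derivative_linear[OF hf[OF that]]])
      from 1[unfolded this[of "fderiv g x _"]] show ?thesis .
    qed
    show "Ck_on k S (\<lambda>x. \<Sum>b\<in>Basis. (fderiv g x v \<bullet> b) *\<^sub>R fderiv f (g x) b)" for v
      using Suc.IH[OF d(1) p(2) Suc.prems(3)] d(2)[of v] assms(1)
      by (intro Ck_on_sum Ck_on_scaleR Ck_on_inner Ck_on_const)
  qed
qed

lemma Ck_on_linear_comp:
  "open S \<Longrightarrow> bounded_linear L \<Longrightarrow> Ck_on k S f \<Longrightarrow> Ck_on k S (\<lambda>x. L (f x))"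
  by (rule Ck_on_compose[of S UNIV k L]) (auto intro: Ck_on_bounded_linear)

lemma Ck_on_minus: "open S \<Longrightarrow> Ck_on k S f \<Longrightarrow> Ck_on k S (\<lambda>x. - f x)"
  by (rule Ck_on_linear_comp[OF _ bounded_linear_minus[OF bounded_linear_ident]])

lemma Ck_on_diff: "open S \<Longrightarrow> Ck_on k S f \<Longrightarrow> Ck_on k S g \<Longrightarrow> Ck_on k S (\<lambda>x. f x - g x)"
  using Ck_on_add[of S k f "\<lambda>x. - g x"] Ck_on_minus[of S k g] by simp

lemma Ck_on_Pair:
  assumes "open S" "Ck_on k S f" "Ck_on k S g" shows "Ck_on k S (\<lambda>x. (f x, g x))"
proof -
  have "bounded_linear (\<lambda>a. (a, 0))" "bounded_linear (\<lambda>a. (0, a))"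
    by (auto intro!: bounded_linear_Pair bounded_linear_ident bounded_linear_zero)
  from Ck_on_add[OF assms(1) Ck_on_linear_comp[OF assms(1) this(1) assms(2)] Ck_on_linear_comp[OF assms(1) this(2) assms(3)]]
  have "Ck_on k S (\<lambda>x. (f x, 0) + (0, g x))" .
  then show ?thesis by simp
qed

lemma Ck_on_inverse: "Ck_on k {x::real. x \<noteq> 0} inverse"
proof (induction k)
  case 0
  show ?case by (auto intro!: continuous_intros)
next
  case (Suc k)
  have o: "open {x::real. x \<noteq> 0}" by (simp add: open_Collect_neq)
  show ?case
  proof (rule Ck_on_SucI[OF o, of _ "\<lambda>x v. (- v) * (inverse x * inverse x)"])
    show "Ck_on k {x::real. x \<noteq> 0} (\<lambda>x. (- v) * (inverse x * inverse x))" for v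
      by (intro Ck_on_mult o Suc Ck_on_const)
  qed (auto intro!: derivative_eq_intros)
qed

lemma Ck_on_sqrt: "Ck_on k {0<..} sqrt"
proof (induction k)
  case 0
  show ?case by (auto intro!: continuous_intros)
next
  case (Suc k)
  have "Ck_on k {0<..} (\<lambda>x. inverse (sqrt x))"
    by (rule Ck_on_compose[of _ "{x. x \<noteq> 0}"]) (auto intro: Ck_on_inverse Suc simp: open_Collect_neq)
  then show ?case
    by (intro Ck_on_SucI[of _ _ "\<lambda>x v. (v/2) *\<^sub>R inverse (sqrt x)"] Ck_on_scaleR)
      (auto intro!: derivative_eq_intros simp: divide_simps)
qed

text \<open>Injectivity of a linear map is an open condition, with a quantitative lower bound that
  persists nearby.\<close>

lemma linear_eventually_bounded_below:
  fixes L :: "'p::euclidean_space \<Rightarrow> 'a::euclidean_space \<Rightarrow> 'b::euclidean_space"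
  assumes "open S" "y0 \<in> S" "\<And>y. y \<in> S \<Longrightarrow> linear (L y)" "inj (L y0)"
    and "\<And>w. continuous_on S (\<lambda>y. L y w)"
  obtains m where "m > 0" "\<forall>\<^sub>F y in at y0. \<forall>w. m * norm w \<le> norm (L y w)"
proof -
  obtain m where m: "m > 0" "\<And>w. m * norm w \<le> norm (L y0 w)"
    using linear_inj_bounded_below_pos[OF assms(3)[OF assms(2)] assms(4)] by blast
  define \<sigma> where "\<sigma> y = (\<Sum>b\<in>Basis. norm (L y b - L y0 b))" for y
  have c: "isCont (\<lambda>y. L y w) y0" for w
    using assms(1,2,5) continuous_on_eq_continuous_at by blast
  have "isCont \<sigma> y0" unfolding \<sigma>_def by (intro continuous_intros c)
  then have s0: "(\<sigma> \<longlongrightarrow> 0) (at y0)" by (simp add: isCont_def \<sigma>_def)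
  have b: "norm (L y w - L y0 w) \<le> norm w * \<sigma> y" if "y \<in> S" for y w
  proof -
    have "L y w - L y0 w = (\<Sum>b\<in>Basis. (w \<bullet> b) *\<^sub>R (L y b - L y0 b))"
      using linear_basis_sum[OF assms(3)[OF that], of w] linear_basis_sum[OF assms(3)[OF assms(2)], of w]
      by (simp add: scaleR_diff_right sum_subtractf)
    also have "norm \<dots> \<le> (\<Sum>b\<in>Basis. norm w * norm (L y b - L y0 b))"
      by (rule sum_norm_le) (auto intro!: mult_right_mono Basis_le_norm)
    finally show ?thesis by (simp add: \<sigma>_def sum_distrib_left)
  qed
  have "\<forall>\<^sub>F y in at y0. \<sigma> y < m/2" using order_tendstoD(2)[OF s0, of "m/2"] m by simp
  moreover have "\<forall>\<^sub>F y in at y0. y \<in> S" using assms(1,2) eventually_at_topological by blast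
  ultimately have "\<forall>\<^sub>F y in at y0. \<forall>w. (m/2) * norm w \<le> norm (L y w)"
  proof eventually_elim
    case (elim y)
    show ?case
    proof
      fix w
      have "norm (L y w - L y0 w) \<le> norm w * (m/2)"
        using order_trans[OF b[OF elim(2), of w] mult_left_mono[of "\<sigma> y" "m/2" "norm w"]] elim(1) by simp
      moreover have "norm (L y0 w) \<le> norm (L y w) + norm (L y w - L y0 w)"
        by (metis add.commute norm_minus_commute norm_triangle_sub)
      ultimately show "(m/2) * norm w \<le> norm (L y w)" using m(2)[of w] by (simp add: algebra_simps)
    qed
  qed
  with that[of "m/2"] m show ?thesis by simp
qed

text \<open>A product of two quantities that vanish at a point has derivative zero there as soon as
  one of them is differentiable and the other continuous.\<close>

lemma has_derivative_zero_times:
  fixes f :: "'a::euclidean_space \<Rightarrow> 'b::euclidean_space"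
  assumes "(f has_derivative f') (at x)" "f x = 0" "(c \<longlongrightarrow> (0::real)) (at x)" "c x = 0"
  shows "((\<lambda>y. c y *\<^sub>R f y) has_derivative (\<lambda>_. 0)) (at x)"
  unfolding has_derivative_at_alt
proof (intro conjI allI impI)
  fix e :: real assume e: "0 < e"
  have bl: "bounded_linear f'" using assms(1) has_derivative_bounded_linear by blast
  define B where "B = onorm f' + 1"
  have B: "B > 0" using onorm_pos_le[OF bl] by (simp add: B_def)
  obtain d1 where d1: "d1 > 0" "\<And>y. norm (y - x) < d1 \<Longrightarrow> norm (f y - f x - f' (y - x)) \<le> 1 * norm (y - x)"
    using assms(1) unfolding has_derivative_at_alt by (meson zero_less_one)
  have "\<forall>\<^sub>F y in at x. \<bar>c y\<bar> < e / B" using assms(3) e B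
    by (auto dest!: tendstoD[of _ _ _ "e/B"] simp: dist_real_def)
  then obtain d2 where d2: "d2 > 0" "\<And>y. y \<noteq> x \<Longrightarrow> dist y x < d2 \<Longrightarrow> \<bar>c y\<bar> < e / B"
    unfolding eventually_at by auto
  have "norm (c y *\<^sub>R f y) \<le> e * norm (y - x)" if y: "norm (y - x) < min d1 d2" for y
  proof (cases "y = x")
    case False
    have "norm (f y) \<le> norm (f' (y - x)) + norm (y - x)"
      using d1(2)[of y] y norm_triangle_sub[of "f y" "f' (y-x)"] assms(2) by simp
    also have "\<dots> \<le> B * norm (y - x)" using onorm[OF bl, of "y - x"] by (simp add: B_def algebra_simps)
    finally have "\<bar>c y\<bar> * norm (f y) \<le> (e / B) * (B * norm (y - x))"
      using d2(2)[OF False] y by (intro mult_mono) (auto simp: dist_norm)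
    then show ?thesis using B by simp
  qed (simp add: assms)
  then show "\<exists>d>0. \<forall>y. norm (y - x) < d \<longrightarrow> norm (c y *\<^sub>R f y - c x *\<^sub>R f x - 0) \<le> e * norm (y - x)"
    using d1(1) d2(1) assms by (intro exI[of _ "min d1 d2"]) auto
qed simp

lemma linear_solve_continuous:
  fixes L :: "'p::euclidean_space \<Rightarrow> 'a::euclidean_space \<Rightarrow> 'b::euclidean_space"
  assumes S: "open S" and lin: "\<And>y. y \<in> S \<Longrightarrow> linear (L y)" and inj: "\<And>y. y \<in> S \<Longrightarrow> inj (L y)"
    and L: "\<And>w. continuous_on S (\<lambda>y. L y w)" and b: "continuous_on S b"
    and z: "\<And>y. y \<in> S \<Longrightarrow> L y (z y) = b y"
  shows "continuous_on S z"
proof (rule continuous_at_imp_continuous_on, rule ballI)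
  fix y0 assume y0: "y0 \<in> S"
  obtain m where m: "m > 0" "\<forall>\<^sub>F y in at y0. \<forall>w. m * norm w \<le> norm (L y w)"
    by (rule linear_eventually_bounded_below[where L=L, OF S y0 lin inj[OF y0] L]) (assumption | rule that)+
  have "isCont b y0" "isCont (\<lambda>y. L y (z y0)) y0"
    using S y0 L b continuous_on_eq_continuous_at by blast+
  then have "isCont (\<lambda>y. norm (b y - L y (z y0)) / m) y0" using m(1) by (intro continuous_intros) auto
  then have "((\<lambda>y. norm (b y - L y (z y0)) / m) \<longlongrightarrow> 0) (at y0)" using z[OF y0] by (simp add: isCont_def)
  moreover have "\<forall>\<^sub>F y in at y0. norm (z y - z y0) \<le> norm (b y - L y (z y0)) / m"
  proof -
    have "\<forall>\<^sub>F y in at y0. y \<in> S" using S y0 eventually_at_topological by blast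
    with m(2) show ?thesis
    proof eventually_elim
      case (elim y)
      have e: "L y (z y - z y0) = b y - L y (z y0)" using z lin elim(2) by (simp add: linear_diff)
      show ?case using elim(1)[rule_format, of "z y - z y0"] m(1) unfolding e by (simp add: field_simps)
    qed
  qed
  ultimately have "((\<lambda>y. z y - z y0) \<longlongrightarrow> 0) (at y0)" by (rule Lim_null_comparison[rotated])
  then show "isCont z y0" using isCont_def LIM_zero_iff by blast
qed

text \<open>Differentiating \<open>L y (z y) = b y\<close> shows that a derivative of \<open>z\<close> solves a linear equation
  with the same coefficients \<open>L\<close> and with a right-hand side that involves \<open>z\<close> itself but none of
  its derivatives. This is what makes an induction over arbitrary right-hand sides work, and the
  induction replaces Cramer's rule.\<close>

lemma Ck_on_linear_solve:
  fixes L :: "'p::euclidean_space \<Rightarrow> 'a::euclidean_space \<Rightarrow> 'a"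
  assumes S: "open S" and lin: "\<And>y. y \<in> S \<Longrightarrow> linear (L y)" and inj: "\<And>y. y \<in> S \<Longrightarrow> inj (L y)"
  shows "(\<And>w. Ck_on k S (\<lambda>y. L y w)) \<Longrightarrow> Ck_on k S b \<Longrightarrow> (\<And>y. y \<in> S \<Longrightarrow> L y (z y) = b y) \<Longrightarrow> Ck_on k S z"
proof (induction k arbitrary: b z)
  case 0
  then show ?case using linear_solve_continuous[OF S lin inj, where b=b and z=z] by simp
next
  case (Suc k)
  have cz: "continuous_on S z"
    by (rule linear_solve_continuous[OF S lin inj Ck_on_continuous[OF Suc.prems(1)] Ck_on_continuous[OF Suc.prems(2)] Suc.prems(3)])
  have p: "Ck_on k S (\<lambda>y. L y w)" "Ck_on k S b" for w using Suc.prems(1,2) Ck_on_pred by blast+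
  have ckz: "Ck_on k S z" by (rule Suc.IH[OF p Suc.prems(3)])
  define I where "I y = inv (L y)" for y
  have I: "linear (I y)" "L y (I y w) = w" "I y (L y w) = w" if "y \<in> S" for y w
    unfolding I_def
    by (rule inj_linear_imp_inv_linear[OF lin[OF that] inj[OF that]],
        rule surj_f_inv_f[OF linear_inj_imp_surj[OF lin[OF that] inj[OF that]]],
        rule inv_f_f[OF inj[OF that]])
  define R where "R y v = fderiv b y v - (\<Sum>c\<in>Basis. (z y \<bullet> c) *\<^sub>R fderiv (\<lambda>y. L y c) y v)" for y v
  have Ck_R: "Ck_on k S (\<lambda>y. R y v)" for v
  proof -
    have "Ck_on k S (\<lambda>y. fderiv b y v)" "Ck_on k S (\<lambda>y. fderiv (\<lambda>y. L y c) y v)" for c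
      using Suc.prems(1,2) by auto
    then show ?thesis unfolding R_def
      by (intro Ck_on_diff S Ck_on_sum Ck_on_scaleR Ck_on_inner ckz Ck_on_const)
  qed
  have der: "(z has_derivative (\<lambda>v. I y0 (R y0 v))) (at y0)" if y0: "y0 \<in> S" for y0
  proof -
    \<comment> \<open>Freezing the coefficients at \<open>y0\<close> leaves an error that is a sum of products of two
      quantities vanishing at \<open>y0\<close>.\<close>
    have eq: "z y = z y0 + I y0 (b y - (\<Sum>c\<in>Basis. (z y0 \<bullet> c) *\<^sub>R L y c)
        - (\<Sum>c\<in>Basis. ((z y - z y0) \<bullet> c) *\<^sub>R (L y c - L y0 c)))" if "y \<in> S" for y
    proof -
      have "(\<Sum>c\<in>Basis. (z y0 \<bullet> c) *\<^sub>R L y c) = L y (z y0)" "(\<Sum>c\<in>Basis. ((z y - z y0) \<bullet> c) *\<^sub>R (L y c - L y0 c)) = L y (z y - z y0) - L y0 (z y - z y0)"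
        unfolding linear_basis_sum[OF lin[OF that], of "z y0"] linear_basis_sum[OF lin[OF that], of "z y - z y0"]
          linear_basis_sum[OF lin[OF y0], of "z y - z y0"]
        by (simp_all add: scaleR_diff_right sum_subtractf)
      then have "b y - (\<Sum>c\<in>Basis. (z y0 \<bullet> c) *\<^sub>R L y c)
        - (\<Sum>c\<in>Basis. ((z y - z y0) \<bullet> c) *\<^sub>R (L y c - L y0 c)) = L y0 (z y - z y0)"
        using Suc.prems(3)[OF that] lin[OF that] by (simp add: linear_diff)
      then show ?thesis using I(3)[OF y0] by simp
    qed
    have dL: "((\<lambda>y. L y c) has_derivative fderiv (\<lambda>y. L y c) y0) (at y0)" for c
      by (rule Ck_on_has_derivative[OF Suc.prems(1) y0])
    have cont: "isCont z y0" using cz S y0 continuous_on_eq_continuous_at by blast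
    have "((\<lambda>y. ((z y - z y0) \<bullet> c) *\<^sub>R (L y c - L y0 c)) has_derivative (\<lambda>_. 0)) (at y0)" for c
    proof (rule has_derivative_zero_times)
      show "((\<lambda>y. L y c - L y0 c) has_derivative fderiv (\<lambda>y. L y c) y0) (at y0)"
        using has_derivative_diff[OF dL has_derivative_const] by simp
      have "isCont (\<lambda>y. (z y - z y0) \<bullet> c) y0" by (intro continuous_intros cont)
      then show "((\<lambda>y. (z y - z y0) \<bullet> c) \<longlongrightarrow> 0) (at y0)" by (simp add: isCont_def)
    qed simp_all
    then have s0: "((\<lambda>y. \<Sum>c\<in>Basis. ((z y - z y0) \<bullet> c) *\<^sub>R (L y c - L y0 c)) has_derivative (\<lambda>_. \<Sum>c\<in>(Basis::'a set). 0)) (at y0)"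
      by (rule has_derivative_sum)
    have s1: "((\<lambda>y. \<Sum>c\<in>Basis. (z y0 \<bullet> c) *\<^sub>R L y c) has_derivative (\<lambda>v. \<Sum>c\<in>Basis. (z y0 \<bullet> c) *\<^sub>R fderiv (\<lambda>y. L y c) y0 v)) (at y0)"
      by (intro has_derivative_sum has_derivative_scaleR_right dL)
    have bI: "bounded_linear (I y0)" using I(1)[OF y0] by (simp add: linear_conv_bounded_linear)
    have "((\<lambda>y. z y0 + I y0 (b y - (\<Sum>c\<in>Basis. (z y0 \<bullet> c) *\<^sub>R L y c)
        - (\<Sum>c\<in>Basis. ((z y - z y0) \<bullet> c) *\<^sub>R (L y c - L y0 c)))) has_derivative
        (\<lambda>v. 0 + I y0 (fderiv b y0 v - (\<Sum>c\<in>Basis. (z y0 \<bullet> c) *\<^sub>R fderiv (\<lambda>y. L y c) y0 v) - (\<Sum>c\<in>(Basis::'a set). 0)))) (at y0)"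
      by (intro has_derivative_add has_derivative_const bounded_linear.has_derivative[OF bI] has_derivative_diff s0 s1
          Ck_on_has_derivative[OF Suc.prems(2) y0])
    then have "((\<lambda>y. z y0 + I y0 (b y - (\<Sum>c\<in>Basis. (z y0 \<bullet> c) *\<^sub>R L y c)
        - (\<Sum>c\<in>Basis. ((z y - z y0) \<bullet> c) *\<^sub>R (L y c - L y0 c)))) has_derivative (\<lambda>v. I y0 (R y0 v))) (at y0)"
      by (simp add: R_def)
    then show ?thesis
      by (rule has_derivative_transform_within_open[OF _ S y0]) (use eq in metis)
  qed
  show ?case
  proof (rule Ck_on_SucI[OF S der])
    show "Ck_on k S (\<lambda>y. I y (R y v))" for v
      by (rule Suc.IH[OF p(1) Ck_R[of v]]) (simp add: I)
  qed
qed

text \<open>The derivative of the inverse \<open>g\<close> in direction \<open>v\<close> solves the linear equation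
  \<open>fderiv f (g y) w = v\<close> for \<open>w\<close>, so that \<open>g\<close> gains one order of differentiability from its own
  regularity.\<close>

lemma Ck_on_inverse_function:
  fixes f :: "'a::euclidean_space \<Rightarrow> 'a"
  assumes S: "open S" and T: "open T" and f: "\<And>k. Ck_on k S f" and inj: "\<And>x. x \<in> S \<Longrightarrow> inj (fderiv f x)"
    and g: "continuous_on T g" "g ` T \<subseteq> S" "\<And>y. y \<in> T \<Longrightarrow> f (g y) = y"
  shows "Ck_on k T g"
proof (induction k)
  case 0
  then show ?case using g by simp
next
  case (Suc k)
  have df: "(f has_derivative fderiv f x) (at x)" if "x \<in> S" for x
    using Ck_on_has_derivative[OF f that] .
  have lin: "linear (fderiv f x)" if "x \<in> S" for x using df[OF that] has_derivative_linear by blast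
  show ?case
  proof (rule Ck_on_SucI[OF T])
    fix y assume y: "y \<in> T"
    then have x: "g y \<in> S" using g(2) by auto
    have iv: "bounded_linear (inv (fderiv f (g y)))" "inv (fderiv f (g y)) \<circ> fderiv f (g y) = id"
      using inj[OF x] lin[OF x] by (auto simp: linear_conv_bounded_linear[symmetric] linear_inj_imp_surj inj_linear_imp_inv_linear)
    then show "(g has_derivative inv (fderiv f (g y))) (at y)"
      using g(1,3) T y continuous_on_eq_continuous_at by (intro has_derivative_inverse_basic[where g=g and f=f and T=T, OF df[OF x] iv]) auto
  next
    fix v
    have "Ck_on k T (\<lambda>y. fderiv f (g y) w)" for w
      using f[of "Suc k"] by (intro Ck_on_compose[OF T S _ Suc g(2), where f="\<lambda>x. fderiv f x w"]) auto
    then show "Ck_on k T (\<lambda>y. inv (fderiv f (g y)) v)"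
    proof (rule Ck_on_linear_solve[OF T, rotated 2])
      show "Ck_on k T (\<lambda>y. v)" by simp
      fix y assume "y \<in> T"
      then have gy: "g y \<in> S" using g(2) by auto
      show "linear (fderiv f (g y))" "inj (fderiv f (g y))" by (rule lin[OF gy], rule inj[OF gy])
      show "fderiv f (g y) (inv (fderiv f (g y)) v) = v"
        by (rule surj_f_inv_f[OF linear_inj_imp_surj[OF lin[OF gy] inj[OF gy]]])
    qed
  qed
qed

section \<open>Second derivatives, uniform linearization and perturbations of the identity\<close>

lemma vector_mean_value_bound:
  fixes \<phi> :: "real \<Rightarrow> 'a::real_normed_vector"
  assumes "a \<le> b" "\<And>s. s \<in> {a..b} \<Longrightarrow> (\<phi> has_vector_derivative \<phi>' s) (at s within {a..b})"
    "\<And>s. s \<in> {a..b} \<Longrightarrow> norm (\<phi>' s) \<le> B"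
  shows "norm (\<phi> b - \<phi> a) \<le> B * (b - a)"
proof -
  have "norm (\<phi> b - \<phi> a) \<le> B * norm (b - a)"
  proof (rule differentiable_bound[of "{a..b}" \<phi> "\<lambda>s x. x *\<^sub>R \<phi>' s"])
    show "onorm (\<lambda>x. x *\<^sub>R \<phi>' s) \<le> B" if "s \<in> {a..b}" for s
      using assms(3)[OF that] by (simp add: onorm_scaleR_left onorm_id bounded_linear_ident)
  qed (use assms in \<open>auto simp: has_vector_derivative_def\<close>)
  then show ?thesis using assms(1) by simp
qed

lemma has_vector_derivative_along_line:
  assumes "(f has_derivative f') (at (a + s *\<^sub>R v))"
  shows "((\<lambda>s. f (a + s *\<^sub>R v)) has_vector_derivative f' v) (at s within X)"
proof -
  have 1: "((\<lambda>s. a + s *\<^sub>R v) has_derivative (\<lambda>h. h *\<^sub>R v)) (at s within X)"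
    by (auto intro!: derivative_eq_intros)
  have "((\<lambda>s. f (a + s *\<^sub>R v)) has_derivative (\<lambda>h. f' (h *\<^sub>R v))) (at s within X)"
    using has_derivative_compose[OF 1 assms] .
  then show ?thesis
    using linear_cmul[OF has_derivative_linear[OF assms]] by (simp add: has_vector_derivative_def)
qed

text \<open>The second difference of \<open>f\<close> over the parallelogram spanned by \<open>h v\<close> and \<open>h w\<close> is the
  increment of \<open>s \<mapsto> f (x + s v + h w) - f (x + s v)\<close> over \<open>{0..h}\<close>; the mean value theorem
  compares it with the increment of the derivative of \<open>f\<close> in direction \<open>v\<close>, which is \<open>h A w\<close> up
  to a small multiple of \<open>h\<close>.\<close>

lemma second_difference_estimate:
  fixes f :: "'a::euclidean_space \<Rightarrow> 'b::euclidean_space"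
  assumes S: "open S" "x \<in> S" and f: "\<And>y. y \<in> S \<Longrightarrow> f differentiable at y"
    and A: "((\<lambda>y. fderiv f y v) has_derivative A) (at x)" and e: "0 < e"
  shows "\<forall>\<^sub>F h in at_right 0. norm (f (x + h *\<^sub>R v + h *\<^sub>R w) - f (x + h *\<^sub>R v) - f (x + h *\<^sub>R w) + f x - h\<^sup>2 *\<^sub>R A w) \<le> e * h\<^sup>2"
proof -
  define M where "M = 2 * (norm v + norm w) + 1"
  have M: "M > 0" by (auto simp: M_def intro!: add_nonneg_pos)
  obtain d where d: "d > 0" "\<And>y. norm (y - x) < d \<Longrightarrow> norm (fderiv f y v - fderiv f x v - A (y - x)) \<le> (e / M) * norm (y - x)"
    using A e M unfolding has_derivative_at_alt by (meson divide_pos_pos)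
  obtain r where r: "r > 0" "ball x r \<subseteq> S" using S openE by blast
  have linA: "linear A" using A has_derivative_linear by blast
  have "norm (f (x + h *\<^sub>R v + h *\<^sub>R w) - f (x + h *\<^sub>R v) - f (x + h *\<^sub>R w) + f x - h\<^sup>2 *\<^sub>R A w) \<le> e * h\<^sup>2"
    if h: "0 < h" "h < min d r / M" for h
  proof -
    have hM: "h * M < d" "h * M < r" using h M by (auto simp: field_simps)
    have small: "norm ((s *\<^sub>R v + c *\<^sub>R w)) \<le> h * (norm v + norm w)" if "s \<in> {0..h}" "c \<in> {0..h}" for s c
    proof -
      have "norm (s *\<^sub>R v + c *\<^sub>R w) \<le> s * norm v + c * norm w"
        using norm_triangle_ineq[of "s *\<^sub>R v" "c *\<^sub>R w"] that by simp
      also have "\<dots> \<le> h * norm v + h * norm w" using that by (intro add_mono mult_right_mono) auto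
      finally show ?thesis by (simp add: algebra_simps)
    qed
    have lt: "h * (norm v + norm w) < h * M" using h(1) by (simp add: M_def add_nonneg_pos)
    have inS: "x + s *\<^sub>R v + c *\<^sub>R w \<in> S" and near: "norm ((x + s *\<^sub>R v + c *\<^sub>R w) - x) < d"
      if "s \<in> {0..h}" "c \<in> {0..h}" for s c
    proof -
      have "norm ((x + s *\<^sub>R v + c *\<^sub>R w) - x) < min d r" using small[OF that] lt hM by (simp add: algebra_simps)
      then show "x + s *\<^sub>R v + c *\<^sub>R w \<in> S" "norm ((x + s *\<^sub>R v + c *\<^sub>R w) - x) < d"
        using r(2) by (auto simp: dist_norm norm_minus_commute subset_iff)
    qed
    define \<phi> where "\<phi> s = f ((x + h *\<^sub>R w) + s *\<^sub>R v) - f (x + s *\<^sub>R v) - (s * h) *\<^sub>R A w" for s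
    define \<phi>' where "\<phi>' s = fderiv f ((x + h *\<^sub>R w) + s *\<^sub>R v) v - fderiv f (x + s *\<^sub>R v) v - h *\<^sub>R A w" for s
    have "norm (\<phi> h - \<phi> 0) \<le> (e * h) * (h - 0)"
    proof (rule vector_mean_value_bound)
      fix s assume s: "s \<in> {0..h}"
      have i: "(x + h *\<^sub>R w) + s *\<^sub>R v \<in> S" "x + s *\<^sub>R v \<in> S"
        using inS[OF s, of h] inS[OF s, of 0] h by (simp_all add: algebra_simps)
      have dd: "(f has_derivative fderiv f y) (at y)" if "y \<in> S" for y using f[OF that] by (simp add: frechet_derivative_works)
      show "(\<phi> has_vector_derivative \<phi>' s) (at s within {0..h})"
        unfolding \<phi>_def \<phi>'_def
        by (intro has_vector_derivative_diff has_vector_derivative_along_line dd i)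
          (auto intro!: derivative_eq_intros simp: has_vector_derivative_def)
      have n: "norm (fderiv f (x + s *\<^sub>R v + c *\<^sub>R w) v - fderiv f x v - A (s *\<^sub>R v + c *\<^sub>R w)) \<le> (e / M) * (h * (norm v + norm w))"
        if c: "c \<in> {0..h}" for c
      proof -
        have "norm (fderiv f (x + s *\<^sub>R v + c *\<^sub>R w) v - fderiv f x v - A (s *\<^sub>R v + c *\<^sub>R w)) \<le> (e / M) * norm (s *\<^sub>R v + c *\<^sub>R w)"
          using d(2)[OF near[OF s c]] by (simp add: algebra_simps)
        also have "\<dots> \<le> (e / M) * (h * (norm v + norm w))" using small[OF s c] e M by (intro mult_left_mono) auto
        finally show ?thesis .
      qed
      have "\<phi>' s = (fderiv f (x + s *\<^sub>R v + h *\<^sub>R w) v - fderiv f x v - A (s *\<^sub>R v + h *\<^sub>R w))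
          - (fderiv f (x + s *\<^sub>R v + 0 *\<^sub>R w) v - fderiv f x v - A (s *\<^sub>R v + 0 *\<^sub>R w))"
        by (simp add: \<phi>'_def linear_add[OF linA] linear_cmul[OF linA] algebra_simps)
      also have "norm \<dots> \<le> (e / M) * (h * (norm v + norm w)) + (e / M) * (h * (norm v + norm w))"
        using h by (intro norm_triangle_le_diff add_mono n) auto
      also have "\<dots> = (e / M) * (h * (2 * (norm v + norm w)))" by (simp add: algebra_simps)
      also have "\<dots> \<le> (e / M) * (h * M)" using e M h by (intro mult_left_mono) (auto simp: M_def)
      finally show "norm (\<phi>' s) \<le> e * h" using M by simp
    qed (use h in simp)
    then show ?thesis by (simp add: \<phi>_def power2_eq_square algebra_simps)
  qed
  moreover have "min d r / M > 0" using d r M by simp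
  ultimately show ?thesis unfolding eventually_at_right_field by blast
qed

text \<open>The second difference is symmetric in \<open>v\<close> and \<open>w\<close>, hence so is its limit.\<close>

lemma second_derivative_symmetric:
  fixes f :: "'a::euclidean_space \<Rightarrow> 'b::euclidean_space"
  assumes S: "open S" "x \<in> S" and f: "Ck_on (Suc (Suc 0)) S f"
  shows "fderiv (\<lambda>y. fderiv f y v) x w = fderiv (\<lambda>y. fderiv f y w) x v"
proof (rule ccontr)
  assume ne: "\<not> ?thesis"
  define A where "A = fderiv (\<lambda>y. fderiv f y v) x w"
  define B where "B = fderiv (\<lambda>y. fderiv f y w) x v"
  define e where "e = norm (A - B) / 4"
  have e: "e > 0" using ne by (simp add: e_def A_def B_def)
  have d: "f differentiable at y" if "y \<in> S" for y using f that by simp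
  have d2: "((\<lambda>y. fderiv f y u) has_derivative fderiv (\<lambda>y. fderiv f y u) x) (at x)" for u
    using f S(2) by (simp add: frechet_derivative_works)
  have est: "\<forall>\<^sub>F h in at_right 0. norm (f (x + h *\<^sub>R v + h *\<^sub>R w) - f (x + h *\<^sub>R v) - f (x + h *\<^sub>R w) + f x
      - h\<^sup>2 *\<^sub>R fderiv (\<lambda>y. fderiv f y v) x w) \<le> e * h\<^sup>2" for v w
    by (rule second_difference_estimate[OF S d d2 e])
  have "\<forall>\<^sub>F h in at_right (0::real). False"
    using est[of v w] est[of w v] eventually_at_right_less[of "0::real"]
  proof eventually_elim
    case (elim h)
    let ?Q = "f (x + h *\<^sub>R v + h *\<^sub>R w) - f (x + h *\<^sub>R v) - f (x + h *\<^sub>R w) + f x"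
    have 1: "norm (?Q - h\<^sup>2 *\<^sub>R A) \<le> e * h\<^sup>2" using elim(1) by (simp add: A_def)
    have "f (x + h *\<^sub>R w + h *\<^sub>R v) - f (x + h *\<^sub>R w) - f (x + h *\<^sub>R v) + f x = ?Q" by (simp add: algebra_simps)
    then have 2: "norm (?Q - h\<^sup>2 *\<^sub>R B) \<le> e * h\<^sup>2" using elim(2) unfolding B_def by metis
    have "norm (h\<^sup>2 *\<^sub>R (A - B)) = norm ((?Q - h\<^sup>2 *\<^sub>R B) - (?Q - h\<^sup>2 *\<^sub>R A))" by (simp add: algebra_simps)
    also have "\<dots> \<le> e * h\<^sup>2 + e * h\<^sup>2" by (rule norm_triangle_le_diff[OF add_mono[OF 2 1]])
    finally have "h\<^sup>2 * (4 * e) \<le> h\<^sup>2 * (2 * e)"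
      unfolding norm_scaleR by (simp add: e_def)
    then show False using elim(3) e by simp
  qed
  then show False by simp
qed

lemma linear_norm_le_basis_sum:
  fixes L :: "'a::euclidean_space \<Rightarrow> 'b::real_normed_vector"
  assumes "linear L" shows "norm (L v) \<le> (\<Sum>b\<in>Basis. norm (L b)) * norm v"
proof -
  have "norm (L v) \<le> (\<Sum>b\<in>Basis. norm v * norm (L b))"
    unfolding linear_basis_sum[OF assms, of v] by (rule sum_norm_le) (auto intro!: mult_right_mono Basis_le_norm)
  then show ?thesis by (simp add: sum_distrib_left mult.commute)
qed

text \<open>On a compact set a continuously differentiable map is strictly differentiable with one
  radius for all points, by uniform continuity of the partial derivatives on a compact
  neighbourhood. Both the differentiability of flows and the comparison of the Temple map with a
  shear rest on this.\<close>

lemma C1_strict_derivative_uniform: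
  fixes h :: "'a::euclidean_space \<Rightarrow> 'b::euclidean_space"
  assumes D: "open D" "Ck_on (Suc 0) D h" and C: "compact C" "C \<subseteq> D" and e: "0 < e"
  obtains \<eta> where "\<eta> > 0" "\<And>x. x \<in> C \<Longrightarrow> ball x \<eta> \<subseteq> D"
    "\<And>x y z. x \<in> C \<Longrightarrow> y \<in> ball x \<eta> \<Longrightarrow> z \<in> ball x \<eta> \<Longrightarrow>
      norm (h y - h z - fderiv h x (y - z)) \<le> e * norm (y - z)"
proof -
  obtain r where r: "r > 0" "(\<Union>x\<in>C. cball x r) \<subseteq> D"
    using compact_subset_open_imp_cball_epsilon_subset[OF C(1) D(1) C(2)] by blast
  define C' where "C' = (\<Union>x\<in>C. cball x r)"
  have eqC: "C' = {x + y |x y. x \<in> C \<and> y \<in> cball 0 r}"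
  proof (intro set_eqI iffI)
    fix z assume "z \<in> C'"
    then obtain x where x: "x \<in> C" "dist x z \<le> r" by (auto simp: C'_def)
    then have "z = x + (z - x)" "z - x \<in> cball 0 r" by (auto simp: dist_norm norm_minus_commute)
    then show "z \<in> {x + y |x y. x \<in> C \<and> y \<in> cball 0 r}" using x(1) by blast
  next
    fix z assume "z \<in> {x + y |x y. x \<in> C \<and> y \<in> cball 0 r}"
    then obtain x y where "x \<in> C" "norm y \<le> r" "z = x + y" by auto
    then show "z \<in> C'" by (auto simp: C'_def dist_norm intro!: bexI[of _ x])
  qed
  have C': "compact C'" unfolding eqC by (rule compact_sums[OF C(1) compact_cball])
  define N where "N = real DIM('a)"
  have N: "N > 0" by (simp add: N_def)
  have "\<exists>\<eta>>0. \<forall>x\<in>C'. \<forall>y\<in>C'. dist y x < \<eta> \<longrightarrow> dist (fderiv h y b) (fderiv h x b) < e / N" for b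
  proof -
    have "continuous_on C' (\<lambda>x. fderiv h x b)"
      using D(2) r(2) by (auto simp: C'_def intro: continuous_on_subset)
    from compact_uniformly_continuous[OF this C'] show ?thesis
      unfolding uniformly_continuous_on_def by (elim allE[of _ "e / N"]) (simp add: e N)
  qed
  then obtain \<eta>0 where \<eta>0: "\<And>b. \<eta>0 b > 0"
    "\<And>b x y. x \<in> C' \<Longrightarrow> y \<in> C' \<Longrightarrow> dist y x < \<eta>0 b \<Longrightarrow> dist (fderiv h y b) (fderiv h x b) < e / N"
    by metis
  define \<eta> where "\<eta> = Min (insert r (\<eta>0 ` Basis))"
  have "\<eta> \<le> \<eta>0 b" if "b \<in> Basis" for b unfolding \<eta>_def by (rule Min_le) (use that in auto)
  then have \<eta>: "\<eta> > 0" "\<eta> \<le> r" "\<And>b. b \<in> Basis \<Longrightarrow> \<eta> \<le> \<eta>0 b" using r(1) \<eta>0(1) by (auto simp: \<eta>_def)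
  have sub: "ball x \<eta> \<subseteq> C'" if "x \<in> C" for x using that \<eta>(2) by (auto simp: C'_def)
  have der: "(h has_derivative fderiv h y) (at y)" if "y \<in> D" for y
    using Ck_on_has_derivative[OF D(2) that] .
  have CD: "C' \<subseteq> D" using r(2) by (simp add: C'_def)
  show ?thesis
  proof (rule that[OF \<eta>(1)])
    show "ball x \<eta> \<subseteq> D" if "x \<in> C" for x using sub[OF that] CD by blast
    fix x y z assume x: "x \<in> C" and y: "y \<in> ball x \<eta>" "z \<in> ball x \<eta>"
    have linx: "linear (fderiv h y)" if "y \<in> C'" for y using der that CD has_derivative_linear by blast
    have xC: "x \<in> C'" using sub[OF x] \<eta>(1) by auto
    have "norm (h y - h z - fderiv h x (y - z)) \<le> norm (y - z) * e"
    proof (rule differentiable_bound_linearization[where S="ball x \<eta>"])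
      show "z + t *\<^sub>R (y - z) \<in> ball x \<eta>" if "t \<in> {0..1}" for t
        using convexD_alt[OF convex_ball y(2,1), of t] that by (simp add: algebra_simps)
      show "(h has_derivative fderiv h u) (at u within ball x \<eta>)" if "u \<in> ball x \<eta>" for u
        using der sub[OF x] CD that has_derivative_at_withinI by blast
      show "onorm (fderiv h u - fderiv h x) \<le> e" if u: "u \<in> ball x \<eta>" for u
      proof (rule onorm_le)
        fix v
        have uC: "u \<in> C'" using sub[OF x] u by auto
        have "norm ((fderiv h u - fderiv h x) b) \<le> e / N" if "b \<in> Basis" for b
          using \<eta>0(2)[OF xC uC, of b] \<eta>(3)[OF that] u by (auto simp: dist_norm norm_minus_commute)
        then have "(\<Sum>b\<in>Basis. norm ((fderiv h u - fderiv h x) b)) \<le> (\<Sum>b\<in>(Basis::'a set). e / N)" by (rule sum_mono)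
        also have "\<dots> = e" using N by (simp add: N_def)
        finally have s: "(\<Sum>b\<in>Basis. norm ((fderiv h u - fderiv h x) b)) \<le> e" .
        have "linear (fderiv h u - fderiv h x)" using linear_compose_sub[OF linx[OF uC] linx[OF xC]] by (simp add: fun_diff_def)
        from linear_norm_le_basis_sum[OF this, of v] s
        show "norm ((fderiv h u - fderiv h x) v) \<le> e * norm v"
          using mult_right_mono[OF s, of "norm v"] by simp
      qed
      show "x \<in> ball x \<eta>" using \<eta>(1) by simp
    qed
    then show "norm (h y - h z - fderiv h x (y - z)) \<le> e * norm (y - z)" by (simp add: mult.commute)
  qed
qed

lemma C1_lipschitz:
  fixes h :: "'a::euclidean_space \<Rightarrow> 'b::euclidean_space"
  assumes D: "Ck_on (Suc 0) D h" and C: "compact C" "convex C" "C \<subseteq> D"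
  obtains K where "K > 0" "\<And>x v. x \<in> C \<Longrightarrow> norm (fderiv h x v) \<le> K * norm v"
    "\<And>x y. x \<in> C \<Longrightarrow> y \<in> C \<Longrightarrow> norm (h x - h y) \<le> K * norm (x - y)"
proof -
  have "\<exists>B. \<forall>x\<in>C. norm (fderiv h x b) \<le> B" for b
  proof -
    have "continuous_on C (\<lambda>x. fderiv h x b)" using D C(3) by (auto intro: continuous_on_subset)
    then have "bounded ((\<lambda>x. fderiv h x b) ` C)" using C(1) compact_continuous_image compact_imp_bounded by blast
    then show ?thesis unfolding bounded_iff by blast
  qed
  then obtain B where B: "\<And>b x. x \<in> C \<Longrightarrow> norm (fderiv h x b) \<le> B b" by metis
  define K where "K = 1 + (\<Sum>b\<in>Basis. \<bar>B b\<bar>)"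
  have K: "K > 0" by (auto simp: K_def intro!: add_pos_nonneg sum_nonneg)
  have der: "(h has_derivative fderiv h y) (at y)" if "y \<in> C" for y
    using Ck_on_has_derivative[OF D] that C(3) by blast
  have b: "norm (fderiv h x v) \<le> K * norm v" if "x \<in> C" for x v
  proof -
    have "(\<Sum>b\<in>Basis. norm (fderiv h x b)) \<le> (\<Sum>b\<in>Basis. \<bar>B b\<bar>)"
      by (rule sum_mono) (use B[OF that] in \<open>smt (verit)\<close>)
    then have "(\<Sum>b\<in>Basis. norm (fderiv h x b)) \<le> K" by (simp add: K_def)
    from order_trans[OF linear_norm_le_basis_sum[OF has_derivative_linear[OF der[OF that]]] mult_right_mono[OF this]]
    show ?thesis by simp
  qed
  show ?thesis
    by (rule that[OF K b]) (auto intro!: differentiable_bound[OF C(2) has_derivative_at_withinI[OF der] onorm_le[OF b]])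
qed

text \<open>For \<open>y\<close> in the smaller ball the map \<open>a \<mapsto> a - h a + y\<close> is a contraction of a closed ball
  around \<open>c\<close>, and its fixed points are preimages of \<open>y\<close>.\<close>

lemma near_identity_image:
  fixes h :: "'a::euclidean_space \<Rightarrow> 'a"
  assumes h: "\<And>a b. a \<in> ball c r \<Longrightarrow> b \<in> ball c r \<Longrightarrow> norm (h a - h b - (a - b)) \<le> (1/2) * norm (a - b)"
  shows "ball (h c) (r/2) \<subseteq> h ` ball c r"
proof
  fix y assume y: "y \<in> ball (h c) (r/2)"
  define \<rho> where "\<rho> = 2 * dist (h c) y"
  have \<rho>: "0 \<le> \<rho>" "\<rho> < r" using y by (auto simp: \<rho>_def)
  then have sub: "cball c \<rho> \<subseteq> ball c r" "c \<in> ball c r" by auto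
  have contr: "dist (a - h a + y) (b - h b + y) \<le> (1/2) * dist a b" if "a \<in> cball c \<rho>" "b \<in> cball c \<rho>" for a b
    using h[of a b] that sub(1) norm_minus_commute[of "h a - h b" "a - b"] by (auto simp: dist_norm algebra_simps subset_iff)
  have "\<exists>!x. x \<in> cball c \<rho> \<and> x - h x + y = x"
  proof (rule Banach_fix[where c="1/2"])
    show "(\<lambda>x. x - h x + y) ` cball c \<rho> \<subseteq> cball c \<rho>"
    proof clarsimp
      fix a assume a: "dist c a \<le> \<rho>"
      have "dist c (a - h a + y) \<le> dist (c - h c + y) (a - h a + y) + dist c (c - h c + y)"
        by (metis add.commute dist_triangle2 dist_commute)
      also have "\<dots> \<le> (1/2) * dist c a + dist (h c) y"
        using contr[of c a] a \<rho> by (auto simp: dist_norm)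
      also have "\<dots> \<le> \<rho>" using a by (simp add: \<rho>_def)
      finally show "dist c (a - h a + y) \<le> \<rho>" .
    qed
  qed (use \<rho> contr in \<open>auto intro: compact_imp_complete\<close>)
  then obtain x where "x \<in> cball c \<rho>" "h x = y" by (auto simp: algebra_simps)
  then show "y \<in> h ` ball c r" using sub by blast
qed

section \<open>Ordinary differential equations with parameters\<close>

lemma vector_mean_value_bound_0:
  fixes \<phi> :: "real \<Rightarrow> 'a::real_normed_vector"
  assumes d: "\<And>s. s \<in> {-d..d} \<Longrightarrow> (\<phi> has_vector_derivative \<phi>' s) (at s within {-d..d})"
    and b: "\<And>s. s \<in> {-d..d} \<Longrightarrow> norm (\<phi>' s) \<le> B" and t: "t \<in> {-d..d}"
  shows "norm (\<phi> t - \<phi> 0) \<le> B * \<bar>t\<bar>"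
proof (cases "0 \<le> t")
  case True
  have "norm (\<phi> t - \<phi> 0) \<le> B * (t - 0)"
    by (rule vector_mean_value_bound[OF True has_vector_derivative_within_subset[OF d]]) (use t True b in auto)
  then show ?thesis using True by simp
next
  case False
  have "norm (\<phi> 0 - \<phi> t) \<le> B * (0 - t)"
    by (rule vector_mean_value_bound[OF _ has_vector_derivative_within_subset[OF d]]) (use t False b in auto)
  then show ?thesis using False by (simp add: norm_minus_commute)
qed

text \<open>On an interval this short a differential inequality for \<open>e\<close> can be solved for the maximum
  of its norm: \<open>K d \<le> 1/2\<close> absorbs the term \<open>K |e|\<close> into the left-hand side. This takes the
  place of Gronwall's inequality in all the estimates for differential equations below.\<close>

lemma ode_sup_bound:
  fixes e :: "real \<Rightarrow> 'a::real_normed_vector"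
  assumes e: "\<And>s. s \<in> {-d..d} \<Longrightarrow> (e has_vector_derivative e' s) (at s within {-d..d})"
    and b: "\<And>s. s \<in> {-d..d} \<Longrightarrow> norm (e' s) \<le> a + K * norm (e s)"
    and K: "0 \<le> K" "K * d \<le> 1/2" and a: "0 \<le> a" and t: "t \<in> {-d..d}"
  shows "norm (e t) \<le> 2 * (norm (e 0) + a * d)"
proof -
  have "continuous_on {-d..d} (\<lambda>s. norm (e s))"
    using e by (intro continuous_on_norm continuous_on_vector_derivative) auto
  then obtain s where s: "s \<in> {-d..d}" "\<And>r. r \<in> {-d..d} \<Longrightarrow> norm (e r) \<le> norm (e s)"
    using continuous_attains_sup[OF compact_Icc, of "-d" d] t by (metis empty_iff)
  have "norm (e s - e 0) \<le> (a + K * norm (e s)) * \<bar>s\<bar>"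
    by (rule vector_mean_value_bound_0[OF e _ s(1)]) (assumption | rule order_trans[OF b add_left_mono[OF mult_left_mono[OF s(2) K(1)]]])+
  also have "\<dots> \<le> (a + K * norm (e s)) * d" using s(1) a K by (intro mult_left_mono) auto
  also have "\<dots> = a * d + (K * d) * norm (e s)" by (simp add: algebra_simps)
  also have "\<dots> \<le> a * d + (1/2) * norm (e s)" using K by (intro add_left_mono mult_right_mono) auto
  finally have "norm (e s) \<le> 2 * (norm (e 0) + a * d)"
    using norm_triangle_sub[of "e s" "e 0"] by simp
  with s(2)[OF t] show ?thesis by simp
qed

text \<open>The unknown ranges over bounded continuous functions on the whole line, a complete space;
  the integral operator is evaluated at the time clamped to \<open>{-d..d}\<close>, so that only values on
  this interval matter.\<close>

lemma picard_lindelof: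
  fixes F :: "real \<Rightarrow> 'a::euclidean_space \<Rightarrow> 'a"
  assumes d: "0 \<le> d" and K: "0 \<le> K" "K * d \<le> 1/2"
    and cont: "continuous_on ({-d..d} \<times> UNIV) (\<lambda>(s, y). F s y)"
    and lip: "\<And>s y z. s \<in> {-d..d} \<Longrightarrow> norm (F s y - F s z) \<le> K * norm (y - z)"
  obtains u where "u 0 = x0" "\<And>t. t \<in> {-d..d} \<Longrightarrow> (u has_vector_derivative F t (u t)) (at t within {-d..d})"
proof -
  define c where "c t = max (-d) (min d t)" for t :: real
  have c: "c t \<in> {-d..d}" "t \<in> {-d..d} \<Longrightarrow> c t = t" for t using d by (auto simp: c_def)
  have cc: "continuous_on UNIV c" unfolding c_def by (intro continuous_intros)
  define G where "G y s = F s (apply_bcontfun y s)" for y :: "real \<Rightarrow>\<^sub>C 'a" and s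
  have G: "continuous_on {-d..d} (G y)" for y
  proof -
    have "continuous_on {-d..d} (\<lambda>s. (s, apply_bcontfun y s))" by (intro continuous_intros) simp
    from continuous_on_compose2[OF cont this] show ?thesis by (auto simp: G_def[abs_def])
  qed
  define I where "I y t = x0 + (integral {-d..t} (G y) - integral {-d..0} (G y))" for y t
  have I': "(I y has_vector_derivative G y t) (at t within {-d..d})" if "t \<in> {-d..d}" for y t
    unfolding I_def[abs_def]
    using integral_has_vector_derivative[OF G that] by (auto intro!: derivative_eq_intros)
  have cI: "continuous_on {-d..d} (I y)" for y
    by (rule continuous_on_vector_derivative[OF I'])
  have bI: "(\<lambda>t. I y (c t)) \<in> bcontfun" for y
  proof -
    have "continuous_on UNIV (\<lambda>t. I y (c t))" by (rule continuous_on_compose2[OF cI cc]) (use c in auto)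
    moreover have "bounded (I y ` {-d..d})" using cI compact_continuous_image compact_imp_bounded by blast
    then have "bounded (range (\<lambda>t. I y (c t)))" by (rule bounded_subset) (use c in auto)
    ultimately show ?thesis by (simp add: bcontfun_def)
  qed
  define P where "P y = Bcontfun (\<lambda>t. I y (c t))" for y
  have P: "apply_bcontfun (P y) t = I y (c t)" for y t using bI by (simp add: P_def Bcontfun_inverse)
  have "\<exists>!y. P y = y"
  proof (rule banach_fix_type[of "1/2"])
    show "\<forall>y z. dist (P y) (P z) \<le> (1/2) * dist y z"
    proof (intro allI dist_bound)
      fix y z t
      have "norm ((I y (c t) - I z (c t)) - (I y 0 - I z 0)) \<le> (K * dist y z) * \<bar>c t\<bar>"
      proof (rule vector_mean_value_bound_0)
        show "((\<lambda>s. I y s - I z s) has_vector_derivative G y s - G z s) (at s within {-d..d})" if "s \<in> {-d..d}" for s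
          using that by (intro has_vector_derivative_diff I')
        show "norm (G y s - G z s) \<le> K * dist y z" if "s \<in> {-d..d}" for s
          using order_trans[OF lip[OF that, of "apply_bcontfun y s" "apply_bcontfun z s"]
              mult_left_mono[OF dist_bounded[of y s z, unfolded dist_norm[of "apply_bcontfun y s"]] K(1)]]
          by (simp add: G_def)
      qed (rule c)
      also have "\<dots> \<le> (K * dist y z) * d" using c(1)[of t] K by (intro mult_left_mono) auto
      also have "\<dots> \<le> (1/2) * dist y z" using mult_right_mono[OF K(2), of "dist y z"] by (simp add: algebra_simps)
      finally show "dist (apply_bcontfun (P y) t) (apply_bcontfun (P z) t) \<le> (1/2) * dist y z"
        by (simp add: P dist_norm I_def)
    qed
  qed auto
  then obtain y where y: "P y = y" by blast
  have yI: "apply_bcontfun y t = I y t" if "t \<in> {-d..d}" for t using P[of y t] y c(2)[OF that] by simp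
  show ?thesis
  proof (rule that[of "apply_bcontfun y"])
    show "apply_bcontfun y 0 = x0" using yI[of 0] d by (simp add: I_def)
    show "(apply_bcontfun y has_vector_derivative F t (apply_bcontfun y t)) (at t within {-d..d})" if "t \<in> {-d..d}" for t
      using has_vector_derivative_transform[OF that _ I'[OF that, of y]] yI by (auto simp: G_def)
  qed
qed

text \<open>A solution \<open>u\<close> of \<open>u' = h\<close>, where \<open>h\<close> depends on time, on a parameter in \<open>W\<close> and on the
  unknown in \<open>V\<close>, with initial values \<open>u0\<close>. The bound \<open>1/4\<close> instead of \<open>1/2\<close> leaves room for a
  small increase of \<open>K\<close> in the linearization estimate. Flows are the case in which \<open>h\<close> is a
  function of the unknown alone and \<open>u0\<close> the identity; variational equations are the case in
  which \<open>h\<close> is affine in the unknown.\<close>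

locale parametric_ode =
  fixes W :: "'p::euclidean_space set" and V :: "'a::euclidean_space set" and \<delta> K :: real
    and h :: "(real \<times> 'p) \<times> 'a \<Rightarrow> 'a" and u :: "real \<times> 'p \<Rightarrow> 'a" and u0 :: "'p \<Rightarrow> 'a"
  assumes W: "open W" and V: "open V" and K: "0 \<le> K" "K * \<delta> \<le> 1/4"
    and uV: "\<And>t X. t \<in> {-\<delta><..<\<delta>} \<Longrightarrow> X \<in> W \<Longrightarrow> u (t, X) \<in> V"
    and ode: "\<And>t X. t \<in> {-\<delta><..<\<delta>} \<Longrightarrow> X \<in> W \<Longrightarrow> ((\<lambda>s. u (s, X)) has_vector_derivative h ((t, X), u (t, X))) (at t)"
    and init: "\<And>X. X \<in> W \<Longrightarrow> u (0, X) = u0 X"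
    and lip: "\<And>z a b. z \<in> {-\<delta><..<\<delta>} \<times> W \<Longrightarrow> a \<in> V \<Longrightarrow> b \<in> V \<Longrightarrow> norm (h (z, a) - h (z, b)) \<le> K * norm (a - b)"
    and ch: "continuous_on (({-\<delta><..<\<delta>} \<times> W) \<times> V) h" and cu0: "continuous_on W u0"
begin

lemma continuous_in_time: "X \<in> W \<Longrightarrow> d < \<delta> \<Longrightarrow> continuous_on {-d..d} (\<lambda>t. u (t, X))"
  by (rule continuous_on_vector_derivative[OF has_vector_derivative_at_within[OF ode]]) auto

lemma uniform_continuity_in_parameter:
  assumes X0: "X0 \<in> W" and d: "0 < d" "d < \<delta>" and e: "0 < e"
  obtains r where "r > 0" "ball X0 r \<subseteq> W"
    "\<And>X t. X \<in> ball X0 r \<Longrightarrow> t \<in> {-d..d} \<Longrightarrow> norm (u (t, X) - u (t, X0)) < e"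
proof -
  \<comment> \<open>The estimate below yields \<open>2 (a + a d)\<close>, which is \<open>e / 2\<close> for this choice.\<close>
  define a where "a = e / (4 * (1 + d))"
  have a: "a > 0" using e d by (simp add: a_def)
  obtain r0 where r0: "r0 > 0" "cball X0 r0 \<subseteq> W" using W X0 open_contains_cball by blast
  define k where "k = (\<lambda>(t, X). h ((t, X), u (t, X0)))"
  have "continuous_on ({-d..d} \<times> cball X0 r0) k"
  proof -
    have "continuous_on ({-d..d} \<times> cball X0 r0) (\<lambda>z. (z, u (fst z, X0)))"
      by (intro continuous_intros continuous_on_compose2[OF continuous_in_time[OF X0 d(2)]]) auto
    then have "continuous_on ({-d..d} \<times> cball X0 r0) (\<lambda>z. h (z, u (fst z, X0)))"
      by (rule continuous_on_compose2[OF ch]) (use r0(2) d uV[OF _ X0] in auto)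
    then show ?thesis by (simp add: k_def case_prod_beta')
  qed
  moreover have "compact ({-d..d} \<times> cball X0 r0)" by (intro compact_Times compact_Icc compact_cball)
  ultimately have "uniformly_continuous_on ({-d..d} \<times> cball X0 r0) k" by (rule compact_uniformly_continuous)
  then obtain r1 where r1: "r1 > 0"
    "\<And>z z'. z \<in> {-d..d} \<times> cball X0 r0 \<Longrightarrow> z' \<in> {-d..d} \<times> cball X0 r0 \<Longrightarrow> dist z' z < r1 \<Longrightarrow> dist (k z') (k z) < a"
    unfolding uniformly_continuous_on_def using a by meson
  obtain r2 where r2: "r2 > 0" "\<And>X. X \<in> W \<Longrightarrow> dist X X0 < r2 \<Longrightarrow> dist (u0 X) (u0 X0) < a"
    using cu0 X0 a unfolding continuous_on_iff by blast
  define r where "r = min r0 (min r1 r2)"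
  show ?thesis
  proof (rule that[of r])
    show "r > 0" "ball X0 r \<subseteq> W" using r0 r1(1) r2(1) by (auto simp: r_def subset_iff)
    fix X t assume X: "X \<in> ball X0 r" and t: "t \<in> {-d..d}"
    have XW: "X \<in> W" and X': "X \<in> cball X0 r0" "dist X X0 < r1" "dist X X0 < r2"
      using X r0(2) by (auto simp: r_def dist_commute)
    have "norm (u (t, X) - u (t, X0)) \<le> 2 * (norm (u (0, X) - u (0, X0)) + a * d)"
    proof (rule ode_sup_bound[where K=K])
      fix s assume s: "s \<in> {-d..d}"
      then have s': "s \<in> {-\<delta><..<\<delta>}" using d by auto
      show "((\<lambda>t. u (t, X) - u (t, X0)) has_vector_derivative (h ((s, X), u (s, X)) - h ((s, X0), u (s, X0)))) (at s within {-d..d})"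
        by (intro has_vector_derivative_diff has_vector_derivative_at_within[OF ode] s' XW X0)
      have "norm (h ((s, X), u (s, X)) - h ((s, X), u (s, X0))) \<le> K * norm (u (s, X) - u (s, X0))"
        using s' XW X0 uV by (intro lip) auto
      moreover have "norm (h ((s, X), u (s, X0)) - h ((s, X0), u (s, X0))) \<le> a"
        using r1(2)[of "(s, X0)" "(s, X)"] s X' r0(1) by (auto simp: k_def dist_norm norm_Pair)
      ultimately show "norm (h ((s, X), u (s, X)) - h ((s, X0), u (s, X0))) \<le> a + K * norm (u (s, X) - u (s, X0))"
        using norm_triangle_ineq[of "h ((s, X), u (s, X)) - h ((s, X), u (s, X0))" "h ((s, X), u (s, X0)) - h ((s, X0), u (s, X0))"]
        by simp
    next
      have "K * d \<le> K * \<delta>" using K d by (intro mult_left_mono) auto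
      then show "K * d \<le> 1/2" using K by simp
    qed (use K a t in auto)
    also have "norm (u (0, X) - u (0, X0)) \<le> a"
      using r2(2)[OF XW X'(3)] by (simp add: init XW X0 dist_norm)
    then have "2 * (norm (u (0, X) - u (0, X0)) + a * d) \<le> 2 * (a * (1 + d))" by (simp add: algebra_simps)
    also have "\<dots> = e / 2" using d by (simp add: a_def divide_simps)
    finally show "norm (u (t, X) - u (t, X0)) < e" using e by simp
  qed
qed

lemma solution_continuous: "continuous_on ({-\<delta><..<\<delta>} \<times> W) u"
proof (rule continuous_on_iff[THEN iffD2], safe)
  fix t0 X0 and e :: real assume t0: "t0 \<in> {-\<delta><..<\<delta>}" and X0: "X0 \<in> W" and e: "0 < e"
  define d where "d = (\<bar>t0\<bar> + \<delta>) / 2"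
  have d: "0 < d" "d < \<delta>" "\<bar>t0\<bar> < d" using t0 by (auto simp: d_def)
  obtain r where r: "r > 0" "ball X0 r \<subseteq> W"
    "\<And>X t. X \<in> ball X0 r \<Longrightarrow> t \<in> {-d..d} \<Longrightarrow> norm (u (t, X) - u (t, X0)) < e/2"
    using uniform_continuity_in_parameter[OF X0 d(1,2), of "e/2"] e by auto
  have "isCont (\<lambda>t. u (t, X0)) t0"
    using has_vector_derivative_continuous[OF ode[OF t0 X0]] by simp
  then obtain r' where r': "r' > 0" "\<And>t. dist t t0 < r' \<Longrightarrow> dist (u (t, X0)) (u (t0, X0)) < e/2"
    using e unfolding continuous_at_eps_delta by (meson half_gt_zero)
  show "\<exists>d>0. \<forall>z\<in>{-\<delta><..<\<delta>} \<times> W. dist z (t0, X0) < d \<longrightarrow> dist (u z) (u (t0, X0)) < e"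
  proof (intro exI[of _ "min r (min r' (d - \<bar>t0\<bar>))"] conjI ballI impI)
    fix z assume z: "z \<in> {-\<delta><..<\<delta>} \<times> W" "dist z (t0, X0) < min r (min r' (d - \<bar>t0\<bar>))"
    obtain t X where zz: "z = (t, X)" by force
    have "dist t t0 \<le> dist z (t0, X0)" "dist X X0 \<le> dist z (t0, X0)"
      using dist_fst_le[of z "(t0, X0)"] dist_snd_le[of z "(t0, X0)"] by (simp_all add: zz)
    then have *: "dist t t0 < r'" "X \<in> ball X0 r" "dist t t0 < d - \<bar>t0\<bar>" using z(2) by (auto simp: dist_commute)
    then have "t \<in> {-d..d}" by (auto simp: dist_real_def)
    from r(3)[OF *(2) this] r'(2)[OF *(1)] show "dist (u z) (u (t0, X0)) < e"
      using dist_triangle_half_r[of "u (t, X0)" "u z" e "u (t0, X0)"] by (simp add: zz dist_norm norm_minus_commute)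
  qed (use r r' d in auto)
qed

end

locale parametric_ode_C1 = parametric_ode W V \<delta> K h u u0
  for W :: "'p::euclidean_space set" and V :: "'a::euclidean_space set" and \<delta> K h u u0 +
  assumes C1h: "Ck_on (Suc 0) (({-\<delta><..<\<delta>} \<times> W) \<times> V) h" and C1u0: "Ck_on (Suc 0) W u0"
    and dh: "\<And>z a y. z \<in> {-\<delta><..<\<delta>} \<times> W \<Longrightarrow> a \<in> V \<Longrightarrow> norm (fderiv h (z, a) (0, y)) \<le> K * norm y"
begin

lemma h_derivative:
  assumes "t \<in> {-\<delta><..<\<delta>}" "X \<in> W"
  shows "(h has_derivative fderiv h ((t, X), u (t, X))) (at ((t, X), u (t, X)))" "linear (fderiv h ((t, X), u (t, X)))"
proof -
  show 1: "(h has_derivative fderiv h ((t, X), u (t, X))) (at ((t, X), u (t, X)))"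
    by (rule Ck_on_has_derivative[OF C1h]) (use assms uV in auto)
  then show "linear (fderiv h ((t, X), u (t, X)))" by (rule has_derivative_linear)
qed

text \<open>The derivatives of the solution with respect to the parameter should solve the linearized
  equation, so \<open>w\<close> solves it for each basis vector and is extended linearly.\<close>

lemma variational_solution:
  assumes X0: "X0 \<in> W" and d: "0 < d" "d < \<delta>"
  obtains w where "\<And>v. w 0 v = fderiv u0 X0 v" "\<And>t. linear (w t)"
    "\<And>v t. t \<in> {-d..d} \<Longrightarrow> ((\<lambda>s. w s v) has_vector_derivative fderiv h ((t, X0), u (t, X0)) ((0, v), w t v)) (at t within {-d..d})"
proof -
  define F where "F v s y = fderiv h ((s, X0), u (s, X0)) ((0, v), y)" for v s y
  have s': "s \<in> {-\<delta><..<\<delta>}" if "s \<in> {-d..d}" for s using that d by auto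
  have "\<exists>w. w 0 = fderiv u0 X0 v \<and> (\<forall>t\<in>{-d..d}. (w has_vector_derivative F v t (w t)) (at t within {-d..d}))" for v
  proof -
    have Kd: "K * d \<le> 1/2" using mult_left_mono[of d \<delta> K] K d by simp
    have "continuous_on ({-d..d} \<times> UNIV) (\<lambda>(s, y). F v s y)"
    proof -
      have c1: "continuous_on {-d..d} (\<lambda>s. fderiv h ((s, X0), u (s, X0)) c)" for c
      proof -
        have "continuous_on (({-\<delta><..<\<delta>} \<times> W) \<times> V) (\<lambda>p. fderiv h p c)" using C1h by (metis Ck_on.simps)
        moreover have "continuous_on {-d..d} (\<lambda>s. ((s, X0), u (s, X0)))"
          by (intro continuous_intros continuous_in_time[OF X0 d(2)])
        ultimately show ?thesis by (rule continuous_on_compose2) (use X0 s' uV in auto)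
      qed
      have "continuous_on ({-d..d} \<times> UNIV) (\<lambda>z. \<Sum>c\<in>Basis. (((0, v), snd z) \<bullet> c) *\<^sub>R fderiv h ((fst z, X0), u (fst z, X0)) c)"
        by (intro continuous_intros continuous_on_compose2[OF c1]) auto
      then show ?thesis
        by (rule continuous_on_eq) (use linear_basis_sum[OF h_derivative(2)[OF s' X0]] in \<open>auto simp: F_def\<close>)
    qed
    moreover have "norm (F v s y - F v s z) \<le> K * norm (y - z)" if "s \<in> {-d..d}" for s y z
    proof -
      have "F v s y - F v s z = fderiv h ((s, X0), u (s, X0)) (0, y - z)"
        unfolding F_def linear_diff[OF h_derivative(2)[OF s'[OF that] X0], symmetric] by (simp add: zero_prod_def)
      then show ?thesis using dh[of "(s, X0)" "u (s, X0)" "y - z"] s'[OF that] X0 uV by auto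
    qed
    ultimately show ?thesis
      using picard_lindelof[where d=d and K=K and F="F v" and ?x0.0="fderiv u0 X0 v", OF _ K(1) Kd] d by (metis less_imp_le)
  qed
  then obtain w0 where w0: "\<And>v. w0 v 0 = fderiv u0 X0 v"
    "\<And>v t. t \<in> {-d..d} \<Longrightarrow> (w0 v has_vector_derivative F v t (w0 v t)) (at t within {-d..d})" by metis
  define w where "w t v = (\<Sum>b\<in>Basis. (v \<bullet> b) *\<^sub>R w0 b t)" for t and v :: 'p
  show ?thesis
  proof (rule that[of w])
    have lu0: "linear (fderiv u0 X0)" using Ck_on_has_derivative[OF C1u0 X0] has_derivative_linear by blast
    show "w 0 v = fderiv u0 X0 v" for v by (simp add: w_def w0(1) linear_basis_sum[OF lu0, of v])
    show "linear (w t)" for t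
      by (rule linearI) (simp_all add: w_def inner_add_left scaleR_add_left sum.distrib scaleR_sum_right)
    fix v t assume t: "t \<in> {-d..d}"
    let ?L = "fderiv h ((t, X0), u (t, X0))"
    have L: "linear ?L" by (rule h_derivative(2)[OF s'[OF t] X0])
    have "((0::real, v), w t v) = (\<Sum>b\<in>Basis. (v \<bullet> b) *\<^sub>R ((0, b), w0 b t))"
      by (auto simp: prod_eq_iff fst_sum snd_sum w_def euclidean_representation)
    from arg_cong[OF this, of ?L] have "?L ((0, v), w t v) = (\<Sum>b\<in>Basis. (v \<bullet> b) *\<^sub>R F b t (w0 b t))"
      by (simp only: F_def linear_sum[OF L] linear_cmul[OF L])
    moreover have "((\<lambda>s. w s v) has_vector_derivative (\<Sum>b\<in>Basis. (v \<bullet> b) *\<^sub>R F b t (w0 b t))) (at t within {-d..d})"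
      unfolding w_def by (intro has_vector_derivative_sum bounded_linear.has_vector_derivative[OF bounded_linear_scaleR_right] w0(2)[OF t])
    ultimately show "((\<lambda>s. w s v) has_vector_derivative ?L ((0, v), w t v)) (at t within {-d..d})" by simp
  qed
qed

text \<open>The remainder satisfies a differential inequality in which the inhomogeneity is the
  linearization error of \<open>h\<close> along the compact curve of the unperturbed solution. That error is
  proportional to the distance of the two solutions, which is again bounded by \<open>w\<close> and the
  remainder.\<close>

lemma linearization_in_parameter:
  assumes X0: "X0 \<in> W" and d: "0 < d" "d < \<delta>" and e: "0 < e"
    and w: "\<And>v. w 0 v = fderiv u0 X0 v" "\<And>t. linear (w t)"
      "\<And>v t. t \<in> {-d..d} \<Longrightarrow> ((\<lambda>s. w s v) has_vector_derivative fderiv h ((t, X0), u (t, X0)) ((0, v), w t v)) (at t within {-d..d})"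
  obtains r where "r > 0" "\<And>X t. X \<in> ball X0 r \<Longrightarrow> t \<in> {-d..d} \<Longrightarrow>
      norm (u (t, X) - u (t, X0) - w t (X - X0)) \<le> e * norm (X - X0)"
proof -
  have s': "s \<in> {-\<delta><..<\<delta>}" if "s \<in> {-d..d}" for s using that d by auto
  have "\<exists>B. \<forall>t\<in>{-d..d}. norm (w t b) \<le> B" for b
  proof -
    have "continuous_on {-d..d} (\<lambda>t. w t b)" by (rule continuous_on_vector_derivative[OF w(3)])
    then have "bounded ((\<lambda>t. w t b) ` {-d..d})" using compact_continuous_image compact_imp_bounded by blast
    then show ?thesis unfolding bounded_iff by blast
  qed
  then obtain B where B: "\<And>b t. t \<in> {-d..d} \<Longrightarrow> norm (w t b) \<le> B b" by metis
  define C where "C = (\<Sum>b\<in>Basis. \<bar>B b\<bar>)"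
  have C0: "C \<ge> 0" by (simp add: C_def sum_nonneg)
  have C: "norm (w t v) \<le> C * norm v" if "t \<in> {-d..d}" for t v
  proof -
    have "(\<Sum>b\<in>Basis. norm (w t b)) \<le> C" unfolding C_def by (rule sum_mono) (use B[OF that] in \<open>smt (verit)\<close>)
    from order_trans[OF linear_norm_le_basis_sum[OF w(2)] mult_right_mono[OF this norm_ge_zero]] show ?thesis .
  qed
  define M where "M = 2 * (1 + (1 + C) * d)"
  have M: "M > 0" using C0 d by (simp add: M_def add_pos_nonneg)
  \<comment> \<open>The second bound keeps \<open>(K + \<epsilon>) d\<close> below \<open>1/2\<close>.\<close>
  define \<epsilon> where "\<epsilon> = min (e / M) (1 / (4 * d))"
  have eps: "\<epsilon> > 0" "\<epsilon> * M \<le> e" "\<epsilon> * d \<le> 1/4"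
    using e M d by (auto simp: \<epsilon>_def min_def field_simps)
  define \<Gamma> where "\<Gamma> t = ((t, X0), u (t, X0))" for t
  have "continuous_on {-d..d} \<Gamma>" unfolding \<Gamma>_def[abs_def] by (intro continuous_intros continuous_in_time[OF X0 d(2)])
  then have "compact (\<Gamma> ` {-d..d})" using compact_continuous_image by blast
  moreover have "\<Gamma> ` {-d..d} \<subseteq> ({-\<delta><..<\<delta>} \<times> W) \<times> V" using X0 s' uV by (auto simp: \<Gamma>_def)
  moreover have "open (({-\<delta><..<\<delta>} \<times> W) \<times> V)" by (intro open_Times W V open_greaterThanLessThan)
  ultimately obtain \<eta> where \<eta>: "\<eta> > 0"
    "\<And>x y z. x \<in> \<Gamma> ` {-d..d} \<Longrightarrow> y \<in> ball x \<eta> \<Longrightarrow> z \<in> ball x \<eta> \<Longrightarrow> norm (h y - h z - fderiv h x (y - z)) \<le> \<epsilon> * norm (y - z)"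
    using C1_strict_derivative_uniform[OF _ C1h _ _ eps(1)] by metis
  obtain r1 where r1: "r1 > 0" "ball X0 r1 \<subseteq> W"
    "\<And>X t. X \<in> ball X0 r1 \<Longrightarrow> t \<in> {-d..d} \<Longrightarrow> norm (u (t, X) - u (t, X0)) < \<eta>/2"
    using uniform_continuity_in_parameter[OF X0 d, of "\<eta>/2"] \<eta>(1) by auto
  obtain r2 where r2: "r2 > 0" "\<And>X. norm (X - X0) < r2 \<Longrightarrow> norm (u0 X - u0 X0 - fderiv u0 X0 (X - X0)) \<le> \<epsilon> * norm (X - X0)"
    using Ck_on_has_derivative[OF C1u0 X0] eps(1) unfolding has_derivative_at_alt by blast
  define r where "r = min r1 (min r2 (\<eta>/2))"
  show ?thesis
  proof (rule that[of r])
    show "r > 0" using r1 r2 \<eta> by (simp add: r_def)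
    fix X t assume X: "X \<in> ball X0 r" and t: "t \<in> {-d..d}"
    define v where "v = X - X0"
    have X': "X \<in> ball X0 r1" "norm v < r2" "norm v < \<eta>/2" "X \<in> W"
      using X r1(2) by (auto simp: r_def dist_norm norm_minus_commute v_def)
    have "norm (u (t, X) - u (t, X0) - w t v) \<le> 2 * (norm (u (0, X) - u (0, X0) - w 0 v) + (\<epsilon> * (1 + C) * norm v) * d)"
    proof (rule ode_sup_bound[where K="K + \<epsilon>"])
      fix s assume s: "s \<in> {-d..d}"
      let ?L = "fderiv h (\<Gamma> s)" let ?D = "u (s, X) - u (s, X0)" let ?q = "((s, X), u (s, X))"
      have L: "linear ?L" unfolding \<Gamma>_def by (rule h_derivative(2)[OF s'[OF s] X0])
      show "((\<lambda>t. u (t, X) - u (t, X0) - w t v) has_vector_derivative (h ?q - h (\<Gamma> s) - ?L ((0, v), w s v))) (at s within {-d..d})"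
        unfolding \<Gamma>_def
        by (intro has_vector_derivative_diff has_vector_derivative_at_within[OF ode] s'[OF s] X' X0 w(3) s)
      have q: "?q - \<Gamma> s = ((0, v), ?D)" by (simp add: \<Gamma>_def v_def)
      have nq: "norm (?q - \<Gamma> s) \<le> norm v + norm ?D" unfolding q using norm_Pair_le[of "(0::real, v)" ?D] by simp
      have "norm (h ?q - h (\<Gamma> s) - ?L (?q - \<Gamma> s)) \<le> \<epsilon> * norm (?q - \<Gamma> s)"
      proof (rule \<eta>(2))
        show "?q \<in> ball (\<Gamma> s) \<eta>"
          using nq r1(3)[OF X'(1) s] X'(3) by (simp add: dist_norm norm_minus_commute)
      qed (use s \<eta>(1) in auto)
      also have "\<dots> \<le> \<epsilon> * (norm v + norm ?D)" using nq eps(1) by (intro mult_left_mono) auto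
      also have "\<dots> \<le> \<epsilon> * (norm v + (C * norm v + norm (?D - w s v)))"
        using norm_triangle_sub[of ?D "w s v"] C[OF s, of v] eps(1) by (intro mult_left_mono) auto
      finally have 1: "norm (h ?q - h (\<Gamma> s) - ?L ((0, v), ?D)) \<le> \<epsilon> * (norm v + (C * norm v + norm (?D - w s v)))"
        unfolding q .
      have 2: "norm (?L (0, ?D - w s v)) \<le> K * norm (?D - w s v)"
        unfolding \<Gamma>_def by (rule dh) (use s'[OF s] X0 uV in auto)
      have "?L (0, ?D - w s v) = ?L ((0, v), ?D) - ?L ((0, v), w s v)"
        unfolding linear_diff[OF L, symmetric] by (simp add: zero_prod_def)
      then have "h ?q - h (\<Gamma> s) - ?L ((0, v), w s v) = (h ?q - h (\<Gamma> s) - ?L ((0, v), ?D)) + ?L (0, ?D - w s v)" by simp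
      also have "norm \<dots> \<le> \<epsilon> * (norm v + (C * norm v + norm (?D - w s v))) + K * norm (?D - w s v)"
        by (rule norm_triangle_le[OF add_mono[OF 1 2]])
      finally show "norm (h ?q - h (\<Gamma> s) - ?L ((0, v), w s v)) \<le> \<epsilon> * (1 + C) * norm v + (K + \<epsilon>) * norm (?D - w s v)"
        by (simp add: algebra_simps)
    next
      have "K * d \<le> K * \<delta>" using K d by (intro mult_left_mono) auto
      then show "(K + \<epsilon>) * d \<le> 1/2" using K eps by (simp add: algebra_simps)
    qed (use K eps C0 t in auto)
    also have "\<dots> \<le> 2 * (\<epsilon> * norm v + (\<epsilon> * (1 + C) * norm v) * d)"
      using r2(2)[of X] X' by (simp add: init X0 w(1) v_def)
    also have "\<dots> = \<epsilon> * M * norm v" by (simp add: M_def algebra_simps)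
    also have "\<dots> \<le> e * norm v" using eps by (intro mult_right_mono) auto
    finally show "norm (u (t, X) - u (t, X0) - w t (X - X0)) \<le> e * norm (X - X0)" by (simp add: v_def)
  qed
qed

lemma solution_derivative:
  assumes X0: "X0 \<in> W" and d: "0 < d" "d < \<delta>" and t0: "t0 \<in> {-d<..<d}"
    and w: "\<And>v. w 0 v = fderiv u0 X0 v" "\<And>t. linear (w t)"
      "\<And>v t. t \<in> {-d..d} \<Longrightarrow> ((\<lambda>s. w s v) has_vector_derivative fderiv h ((t, X0), u (t, X0)) ((0, v), w t v)) (at t within {-d..d})"
  shows "(u has_derivative (\<lambda>(a, v). a *\<^sub>R h ((t0, X0), u (t0, X0)) + w t0 v)) (at (t0, X0))"
  unfolding has_derivative_at_alt
proof (intro conjI allI impI)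
  show "bounded_linear (\<lambda>(a, v). a *\<^sub>R h ((t0, X0), u (t0, X0)) + w t0 v)"
    using linear_add[OF w(2)] linear_cmul[OF w(2)]
    by (auto intro!: linearI simp: linear_conv_bounded_linear[symmetric] algebra_simps split: prod.splits)
  fix e :: real assume e: "0 < e"
  obtain r1 where r1: "r1 > 0" "\<And>X t. X \<in> ball X0 r1 \<Longrightarrow> t \<in> {-d..d} \<Longrightarrow>
      norm (u (t, X) - u (t, X0) - w t (X - X0)) \<le> (e/3) * norm (X - X0)"
    using linearization_in_parameter[OF X0 d _ w, of "e/3"] e by auto
  have t0': "t0 \<in> {-\<delta><..<\<delta>}" using t0 d by auto
  obtain r2 where r2: "r2 > 0" "\<And>t. norm (t - t0) < r2 \<Longrightarrow>
      norm (u (t, X0) - u (t0, X0) - (t - t0) *\<^sub>R h ((t0, X0), u (t0, X0))) \<le> (e/3) * norm (t - t0)"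
    using ode[OF t0' X0] e unfolding has_vector_derivative_def has_derivative_at_alt
    by (meson divide_pos_pos zero_less_numeral)
  have "isCont (\<lambda>t. \<Sum>b\<in>Basis. norm (w t b - w t0 b)) t0"
  proof -
    have "isCont (\<lambda>t. w t b) t0" for b :: 'p
      using continuous_on_vector_derivative[OF w(3)] t0 by (intro continuous_on_interior[of "{-d..d}"]) auto
    then show ?thesis by (intro continuous_intros)
  qed
  then obtain r3 where r3: "r3 > 0" "\<And>t. dist t t0 < r3 \<Longrightarrow> dist (\<Sum>b\<in>Basis. norm (w t b - w t0 b)) (\<Sum>b\<in>Basis. norm (w t0 b - w t0 b)) < e/3"
    using e unfolding continuous_at_eps_delta by (meson divide_pos_pos zero_less_numeral)
  define r where "r = Min {r1, r2, r3, d - \<bar>t0\<bar>}"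
  show "\<exists>r>0. \<forall>z. norm (z - (t0, X0)) < r \<longrightarrow> norm (u z - u (t0, X0) -
      (case z - (t0, X0) of (a, v) \<Rightarrow> a *\<^sub>R h ((t0, X0), u (t0, X0)) + w t0 v)) \<le> e * norm (z - (t0, X0))"
  proof (intro exI[of _ r] conjI allI impI)
    show "r > 0" using r1 r2 r3 t0 by (auto simp: r_def)
    fix z assume z: "norm (z - (t0, X0)) < r"
    obtain t X where zz: "z = (t, X)" by force
    let ?N = "norm (z - (t0, X0))"
    have le: "norm (t - t0) \<le> ?N" "norm (X - X0) \<le> ?N"
      using norm_fst_le[of "t - t0" "X - X0"] norm_snd_le[of "X - X0" "t - t0"] by (simp_all add: zz)
    have c: "norm (t - t0) < r2" "dist t t0 < r3" "X \<in> ball X0 r1" "t \<in> {-d..d}"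
      using z le by (auto simp: r_def dist_norm norm_minus_commute)
    have "norm (w t (X - X0) - w t0 (X - X0)) \<le> (\<Sum>b\<in>Basis. norm (w t b - w t0 b)) * norm (X - X0)"
      using linear_norm_le_basis_sum[OF linear_compose_sub[OF w(2)[of t] w(2)[of t0]], of "X - X0"] by simp
    also have "\<dots> \<le> (e/3) * norm (X - X0)" using r3(2)[OF c(2)] by (intro mult_right_mono) (auto simp: dist_norm)
    finally have 3: "norm (w t (X - X0) - w t0 (X - X0)) \<le> (e/3) * norm (X - X0)" .
    have "u z - u (t0, X0) - (case z - (t0, X0) of (a, v) \<Rightarrow> a *\<^sub>R h ((t0, X0), u (t0, X0)) + w t0 v)
      = (u (t, X) - u (t, X0) - w t (X - X0)) + ((u (t, X0) - u (t0, X0) - (t - t0) *\<^sub>R h ((t0, X0), u (t0, X0)))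
        + (w t (X - X0) - w t0 (X - X0)))" by (simp add: zz)
    also have "norm \<dots> \<le> (e/3) * norm (X - X0) + ((e/3) * norm (t - t0) + (e/3) * norm (X - X0))"
      by (intro norm_triangle_le add_mono r1(2) r2(2) 3 c)
    also have "\<dots> \<le> (e/3) * ?N + ((e/3) * ?N + (e/3) * ?N)" using le e by (intro add_mono mult_left_mono) auto
    finally show "norm (u z - u (t0, X0) - (case z - (t0, X0) of (a, v) \<Rightarrow> a *\<^sub>R h ((t0, X0), u (t0, X0)) + w t0 v)) \<le> e * ?N"
      by simp
  qed
qed

lemma variational_equation:
  assumes X: "X \<in> W" and t: "t \<in> {-\<delta><..<\<delta>}"
  shows "u differentiable at (t, X)"
    and "fderiv u (t, X) (a, v) = a *\<^sub>R h ((t, X), u (t, X)) + fderiv u (t, X) (0, v)"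
    and "((\<lambda>s. fderiv u (s, X) (0, v)) has_vector_derivative fderiv h ((t, X), u (t, X)) ((0, v), fderiv u (t, X) (0, v))) (at t)"
    and "fderiv u (0, X) (0, v) = fderiv u0 X v"
proof -
  define d where "d = (\<bar>t\<bar> + \<delta>) / 2"
  have d: "0 < d" "d < \<delta>" "\<bar>t\<bar> < d" using t by (auto simp: d_def)
  then have d: "0 < d" "d < \<delta>" "t \<in> {-d<..<d}" by auto
  obtain w where w: "\<And>v. w 0 v = fderiv u0 X v" "\<And>t. linear (w t)"
      "\<And>v t. t \<in> {-d..d} \<Longrightarrow> ((\<lambda>s. w s v) has_vector_derivative fderiv h ((t, X), u (t, X)) ((0, v), w t v)) (at t within {-d..d})"
    using variational_solution[OF X d(1,2)] by blast
  note D = solution_derivative[OF X d(1,2) _ w]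
  have f: "fderiv u (s, X) = (\<lambda>(a, v). a *\<^sub>R h ((s, X), u (s, X)) + w s v)" if "s \<in> {-d<..<d}" for s
    by (rule fderiv_eq[OF D[OF that]])
  show "u differentiable at (t, X)" using D[OF d(3)] by (auto simp: differentiable_def)
  show "fderiv u (t, X) (a, v) = a *\<^sub>R h ((t, X), u (t, X)) + fderiv u (t, X) (0, v)" by (simp add: f[OF d(3)])
  show "fderiv u (0, X) (0, v) = fderiv u0 X v" using d by (simp add: f w(1))
  have i: "t \<in> interior {-d..d}" using d(3) by simp
  have "((\<lambda>s. w s v) has_vector_derivative fderiv h ((t, X), u (t, X)) ((0, v), w t v)) (at t)"
    using w(3)[of t v] d(3) at_within_interior[OF i] by simp
  then have "((\<lambda>s. w s v) has_vector_derivative fderiv h ((t, X), u (t, X)) ((0, v), fderiv u (t, X) (0, v))) (at t)"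
    by (simp add: f[OF d(3)])
  then show "((\<lambda>s. fderiv u (s, X) (0, v)) has_vector_derivative fderiv h ((t, X), u (t, X)) ((0, v), fderiv u (t, X) (0, v))) (at t)"
    by (rule has_vector_derivative_transform_within_open[OF _ open_greaterThanLessThan d(3)]) (simp add: f)
qed

end

lemma Ck_on_fderiv: "Ck_on (Suc k) S f \<Longrightarrow> Ck_on k S (\<lambda>x. fderiv f x v)"
  by simp

lemma has_vector_derivative_affine_shift:
  assumes "(x has_vector_derivative x') (at (a * s + c))"
  shows "((\<lambda>s. x (a * s + c)) has_vector_derivative a *\<^sub>R x') (at s)"
proof -
  have "((\<lambda>s. a * s + c) has_derivative (\<lambda>h. a * h)) (at s)" by (auto intro!: derivative_eq_intros)
  from has_derivative_compose[OF this assms[unfolded has_vector_derivative_def]]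
  show ?thesis by (simp add: has_vector_derivative_def mult.commute)
qed

lemma has_derivative_second_argument:
  assumes "(h has_derivative D) (at (z, a))"
  shows "((\<lambda>a. h (z, a)) has_derivative (\<lambda>y. D (0, y))) (at a)"
proof -
  have "((\<lambda>a. (z, a)) has_derivative (\<lambda>y. (0, y))) (at a)" by (auto intro!: derivative_eq_intros)
  from has_derivative_compose[OF this assms] show ?thesis .
qed

lemma Ck_on_fst: "open S \<Longrightarrow> Ck_on k A f \<Longrightarrow> open A \<Longrightarrow> fst ` S \<subseteq> A \<Longrightarrow> Ck_on k S (\<lambda>p. f (fst p))"
  by (rule Ck_on_compose[where g=fst]) (auto intro: Ck_on_bounded_linear bounded_linear_fst)

lemma Ck_on_snd: "open S \<Longrightarrow> Ck_on k A f \<Longrightarrow> open A \<Longrightarrow> snd ` S \<subseteq> A \<Longrightarrow> Ck_on k S (\<lambda>p. f (snd p))"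
  by (rule Ck_on_compose[where g=snd]) (auto intro: Ck_on_bounded_linear bounded_linear_snd)

text \<open>A parameter derivative of \<open>u\<close> solves an equation with the same linear part \<open>A\<close>; only the
  inhomogeneity changes, and it is as regular as \<open>u\<close>. Hence the induction over the order runs
  over equations for functions of one fixed type, with the same bound \<open>K\<close> and on the same
  interval.\<close>

lemma linear_ode_Ck:
  fixes \<delta> :: real and A :: "real \<times> 'p::euclidean_space \<Rightarrow> 'a::euclidean_space \<Rightarrow> 'a" and W :: "'p set"
  defines "\<Omega> \<equiv> {-\<delta><..<\<delta>} \<times> W"
  assumes W: "open W" and \<delta>: "0 < \<delta>" and K: "0 \<le> K" "K * \<delta> \<le> 1/4"
    and linA: "\<And>z. z \<in> \<Omega> \<Longrightarrow> linear (A z)" and bA: "\<And>z w. z \<in> \<Omega> \<Longrightarrow> norm (A z w) \<le> K * norm w"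
  shows "(\<And>w. Ck_on k \<Omega> (\<lambda>z. A z w)) \<Longrightarrow> Ck_on k \<Omega> b \<Longrightarrow> Ck_on k W u0 \<Longrightarrow>
    (\<And>X. X \<in> W \<Longrightarrow> u (0, X) = u0 X) \<Longrightarrow>
    (\<And>t X. t \<in> {-\<delta><..<\<delta>} \<Longrightarrow> X \<in> W \<Longrightarrow>
      ((\<lambda>s. u (s, X)) has_vector_derivative A (t, X) (u (t, X)) + b (t, X)) (at t)) \<Longrightarrow> Ck_on k \<Omega> u"
proof (induction k arbitrary: b u u0)
  case (0 b u u0)
  define h where "h p = (\<Sum>c\<in>Basis. (snd p \<bullet> c) *\<^sub>R A (fst p) c) + b (fst p)" for p :: "(real \<times> 'p) \<times> 'a"
  have hA: "h (z, a) = A z a + b z" if "z \<in> \<Omega>" for z a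
    by (simp add: h_def linear_basis_sum[OF linA[OF that], of a])
  have o: "open \<Omega>" "open (\<Omega> \<times> (UNIV :: 'a set))" using W by (auto simp: \<Omega>_def intro!: open_Times)
  have "Ck_on 0 (\<Omega> \<times> UNIV) h" unfolding h_def
    by (intro Ck_on_add Ck_on_sum Ck_on_scaleR Ck_on_inner Ck_on_const o Ck_on_fst[OF o(2) 0(1)] Ck_on_fst[OF o(2) 0(2)]
        Ck_on_bounded_linear bounded_linear_snd) auto
  then have ch: "continuous_on (\<Omega> \<times> UNIV) h" by simp
  interpret parametric_ode W UNIV \<delta> K h u u0
  proof unfold_locales
    show "((\<lambda>s. u (s, X)) has_vector_derivative h ((t, X), u (t, X))) (at t)" if "t \<in> {-\<delta><..<\<delta>}" "X \<in> W" for t X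
      using 0(5)[OF that] hA[of "(t, X)" "u (t, X)"] that by (simp add: \<Omega>_def)
    show "norm (h (z, a) - h (z, b)) \<le> K * norm (a - b)" if "z \<in> {-\<delta><..<\<delta>} \<times> W" for z a b
      using bA[of z "a - b"] that linear_diff[OF linA[of z], of a b] by (simp add: hA \<Omega>_def)
  qed (use W K 0 ch in \<open>auto simp: \<Omega>_def\<close>)
  show ?case using solution_continuous by (simp add: \<Omega>_def)
next
  case (Suc k b u u0)
  define h where "h p = (\<Sum>c\<in>Basis. (snd p \<bullet> c) *\<^sub>R A (fst p) c) + b (fst p)" for p :: "(real \<times> 'p) \<times> 'a"
  have hA: "h (z, a) = A z a + b z" if "z \<in> \<Omega>" for z a
    by (simp add: h_def linear_basis_sum[OF linA[OF that], of a])
  have o: "open \<Omega>" "open (\<Omega> \<times> (UNIV :: 'a set))" using W by (auto simp: \<Omega>_def intro!: open_Times)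
  have Ck_h: "Ck_on (Suc k) (\<Omega> \<times> UNIV) h" unfolding h_def
    by (intro Ck_on_add Ck_on_sum Ck_on_scaleR Ck_on_inner Ck_on_const o Ck_on_fst[OF o(2) Suc.prems(1)] Ck_on_fst[OF o(2) Suc.prems(2)]
        Ck_on_bounded_linear bounded_linear_snd) auto
  have C1: "Ck_on (Suc 0) S f" if "Ck_on (Suc k) S f" for S and f :: "'q::euclidean_space \<Rightarrow> 'r::euclidean_space"
    using that Ck_on_continuous[of k S "\<lambda>x. fderiv f x _"] by simp
  have dhA: "fderiv h (z, a) (0, y) = A z y" if "z \<in> \<Omega>" for z a y
  proof -
    have 1: "((\<lambda>a. h (z, a)) has_derivative (\<lambda>y. fderiv h (z, a) (0, y))) (at a)"
      by (rule has_derivative_second_argument[OF Ck_on_has_derivative[OF Ck_h]]) (use that in auto)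
    have 2: "((\<lambda>a. h (z, a)) has_derivative A z) (at a)"
      unfolding hA[OF that] using bounded_linear_imp_has_derivative[of "A z"] linA[OF that]
      by (auto intro!: derivative_eq_intros simp: linear_conv_bounded_linear)
    show ?thesis using has_derivative_unique[OF 1 2] by metis
  qed
  interpret parametric_ode_C1 W UNIV \<delta> K h u u0
  proof unfold_locales
    show "((\<lambda>s. u (s, X)) has_vector_derivative h ((t, X), u (t, X))) (at t)" if "t \<in> {-\<delta><..<\<delta>}" "X \<in> W" for t X
      using Suc.prems(5)[OF that] hA[of "(t, X)" "u (t, X)"] that by (simp add: \<Omega>_def)
    show "norm (h (z, a) - h (z, b)) \<le> K * norm (a - b)" if "z \<in> {-\<delta><..<\<delta>} \<times> W" for z a b
      using bA[of z "a - b"] that linear_diff[OF linA[of z], of a b] by (simp add: hA \<Omega>_def)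
    show "norm (fderiv h (z, a) (0, y)) \<le> K * norm y" if "z \<in> {-\<delta><..<\<delta>} \<times> W" for z a y
      using that bA by (simp add: dhA \<Omega>_def)
    show "continuous_on (({-\<delta><..<\<delta>} \<times> W) \<times> UNIV) h" "continuous_on W u0"
      using Ck_on_continuous[OF Ck_h] Ck_on_continuous[OF Suc.prems(3)] by (simp_all add: \<Omega>_def)
    show "Ck_on (Suc 0) (({-\<delta><..<\<delta>} \<times> W) \<times> UNIV) h" "Ck_on (Suc 0) W u0"
      using C1[OF Ck_h] C1[OF Suc.prems(3)] by (simp_all add: \<Omega>_def)
    show "u (0, X) = u0 X" if "X \<in> W" for X by (rule Suc.prems(4)[OF that])
  qed (use W K in auto)
  have p: "Ck_on k \<Omega> (\<lambda>z. A z w)" "Ck_on k \<Omega> b" "Ck_on k W u0" for w using Suc.prems(1,2,3) Ck_on_pred by blast+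
  have uk: "Ck_on k \<Omega> u" by (rule Suc.IH[OF p Suc.prems(4,5)])
  have zu: "Ck_on k \<Omega> (\<lambda>z. (z, u z))"
    by (rule Ck_on_Pair[OF o(1) Ck_on_bounded_linear[OF bounded_linear_ident] uk])
  have hz: "Ck_on k \<Omega> (\<lambda>z. fderiv h (z, u z) c)" for c
    by (rule Ck_on_compose[OF o(1) o(2) Ck_on_fderiv[OF Ck_h] zu]) auto
  have q: "Ck_on k \<Omega> (\<lambda>z. fderiv u z (0, v))" for v
  proof (rule Suc.IH[OF p(1) hz[of "((0, v), 0)"]])
    show "Ck_on k W (\<lambda>X. fderiv u0 X v)" using Suc.prems(3) by simp
    fix X assume X: "X \<in> W"
    show "((\<lambda>s. fderiv u (s, X) (0, v)) has_vector_derivative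
        A (t, X) (fderiv u (t, X) (0, v)) + fderiv h ((t, X), u (t, X)) ((0, v), 0)) (at t)" if t: "t \<in> {-\<delta><..<\<delta>}" for t
    proof -
      have "fderiv h ((t, X), u (t, X)) ((0, v), fderiv u (t, X) (0, v)) =
          fderiv h ((t, X), u (t, X)) (0, fderiv u (t, X) (0, v)) + fderiv h ((t, X), u (t, X)) ((0, v), 0)"
        unfolding linear_add[OF h_derivative(2)[OF t X], symmetric] by (simp add: zero_prod_def)
      then show ?thesis using variational_equation(3)[OF X t, of v] dhA[of "(t, X)"] t X by (simp add: \<Omega>_def)
    qed
    show "fderiv u (0, X) (0, v) = fderiv u0 X v"
      using variational_equation(4)[OF X, of 0] \<delta> by simp
  qed
  show ?case
  proof (rule Ck_on_SucI[OF o(1)])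
    show "(u has_derivative fderiv u z) (at z)" if "z \<in> \<Omega>" for z
      using variational_equation(1)[of "snd z" "fst z"] that by (auto simp: \<Omega>_def frechet_derivative_works)
    fix av :: "real \<times> 'p"
    have "Ck_on k \<Omega> (\<lambda>z. fst av *\<^sub>R (A z (u z) + b z) + fderiv u z (0, snd av))"
    proof -
      have "Ck_on k \<Omega> (\<lambda>z. h (z, u z))" by (rule Ck_on_compose[OF o(1) o(2) Ck_on_pred[OF Ck_h] zu]) auto
      then have "Ck_on k \<Omega> (\<lambda>z. A z (u z) + b z)"
        by (rule Ck_on_cong[OF o(1), THEN iffD1, rotated]) (simp add: hA)
      from Ck_on_add[OF o(1) Ck_on_scaleR[OF o(1) Ck_on_const this] q] show ?thesis .
    qed
    then show "Ck_on k \<Omega> (\<lambda>z. fderiv u z av)"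
    proof (rule Ck_on_cong[OF o(1), THEN iffD1, rotated])
      fix z assume z: "z \<in> \<Omega>"
      then show "fst av *\<^sub>R (A z (u z) + b z) + fderiv u z (0, snd av) = fderiv u z av"
        using variational_equation(2)[of "snd z" "fst z" "fst av" "snd av"] hA[OF z, of "u z"] by (auto simp: \<Omega>_def)
    qed
  qed
qed

text \<open>The flow is continuously differentiable in the initial value, and its derivative solves
  the linear variational equation, whose coefficients are as regular as the flow. By
  \<open>linear_ode_Ck\<close> the derivative has that regularity too, so each order of differentiability
  gives the next.\<close>

theorem smooth_local_flow:
  fixes f :: "'a::euclidean_space \<Rightarrow> 'a"
  assumes D: "open D" "X0 \<in> D" and f: "\<And>k. Ck_on k D f"
  obtains \<delta> \<rho> \<phi> where "\<delta> > 0" "\<rho> > 0" "\<And>k. Ck_on k ({-\<delta><..<\<delta>} \<times> ball X0 \<rho>) \<phi>"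
    "\<And>t X. t \<in> {-\<delta><..<\<delta>} \<Longrightarrow> X \<in> ball X0 \<rho> \<Longrightarrow> \<phi> (t, X) \<in> D"
    "\<And>X. X \<in> ball X0 \<rho> \<Longrightarrow> \<phi> (0, X) = X"
    "\<And>t X. t \<in> {-\<delta><..<\<delta>} \<Longrightarrow> X \<in> ball X0 \<rho> \<Longrightarrow> ((\<lambda>s. \<phi> (s, X)) has_vector_derivative f (\<phi> (t, X))) (at t)"
proof -
  obtain r where r: "r > 0" "cball X0 r \<subseteq> D" using D open_contains_cball by blast
  define \<rho> where "\<rho> = r / 2"
  define C where "C = cball X0 r"
  have C: "compact C" "convex C" "C \<subseteq> D" "C \<noteq> {}" "closed C" using r by (auto simp: C_def)
  obtain K where KK: "K > 0" "\<And>x v. x \<in> C \<Longrightarrow> norm (fderiv f x v) \<le> K * norm v"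
    "\<And>x y. x \<in> C \<Longrightarrow> y \<in> C \<Longrightarrow> norm (f x - f y) \<le> K * norm (x - y)"
    using C1_lipschitz[OF f C(1,2,3)] by blast
  have cf: "continuous_on D f" using f[of 0] by simp
  have "bounded (f ` C)"
    using C cf compact_continuous_image compact_imp_bounded continuous_on_subset by metis
  then obtain M0 where M0: "\<And>x. x \<in> C \<Longrightarrow> norm (f x) \<le> M0" unfolding bounded_iff by auto
  define M where "M = \<bar>M0\<bar> + 1"
  have M: "M > 0" "\<And>x. x \<in> C \<Longrightarrow> norm (f x) \<le> M" using M0 by (force simp: M_def)+
  define \<delta> where "\<delta> = min (1 / (4 * K)) (\<rho> / (2 * M))"
  have \<rho>: "\<rho> > 0" using r by (simp add: \<rho>_def)
  have \<delta>: "\<delta> > 0" "K * \<delta> \<le> 1/4" "M * \<delta> \<le> \<rho>/2"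
    using KK(1) M(1) \<rho> by (auto simp: \<delta>_def min_def field_simps)
  \<comment> \<open>Composition with the nearest-point projection onto the ball makes the field globally Lipschitz.\<close>
  define F where "F x = f (closest_point C x)" for x
  have cpC: "closest_point C x \<in> C" for x using C closest_point_in_set by blast
  have FL: "norm (F x - F y) \<le> K * norm (x - y)" for x y
    using order_trans[OF KK(3)[OF cpC cpC] mult_left_mono[OF closest_point_lipschitz[OF C(2,5,4), unfolded dist_norm]]] KK(1)
    by (simp add: F_def)
  have "\<exists>u. u 0 = X \<and> (\<forall>t\<in>{-\<delta>..\<delta>}. (u has_vector_derivative F (u t)) (at t within {-\<delta>..\<delta>}))" for X
  proof -
    have "continuous_on UNIV F"
      unfolding F_def using C cpC continuous_on_closest_point[OF C(2,5,4)] continuous_on_subset[OF cf]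
      by (intro continuous_on_compose2[OF cf]) auto
    then have cF: "continuous_on ({-\<delta>..\<delta>} \<times> UNIV) (\<lambda>(s, y). F y)"
      by (auto simp: case_prod_beta' intro!: continuous_on_compose2[of UNIV F _ snd] continuous_intros)
    have K2: "0 \<le> \<delta>" "0 \<le> K" "K * \<delta> \<le> 1/2" using \<delta> KK(1) by auto
    show ?thesis
      by (rule picard_lindelof[where d=\<delta> and K=K and F="\<lambda>s. F" and ?x0.0=X, OF K2 cF FL]) blast
  qed
  then obtain U where U: "\<And>X. U X 0 = X"
    "\<And>X t. t \<in> {-\<delta>..\<delta>} \<Longrightarrow> (U X has_vector_derivative F (U X t)) (at t within {-\<delta>..\<delta>})" by metis
  define \<phi> where "\<phi> = (\<lambda>(t, X). U X t)"
  have near: "U X t \<in> ball X0 r" if X: "X \<in> ball X0 \<rho>" and t: "t \<in> {-\<delta>..\<delta>}" for X t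
  proof -
    have "norm (U X t - U X 0) \<le> M * \<bar>t\<bar>"
      by (rule vector_mean_value_bound_0[OF U(2) _ t]) (auto simp: F_def intro: M(2) cpC)
    also have "\<dots> \<le> M * \<delta>" using t M by (intro mult_left_mono) auto
    also have "\<dots> < \<rho>" using \<delta>(3) \<rho> by simp
    finally have "dist X (U X t) < \<rho>" by (simp add: U(1) dist_norm norm_minus_commute)
    then show ?thesis using X dist_triangle_lt[of X0 X "U X t" r] dist_triangle[of X0 "U X t" X] by (simp add: \<rho>_def)
  qed
  define W where "W = ball X0 \<rho>"
  define \<Omega> where "\<Omega> = {-\<delta><..<\<delta>} \<times> W"
  have o: "open W" "open \<Omega>" by (auto simp: W_def \<Omega>_def intro!: open_Times)
  have inV: "\<phi> z \<in> ball X0 r" if "z \<in> \<Omega>" for z using that near by (auto simp: \<Omega>_def W_def \<phi>_def)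
  have VD: "ball X0 r \<subseteq> D" "ball X0 r \<subseteq> C" using r by (auto simp: C_def)
  have ode_f: "((\<lambda>s. \<phi> (s, X)) has_vector_derivative f (\<phi> (t, X))) (at t)" if t: "t \<in> {-\<delta><..<\<delta>}" and X: "X \<in> W" for t X
  proof -
    have "(U X has_vector_derivative F (U X t)) (at t)"
      using U(2)[of t X] t at_within_interior[of t "{-\<delta>..\<delta>}"] by simp
    moreover have "F (U X t) = f (U X t)"
      using near[of X t] t X VD by (simp add: F_def W_def closest_point_self subset_iff)
    ultimately show ?thesis by (simp add: \<phi>_def)
  qed
  define h where "h p = f (snd p)" for p :: "(real \<times> 'a) \<times> 'a"
  have oV: "open (\<Omega> \<times> ball X0 r)" by (intro open_Times o open_ball)
  have Ck_h: "Ck_on k (\<Omega> \<times> ball X0 r) h" for k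
    unfolding h_def by (rule Ck_on_snd[OF oV f D(1)]) (use VD in auto)
  interpret parametric_ode_C1 W "ball X0 r" \<delta> K h \<phi> "\<lambda>X. X"
  proof unfold_locales
    show "norm (fderiv h (z, a) (0, y)) \<le> K * norm y" if "z \<in> {-\<delta><..<\<delta>} \<times> W" "a \<in> ball X0 r" for z a y
    proof -
      have 1: "((\<lambda>a. h (z, a)) has_derivative (\<lambda>y. fderiv h (z, a) (0, y))) (at a)"
        by (rule has_derivative_second_argument[OF Ck_on_has_derivative[OF Ck_h]]) (use that in \<open>auto simp: \<Omega>_def\<close>)
      have 2: "((\<lambda>a. h (z, a)) has_derivative fderiv f a) (at a)"
        unfolding h_def using Ck_on_has_derivative[OF f] that VD by auto
      have "fderiv h (z, a) (0, y) = fderiv f a y" using has_derivative_unique[OF 1 2] by metis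
      then show ?thesis using KK(2)[of a y] that VD by auto
    qed
    show "Ck_on (Suc 0) (({-\<delta><..<\<delta>} \<times> W) \<times> ball X0 r) h" "continuous_on (({-\<delta><..<\<delta>} \<times> W) \<times> ball X0 r) h"
      using Ck_h[of "Suc 0"] Ck_on_continuous[OF Ck_h[of 0]] by (simp_all only: \<Omega>_def)
    show "Ck_on (Suc 0) W (\<lambda>X. X)" by (rule Ck_on_bounded_linear[OF bounded_linear_ident])
    show "\<phi> (t, X) \<in> ball X0 r" if "t \<in> {-\<delta><..<\<delta>}" "X \<in> W" for t X using inV that by (simp add: \<Omega>_def)
    show "((\<lambda>s. \<phi> (s, X)) has_vector_derivative h ((t, X), \<phi> (t, X))) (at t)" if "t \<in> {-\<delta><..<\<delta>}" "X \<in> W" for t X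
      using ode_f[OF that] by (simp add: h_def)
    show "norm (h (z, a) - h (z, b)) \<le> K * norm (a - b)" if "a \<in> ball X0 r" "b \<in> ball X0 r" for z a b
      using KK(3)[of a b] that VD(2) by (simp add: h_def subset_iff)
  qed (use o KK \<delta> in \<open>auto simp: \<phi>_def U\<close>)
  have "Ck_on k \<Omega> \<phi>" for k
  proof (induction k)
    case 0
    then show ?case using solution_continuous by (simp add: \<Omega>_def)
  next
    case (Suc k)
    have sub: "\<phi> ` \<Omega> \<subseteq> D" using inV VD by blast
    have A: "Ck_on k \<Omega> (\<lambda>z. fderiv f (\<phi> z) w)" for w
      by (rule Ck_on_compose[OF o(2) D(1) Ck_on_fderiv[OF f] Suc sub])
    have fd: "(f has_derivative fderiv f a) (at a)" if "a \<in> D" for a using Ck_on_has_derivative[OF f that] .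
    have q: "Ck_on k \<Omega> (\<lambda>z. fderiv \<phi> z (0, v))" for v
      unfolding \<Omega>_def
    proof (rule linear_ode_Ck[where A="\<lambda>z. fderiv f (\<phi> z)" and b="\<lambda>_. 0" and K=K and ?u0.0="\<lambda>_. v"])
      show "linear (fderiv f (\<phi> z))" if "z \<in> {-\<delta><..<\<delta>} \<times> W" for z
        using has_derivative_linear[OF fd[of "\<phi> z"]] sub that by (auto simp: \<Omega>_def)
      show "norm (fderiv f (\<phi> z) w) \<le> K * norm w" if "z \<in> {-\<delta><..<\<delta>} \<times> W" for z w
        using inV[of z] VD that KK(2) by (auto simp: \<Omega>_def)
      show "Ck_on k ({-\<delta><..<\<delta>} \<times> W) (\<lambda>z. fderiv f (\<phi> z) w)" for w using A by (simp add: \<Omega>_def)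
      show "fderiv \<phi> (0, X) (0, v) = v" if "X \<in> W" for X
        using variational_equation(4)[OF that, of 0] \<delta>(1) by simp
      show "((\<lambda>s. fderiv \<phi> (s, X) (0, v)) has_vector_derivative fderiv f (\<phi> (t, X)) (fderiv \<phi> (t, X) (0, v)) + 0) (at t)"
        if t: "t \<in> {-\<delta><..<\<delta>}" and X: "X \<in> W" for t X
      proof -
        have D': "\<phi> (t, X) \<in> D" using inV[of "(t, X)"] VD t X by (auto simp: \<Omega>_def)
        have "(h has_derivative (\<lambda>w. fderiv f (\<phi> (t, X)) (snd w))) (at ((t, X), \<phi> (t, X)))"
          unfolding h_def by (rule has_derivative_compose[OF has_derivative_snd[OF has_derivative_ident]]) (simp add: fd[OF D'])
        from fderiv_eq[OF this] show ?thesis using variational_equation(3)[OF X t, of v] by simp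
      qed
    qed (use o KK \<delta> in auto)
    show ?case
    proof (rule Ck_on_SucI[OF o(2)])
      show "(\<phi> has_derivative fderiv \<phi> z) (at z)" if "z \<in> \<Omega>" for z
        using variational_equation(1)[of "snd z" "fst z"] that by (auto simp: \<Omega>_def frechet_derivative_works)
      fix av :: "real \<times> 'a"
      have "Ck_on k \<Omega> (\<lambda>z. fst av *\<^sub>R f (\<phi> z) + fderiv \<phi> z (0, snd av))"
        by (intro Ck_on_add Ck_on_scaleR Ck_on_const q o Ck_on_compose[OF o(2) D(1) f Suc sub])
      then show "Ck_on k \<Omega> (\<lambda>z. fderiv \<phi> z av)"
      proof (rule Ck_on_cong[OF o(2), THEN iffD1, rotated])
        fix z assume z: "z \<in> \<Omega>"
        then show "fst av *\<^sub>R f (\<phi> z) + fderiv \<phi> z (0, snd av) = fderiv \<phi> z av"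
          using variational_equation(2)[of "snd z" "fst z" "fst av" "snd av"] by (auto simp: \<Omega>_def h_def)
      qed
    qed
  qed
  moreover have "\<phi> (t, X) \<in> D" if "t \<in> {-\<delta><..<\<delta>}" "X \<in> W" for t X
    using inV[of "(t, X)"] VD that by (auto simp: \<Omega>_def)
  moreover have "\<phi> (0, X) = X" for X by (simp add: \<phi>_def U(1))
  ultimately show ?thesis
    using that[of \<delta> \<rho> \<phi>] \<delta>(1) \<rho> ode_f unfolding \<Omega>_def W_def by metis
qed

text \<open>The difference of two solutions satisfies the hypotheses of \<open>ode_sup_bound\<close> with vanishing
  inhomogeneity and vanishing initial value.\<close>

lemma ode_locally_unique:
  fixes f :: "'a::euclidean_space \<Rightarrow> 'a"
  assumes D: "open D" "Ck_on (Suc 0) D f" and J: "open J" "t0 \<in> J"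
    and y: "\<And>t. t \<in> J \<Longrightarrow> y t \<in> D \<and> (y has_vector_derivative f (y t)) (at t)"
    and z: "\<And>t. t \<in> J \<Longrightarrow> z t \<in> D \<and> (z has_vector_derivative f (z t)) (at t)" and eq: "y t0 = z t0"
  shows "\<forall>\<^sub>F t in nhds t0. y t = z t"
proof -
  obtain r where r: "r > 0" "cball (y t0) r \<subseteq> D" using D y J open_contains_cball by blast
  obtain K where K: "K > 0" "\<And>a b. a \<in> cball (y t0) r \<Longrightarrow> b \<in> cball (y t0) r \<Longrightarrow> norm (f a - f b) \<le> K * norm (a - b)"
    using C1_lipschitz[OF D(2) compact_cball convex_cball r(2)] by metis
  have c: "isCont y t0" "isCont z t0"
    using y[OF J(2)] z[OF J(2)] by (auto intro: has_vector_derivative_continuous)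
  have "\<forall>\<^sub>F t in nhds t0. y t \<in> ball (y t0) r" "\<forall>\<^sub>F t in nhds t0. z t \<in> ball (y t0) r"
    using c[unfolded isCont_def tendsto_at_iff_tendsto_nhds, THEN topological_tendstoD, of "ball (y t0) r"] r(1) eq
    by auto
  moreover have "\<forall>\<^sub>F t in nhds t0. t \<in> J" using J eventually_nhds by blast
  ultimately have "\<forall>\<^sub>F t in nhds t0. t \<in> J \<and> y t \<in> ball (y t0) r \<and> z t \<in> ball (y t0) r" by eventually_elim simp
  then obtain d0 where d0: "d0 > 0" "\<And>t. dist t t0 < d0 \<Longrightarrow> t \<in> J \<and> y t \<in> ball (y t0) r \<and> z t \<in> ball (y t0) r"
    unfolding eventually_nhds_metric by blast
  define d where "d = min (d0 / 2) (1 / (2 * K))"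
  have d: "d > 0" "d < d0" "K * d \<le> 1/2" using d0(1) K(1) by (auto simp: d_def min_def field_simps)
  have "y (t0 + s) = z (t0 + s)" if s: "s \<in> {-d..d}" for s
  proof -
    have "norm (y (t0 + s) - z (t0 + s)) \<le> 2 * (norm (y (t0 + 0) - z (t0 + 0)) + 0 * d)"
    proof (rule ode_sup_bound[where K=K])
      fix s assume s: "s \<in> {-d..d}"
      then have a: "t0 + s \<in> J" "y (t0 + s) \<in> ball (y t0) r" "z (t0 + s) \<in> ball (y t0) r"
        using d0(2)[of "t0 + s"] d(2) by (auto simp: dist_real_def)
      have sh: "((\<lambda>s. x (t0 + s)) has_vector_derivative x') (at s)" if "(x has_vector_derivative x') (at (t0 + s))" for x :: "real \<Rightarrow> 'a" and x'
        using has_vector_derivative_affine_shift[of x x' 1 s t0] that by (simp add: add.commute)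
      show "((\<lambda>s. y (t0 + s) - z (t0 + s)) has_vector_derivative f (y (t0 + s)) - f (z (t0 + s))) (at s within {-d..d})"
        using y[OF a(1)] z[OF a(1)] by (intro has_vector_derivative_diff has_vector_derivative_at_within[OF sh]) auto
      show "norm (f (y (t0 + s)) - f (z (t0 + s))) \<le> 0 + K * norm (y (t0 + s) - z (t0 + s))"
        using K(2)[of "y (t0 + s)" "z (t0 + s)"] a by auto
    qed (use K d s in auto)
    then show ?thesis by (simp add: eq)
  qed
  then have "y t = z t" if "dist t t0 < d" for t
  proof -
    have "t - t0 \<in> {-d..d}" using that by (auto simp: dist_real_def)
    from \<open>\<And>s. s \<in> {-d..d} \<Longrightarrow> y (t0 + s) = z (t0 + s)\<close>[OF this] show ?thesis by simp
  qed
  then show ?thesis using d(1) unfolding eventually_nhds_metric by blast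
qed

section \<open>Smooth maps and fields of linear and bilinear maps\<close>

lemma smooth_onI: "(\<And>k. Ck_on k S f) \<Longrightarrow> smooth_on S f" by (simp add: smooth_on_def)
lemma smooth_onD: "smooth_on S f \<Longrightarrow> Ck_on k S f" by (simp add: smooth_on_def)

lemma smooth_on_const [simp]: "smooth_on S (\<lambda>x. c)" by (simp add: smooth_on_def)
lemma smooth_on_bounded_linear: "bounded_linear f \<Longrightarrow> smooth_on S f"
  by (simp add: smooth_on_def Ck_on_bounded_linear)
lemma smooth_on_id [simp]: "smooth_on S (\<lambda>x. x)" by (rule smooth_on_bounded_linear[OF bounded_linear_ident])
lemma smooth_on_add: "open S \<Longrightarrow> smooth_on S f \<Longrightarrow> smooth_on S g \<Longrightarrow> smooth_on S (\<lambda>x. f x + g x)"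
  by (simp add: smooth_on_def Ck_on_add)
lemma smooth_on_diff: "open S \<Longrightarrow> smooth_on S f \<Longrightarrow> smooth_on S g \<Longrightarrow> smooth_on S (\<lambda>x. f x - g x)"
  by (simp add: smooth_on_def Ck_on_diff)
lemma smooth_on_minus: "open S \<Longrightarrow> smooth_on S f \<Longrightarrow> smooth_on S (\<lambda>x. - f x)"
  by (simp add: smooth_on_def Ck_on_minus)
lemma smooth_on_scaleR: "open S \<Longrightarrow> smooth_on S f \<Longrightarrow> smooth_on S g \<Longrightarrow> smooth_on S (\<lambda>x. f x *\<^sub>R g x)"
  by (simp add: smooth_on_def Ck_on_scaleR)
lemma smooth_on_inner: "open S \<Longrightarrow> smooth_on S f \<Longrightarrow> smooth_on S g \<Longrightarrow> smooth_on S (\<lambda>x. f x \<bullet> g x)"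
  by (simp add: smooth_on_def Ck_on_inner)
lemma smooth_on_sum: "open S \<Longrightarrow> (\<And>i. i \<in> I \<Longrightarrow> smooth_on S (f i)) \<Longrightarrow> smooth_on S (\<lambda>x. \<Sum>i\<in>I. f i x)"
  by (simp add: smooth_on_def Ck_on_sum)
lemma smooth_on_Pair: "open S \<Longrightarrow> smooth_on S f \<Longrightarrow> smooth_on S g \<Longrightarrow> smooth_on S (\<lambda>x. (f x, g x))"
  by (simp add: smooth_on_def Ck_on_Pair)
lemma smooth_on_compose:
  "open S \<Longrightarrow> open T \<Longrightarrow> smooth_on T f \<Longrightarrow> smooth_on S g \<Longrightarrow> g ` S \<subseteq> T \<Longrightarrow> smooth_on S (\<lambda>x. f (g x))"
  by (simp add: smooth_on_def Ck_on_compose)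
lemma smooth_on_linear_comp: "open S \<Longrightarrow> bounded_linear L \<Longrightarrow> smooth_on S f \<Longrightarrow> smooth_on S (\<lambda>x. L (f x))"
  by (simp add: smooth_on_def Ck_on_linear_comp)
lemma smooth_on_subset: "smooth_on S f \<Longrightarrow> T \<subseteq> S \<Longrightarrow> smooth_on T f"
  by (meson smooth_on_def Ck_on_subset)
lemma smooth_on_cong: "open S \<Longrightarrow> (\<And>x. x \<in> S \<Longrightarrow> f x = g x) \<Longrightarrow> smooth_on S f \<longleftrightarrow> smooth_on S g"
  unfolding smooth_on_def using Ck_on_cong by blast
lemma smooth_on_local: "(\<And>x. x \<in> S \<Longrightarrow> \<exists>T. open T \<and> x \<in> T \<and> smooth_on T f) \<Longrightarrow> smooth_on S f"
  unfolding smooth_on_def using Ck_on_local by metis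
lemma smooth_on_fderiv: "smooth_on S f \<Longrightarrow> smooth_on S (\<lambda>x. fderiv f x v)"
  unfolding smooth_on_def using Ck_on_fderiv by blast
lemma smooth_on_continuous: "smooth_on S f \<Longrightarrow> continuous_on S f"
  using smooth_onD[of S f 0] by simp
lemma smooth_on_has_derivative: "smooth_on S f \<Longrightarrow> x \<in> S \<Longrightarrow> (f has_derivative fderiv f x) (at x)"
  using Ck_on_has_derivative[OF smooth_onD] .
lemma smooth_on_differentiable: "smooth_on S f \<Longrightarrow> x \<in> S \<Longrightarrow> f differentiable at x"
  using smooth_on_has_derivative differentiable_def by blast
lemma smooth_on_linear_fderiv: "smooth_on S f \<Longrightarrow> x \<in> S \<Longrightarrow> linear (fderiv f x)"
  using smooth_on_has_derivative has_derivative_linear by blast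
lemma smooth_on_fst: "open S \<Longrightarrow> smooth_on S f \<Longrightarrow> smooth_on S (\<lambda>x. fst (f x))"
  by (rule smooth_on_linear_comp[OF _ bounded_linear_fst])
lemma smooth_on_snd: "open S \<Longrightarrow> smooth_on S f \<Longrightarrow> smooth_on S (\<lambda>x. snd (f x))"
  by (rule smooth_on_linear_comp[OF _ bounded_linear_snd])
lemma smooth_on_vec_nth:
  fixes f :: "'a::euclidean_space \<Rightarrow> 'b::euclidean_space ^ 'i"
  shows "open S \<Longrightarrow> smooth_on S f \<Longrightarrow> smooth_on S (\<lambda>x. f x $ i)"
  by (rule smooth_on_linear_comp[OF _ bounded_linear_vec_nth])
lemma smooth_on_vec_lambda:
  fixes f :: "'i::finite \<Rightarrow> 'a::euclidean_space \<Rightarrow> 'b::euclidean_space"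
  assumes S: "open S" and f: "\<And>i. smooth_on S (f i)"
  shows "smooth_on S (\<lambda>x. \<chi> i. f i x)"
proof -
  have "linear (\<lambda>v::'b. \<chi> j. if j = i then v else 0)" for i :: 'i
    by (rule linearI) (auto simp: vec_eq_iff)
  then have "bounded_linear (\<lambda>v::'b. \<chi> j. if j = i then v else 0)" for i :: 'i
    by (simp add: linear_conv_bounded_linear)
  then have "smooth_on S (\<lambda>x. \<chi> j. if j = i then f i x else 0)" for i
    by (rule smooth_on_linear_comp[OF S _ f])
  then have "smooth_on S (\<lambda>x. \<Sum>i\<in>UNIV. (\<chi> j. if j = i then f i x else 0))"
    by (intro smooth_on_sum[OF S])
  moreover have "(\<Sum>i\<in>UNIV. (\<chi> j. if j = i then f i x else 0)) = (\<chi> i. f i x)" for x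
    by (simp add: vec_eq_iff)
  ultimately show ?thesis by simp
qed
lemma smooth_on_sqrt:
  assumes S: "open S" and f: "smooth_on S f" "\<And>x. x \<in> S \<Longrightarrow> 0 < f x"
  shows "smooth_on S (\<lambda>x. sqrt (f x))" "smooth_on S (\<lambda>x. inverse (sqrt (f x)))"
proof -
  have s: "smooth_on {0<..} sqrt" by (rule smooth_onI[OF Ck_on_sqrt])
  have 1: "smooth_on S (\<lambda>x. sqrt (f x))"
    by (rule smooth_on_compose[OF S open_greaterThan s f(1)]) (use f(2) in auto)
  then show "smooth_on S (\<lambda>x. sqrt (f x))" .
  have o: "open {x::real. x \<noteq> 0}" by (simp add: open_Collect_neq)
  have "(\<lambda>x. sqrt (f x)) ` S \<subseteq> {x. x \<noteq> 0}"
  proof clarify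
    show False if "x \<in> S" "sqrt (f x) = 0" for x using f(2)[OF that(1)] that(2) by simp
  qed
  from smooth_on_compose[OF S o smooth_onI[OF Ck_on_inverse] 1 this]
  show "smooth_on S (\<lambda>x. inverse (sqrt (f x)))" .
qed

text \<open>Fields of linear or bilinear maps are handled through their values on fixed vectors, which
  is the form in which smoothness of a metric is given; expansion in a basis turns this into
  joint smoothness.\<close>

lemma smooth_on_linear_field:
  fixes L :: "'p::euclidean_space \<Rightarrow> 'a::euclidean_space \<Rightarrow> 'b::euclidean_space"
  assumes S: "open S" and D: "open D" and L: "\<And>y. y \<in> D \<Longrightarrow> linear (L y)" "\<And>v. smooth_on D (\<lambda>y. L y v)"
    and Y: "smooth_on S Y" "Y ` S \<subseteq> D" and V: "smooth_on S V"
  shows "smooth_on S (\<lambda>x. L (Y x) (V x))"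
proof -
  have "smooth_on S (\<lambda>x. \<Sum>b\<in>Basis. (V x \<bullet> b) *\<^sub>R L (Y x) b)"
    by (intro smooth_on_sum smooth_on_scaleR smooth_on_inner smooth_on_const V S smooth_on_compose[OF S D L(2) Y])
  then show ?thesis
    by (rule smooth_on_cong[OF S, THEN iffD1, rotated]) (use linear_basis_sum[OF L(1)] Y(2) in \<open>simp add: image_subset_iff\<close>)
qed

lemma smooth_on_bilinear_field:
  fixes B :: "'p::euclidean_space \<Rightarrow> 'a::euclidean_space \<Rightarrow> 'c::euclidean_space \<Rightarrow> 'b::euclidean_space"
  assumes S: "open S" and D: "open D" and B: "\<And>y. y \<in> D \<Longrightarrow> bilinear (B y)" "\<And>u v. smooth_on D (\<lambda>y. B y u v)"
    and Y: "smooth_on S Y" "Y ` S \<subseteq> D" and U: "smooth_on S U" and V: "smooth_on S V"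
  shows "smooth_on S (\<lambda>x. B (Y x) (U x) (V x))"
proof -
  have oD: "open (D \<times> (UNIV :: 'c set))" by (intro open_Times D open_UNIV)
  have "smooth_on S (\<lambda>x. (\<lambda>p u. B (fst p) u (snd p)) (Y x, V x) (U x))"
  proof (rule smooth_on_linear_field[OF S oD _ _ _ _ U])
    show "smooth_on (D \<times> UNIV) (\<lambda>p. B (fst p) u (snd p))" for u
      by (rule smooth_on_linear_field[OF oD D, of "\<lambda>y. B y u"])
        (use B in \<open>auto simp: bilinear_def intro!: smooth_on_fst smooth_on_snd oD\<close>)
  qed (use B Y V S in \<open>auto simp: bilinear_def intro!: smooth_on_Pair\<close>)
  then show ?thesis by simp
qed

lemma has_derivative_linear_field:
  fixes L :: "'p::euclidean_space \<Rightarrow> 'a::euclidean_space \<Rightarrow> 'b::euclidean_space" and Y :: "'x::euclidean_space \<Rightarrow> 'p"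
  assumes D: "open D" "Y x \<in> D" and L: "\<And>y. y \<in> D \<Longrightarrow> linear (L y)" "\<And>v. (\<lambda>y. L y v) differentiable at (Y x)"
    and Y: "(Y has_derivative Y') (at x)" and V: "(V has_derivative V') (at x)"
  shows "((\<lambda>x. L (Y x) (V x)) has_derivative (\<lambda>h. fderiv (\<lambda>z. L z (V x)) (Y x) (Y' h) + L (Y x) (V' h))) (at x)"
proof -
  have dL: "((\<lambda>y. L y v) has_derivative fderiv (\<lambda>y. L y v) (Y x)) (at (Y x))" for v
    using L(2) by (simp add: frechet_derivative_works)
  have "isCont Y x" using Y has_derivative_continuous by blast
  then have "\<forall>\<^sub>F x' in nhds x. Y x' \<in> D"
    using D by (auto simp: isCont_def tendsto_at_iff_tendsto_nhds intro: topological_tendstoD)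
  then obtain N where N: "open N" "x \<in> N" "\<And>x'. x' \<in> N \<Longrightarrow> Y x' \<in> D" unfolding eventually_nhds by blast
  have s: "fderiv (\<lambda>z. L z (V x)) (Y x) = (\<lambda>h. \<Sum>b\<in>Basis. (V x \<bullet> b) *\<^sub>R fderiv (\<lambda>y. L y b) (Y x) h)"
  proof -
    have "((\<lambda>z. \<Sum>b\<in>Basis. (V x \<bullet> b) *\<^sub>R L z b) has_derivative (\<lambda>h. \<Sum>b\<in>Basis. (V x \<bullet> b) *\<^sub>R fderiv (\<lambda>y. L y b) (Y x) h)) (at (Y x))"
      by (intro has_derivative_sum has_derivative_scaleR_right dL)
    from has_derivative_transform_within_open[OF this D, of "\<lambda>z. L z (V x)"]
    have "((\<lambda>z. L z (V x)) has_derivative (\<lambda>h. \<Sum>b\<in>Basis. (V x \<bullet> b) *\<^sub>R fderiv (\<lambda>y. L y b) (Y x) h)) (at (Y x))"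
      using linear_basis_sum[OF L(1)] by metis
    then show ?thesis by (rule fderiv_eq)
  qed
  have "((\<lambda>x. \<Sum>b\<in>Basis. (V x \<bullet> b) *\<^sub>R L (Y x) b) has_derivative
     (\<lambda>h. \<Sum>b\<in>Basis. (V x \<bullet> b) *\<^sub>R fderiv (\<lambda>y. L y b) (Y x) (Y' h) + (V' h \<bullet> b) *\<^sub>R L (Y x) b)) (at x)"
    by (intro has_derivative_sum has_derivative_scaleR has_derivative_inner_left V has_derivative_compose[OF Y dL])
  then have "((\<lambda>x. L (Y x) (V x)) has_derivative
     (\<lambda>h. \<Sum>b\<in>Basis. (V x \<bullet> b) *\<^sub>R fderiv (\<lambda>y. L y b) (Y x) (Y' h) + (V' h \<bullet> b) *\<^sub>R L (Y x) b)) (at x)"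
    by (rule has_derivative_transform_within_open[OF _ N(1,2)]) (metis linear_basis_sum[OF L(1)] N(3))
  moreover have "L (Y x) (V' h) = (\<Sum>b\<in>Basis. (V' h \<bullet> b) *\<^sub>R L (Y x) b)" for h
    by (rule linear_basis_sum[OF L(1)[OF D(2)]])
  ultimately show ?thesis by (simp add: s sum.distrib)
qed

lemma has_derivative_bilinear_field:
  fixes B :: "'p::euclidean_space \<Rightarrow> 'a::euclidean_space \<Rightarrow> 'c::euclidean_space \<Rightarrow> 'b::euclidean_space" and Y :: "'x::euclidean_space \<Rightarrow> 'p"
  assumes D: "open D" "Y x \<in> D" and B: "\<And>y. y \<in> D \<Longrightarrow> bilinear (B y)" "\<And>u v. (\<lambda>y. B y u v) differentiable at (Y x)"
    and Y: "(Y has_derivative Y') (at x)" and V: "(V has_derivative V') (at x)" and W: "(W has_derivative W') (at x)"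
  shows "((\<lambda>x. B (Y x) (V x) (W x)) has_derivative
    (\<lambda>h. fderiv (\<lambda>z. B z (V x) (W x)) (Y x) (Y' h) + B (Y x) (V' h) (W x) + B (Y x) (V x) (W' h))) (at x)"
proof -
  have 1: "((\<lambda>p. B (fst p) v (snd p)) has_derivative
      (\<lambda>h. fderiv (\<lambda>z. B z v (snd p)) (fst p) (fst h) + B (fst p) v (snd h))) (at p)" if "fst p = Y x" for v p
    by (rule has_derivative_linear_field[OF D(1), where L="\<lambda>y. B y v" and Y=fst and V=snd])
      (use D(2) B that in \<open>auto simp: bilinear_def intro!: has_derivative_fst has_derivative_snd has_derivative_ident\<close>)
  have "((\<lambda>x. (\<lambda>p v. B (fst p) v (snd p)) (Y x, W x) (V x)) has_derivative
     (\<lambda>h. fderiv (\<lambda>p. B (fst p) (V x) (snd p)) (Y x, W x) (Y' h, W' h) + B (fst (Y x, W x)) (V' h) (snd (Y x, W x)))) (at x)"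
  proof (rule has_derivative_linear_field[of "D \<times> UNIV"])
    show "(\<lambda>p. B (fst p) v (snd p)) differentiable at (Y x, W x)" for v
      using 1[of "(Y x, W x)" v] by (auto simp: differentiable_def)
  qed (use D B Y V W in \<open>auto simp: bilinear_def intro!: open_Times has_derivative_Pair\<close>)
  then show ?thesis by (simp add: fderiv_eq[OF 1] algebra_simps)
qed

section \<open>Metrics and Christoffel symbols on an open set\<close>

locale local_metric =
  fixes D :: "'e::euclidean_space set" and G :: "'e \<Rightarrow> 'e \<Rightarrow> 'e \<Rightarrow> real"
  assumes open_D: "open D" and bil: "\<And>y. y \<in> D \<Longrightarrow> bilinear (G y)"
    and sym: "\<And>y u v. y \<in> D \<Longrightarrow> G y u v = G y v u"
    and nondegenerate: "\<And>y z. y \<in> D \<Longrightarrow> (\<And>w. G y z w = 0) \<Longrightarrow> z = 0"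
    and smooth: "\<And>u v. smooth_on D (\<lambda>y. G y u v)"
begin

definition dG :: "'e \<Rightarrow> 'e \<Rightarrow> 'e \<Rightarrow> 'e \<Rightarrow> real" where "dG y u v w = fderiv (\<lambda>z. G z v w) y u"

definition \<Gamma> :: "'e \<Rightarrow> 'e \<Rightarrow> 'e \<Rightarrow> 'e" where
  "\<Gamma> y u v = (THE z. \<forall>w. G y z w = (dG y u v w + dG y v u w - dG y w u v) / 2)"

text \<open>The vector that represents the linear form \<open>G y z\<close> with respect to the inner product of
  the model space. Through it, equations between linear forms become linear equations between
  vectors.\<close>

definition flat :: "'e \<Rightarrow> 'e \<Rightarrow> 'e" where "flat y z = (\<Sum>b\<in>Basis. G y z b *\<^sub>R b)"

lemma G_linear: "y \<in> D \<Longrightarrow> linear (G y u)" "y \<in> D \<Longrightarrow> linear (\<lambda>u. G y u v)"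
  using bil by (auto simp: bilinear_def)

lemma G_diff: "y \<in> D \<Longrightarrow> G y (u - u') v = G y u v - G y u' v"
  using linear_diff[OF G_linear(2)] .

lemma flat_inner: "y \<in> D \<Longrightarrow> flat y z \<bullet> w = G y z w"
proof -
  assume y: "y \<in> D"
  have "flat y z \<bullet> w = (\<Sum>b\<in>Basis. G y z b * (b \<bullet> w))" by (simp add: flat_def inner_sum_left)
  also have "\<dots> = (\<Sum>b\<in>Basis. (w \<bullet> b) *\<^sub>R G y z b)" by (simp add: inner_commute mult.commute)
  finally show ?thesis by (simp only: linear_basis_sum[OF G_linear(1)[OF y], symmetric])
qed

lemma flat_linear: "y \<in> D \<Longrightarrow> linear (flat y)"
  by (rule linearI; rule vector_eq_rdot[THEN iffD1])
    (simp_all add: flat_inner linear_add[OF G_linear(2)] linear_cmul[OF G_linear(2)] inner_add_left)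

lemma flat_inj: "y \<in> D \<Longrightarrow> inj (flat y)"
  using flat_inner by (auto simp: linear_injective_0[OF flat_linear] intro!: nondegenerate) (metis inner_zero_left)

lemma ex_representing_vector:
  assumes y: "y \<in> D" and \<alpha>: "linear \<alpha>"
  shows "\<exists>z. \<forall>w. G y z w = \<alpha> w"
proof -
  have "surj (flat y)" using linear_inj_imp_surj[OF flat_linear[OF y] flat_inj[OF y]] .
  then obtain z where z: "flat y z = (\<Sum>b\<in>Basis. \<alpha> b *\<^sub>R b)" by (metis surjD)
  have "G y z w = \<alpha> w" for w
  proof -
    have "G y z w = (\<Sum>b\<in>Basis. \<alpha> b * (b \<bullet> w))"
      unfolding flat_inner[OF y, symmetric] z by (simp add: inner_sum_left)
    also have "\<dots> = (\<Sum>b\<in>Basis. (w \<bullet> b) *\<^sub>R \<alpha> b)" by (simp add: inner_commute mult.commute)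
    finally show ?thesis by (simp only: linear_basis_sum[OF \<alpha>, symmetric])
  qed
  then show ?thesis by blast
qed

lemma representing_vector_unique:
  assumes "y \<in> D" "\<And>w. G y z w = G y z' w" shows "z = z'"
  using nondegenerate[OF assms(1), of "z - z'"] assms by (simp add: G_diff)

text \<open>Smoothness of vector fields that are defined implicitly by the metric; it serves for the
  Christoffel symbols and for the gradient of a coordinate.\<close>

lemma smooth_representing_vector:
  assumes S: "open S" "S \<subseteq> D" and a: "\<And>b. smooth_on S (\<lambda>y. \<alpha> y b)" and z: "\<And>y w. y \<in> S \<Longrightarrow> G y (z y) w = \<alpha> y w"
  shows "smooth_on S z"
proof (rule smooth_onI)
  fix k
  have sG: "smooth_on S (\<lambda>y. G y u v)" for u v by (rule smooth_on_subset[OF smooth S(2)])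
  show "Ck_on k S z"
  proof (rule Ck_on_linear_solve[OF S(1), where L=flat])
    show "linear (flat y)" "inj (flat y)" if "y \<in> S" for y using that S(2) flat_linear flat_inj by auto
    show "Ck_on k S (\<lambda>y. flat y w)" for w
      unfolding flat_def by (rule smooth_onD) (intro smooth_on_sum smooth_on_scaleR smooth_on_const S sG)
    show "Ck_on k S (\<lambda>y. \<Sum>b\<in>Basis. \<alpha> y b *\<^sub>R b)"
      by (rule smooth_onD) (intro smooth_on_sum smooth_on_scaleR smooth_on_const S a)
    show "flat y (z y) = (\<Sum>b\<in>Basis. \<alpha> y b *\<^sub>R b)" if "y \<in> S" for y using z[OF that] by (simp add: flat_def)
  qed
qed

lemma G_differentiable: "y \<in> D \<Longrightarrow> (\<lambda>z. G z v w) differentiable at y"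
  by (rule smooth_on_differentiable[OF smooth])

lemma dG_has_derivative: "y \<in> D \<Longrightarrow> ((\<lambda>z. G z v w) has_derivative (\<lambda>u. dG y u v w)) (at y)"
  unfolding dG_def by (rule smooth_on_has_derivative[OF smooth])

lemma dG_linear:
  assumes y: "y \<in> D"
  shows "linear (\<lambda>u. dG y u v w)" "linear (\<lambda>v. dG y u v w)" "linear (\<lambda>w. dG y u v w)"
proof -
  show "linear (\<lambda>u. dG y u v w)" using dG_has_derivative[OF y] has_derivative_linear by blast
  have eqD: "D' = (\<lambda>u. dG y u a b)" if "((\<lambda>z. G z a b) has_derivative D') (at y)" for D' a b
    using has_derivative_unique[OF that dG_has_derivative[OF y]] .
  have 1: "dG y u (a + b) w = dG y u a w + dG y u b w" for a b w
  proof -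
    have "((\<lambda>z. G z (a + b) w) has_derivative (\<lambda>u. dG y u a w + dG y u b w)) (at y)"
      by (rule has_derivative_transform_within_open[OF has_derivative_add[OF dG_has_derivative[OF y, of a w] dG_has_derivative[OF y, of b w]] open_D y])
        (simp add: linear_add[OF G_linear(2)])
    from eqD[OF this] show ?thesis by metis
  qed
  have 2: "dG y u (c *\<^sub>R a) w = c *\<^sub>R dG y u a w" for c a w
  proof -
    have "((\<lambda>z. G z (c *\<^sub>R a) w) has_derivative (\<lambda>u. c *\<^sub>R dG y u a w)) (at y)"
      by (rule has_derivative_transform_within_open[OF has_derivative_scaleR_right[OF dG_has_derivative[OF y, of a w]] open_D y])
        (simp add: linear_cmul[OF G_linear(2)])
    from eqD[OF this] show ?thesis by metis
  qed
  show "linear (\<lambda>v. dG y u v w)" by (rule linearI) (rule 1, rule 2)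
  have "dG y u a b = dG y u b a" for a b
    using fderiv_cong(2)[OF open_D y, of "\<lambda>z. G z a b" "\<lambda>z. G z b a"] sym by (simp add: dG_def)
  then show "linear (\<lambda>w. dG y u v w)" using \<open>linear (\<lambda>v. dG y u v w)\<close> 1 2 by (intro linearI) metis+
qed

lemma dG_sym: "y \<in> D \<Longrightarrow> dG y u a b = dG y u b a"
  using fderiv_cong(2)[OF open_D, of y "\<lambda>z. G z a b" "\<lambda>z. G z b a"] sym by (simp add: dG_def)

lemma \<Gamma>_eq:
  assumes y: "y \<in> D"
  shows "G y (\<Gamma> y u v) w = (dG y u v w + dG y v u w - dG y w u v) / 2"
proof -
  have "linear (\<lambda>w. (dG y u v w + dG y v u w - dG y w u v) / 2)"
    by (rule linearI)
      (simp_all add: linear_add[OF dG_linear(3)[OF y]] linear_add[OF dG_linear(1)[OF y]]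
        linear_cmul[OF dG_linear(3)[OF y]] linear_cmul[OF dG_linear(1)[OF y]] field_simps)
  from ex_representing_vector[OF y this]
  have "\<exists>!z. \<forall>w. G y z w = (dG y u v w + dG y v u w - dG y w u v) / 2"
    using representing_vector_unique[OF y] by metis
  from theI'[OF this] show ?thesis unfolding \<Gamma>_def by blast
qed

lemma \<Gamma>_unique:
  assumes "y \<in> D" "\<And>w. G y z w = (dG y u v w + dG y v u w - dG y w u v) / 2"
  shows "\<Gamma> y u v = z"
  by (rule representing_vector_unique[OF assms(1)]) (simp add: \<Gamma>_eq[OF assms(1)] assms(2))

lemma \<Gamma>_bilinear: assumes y: "y \<in> D" shows "bilinear (\<Gamma> y)"
proof -
  have s: "\<Gamma> y u v = \<Gamma> y v u" for u v
    by (rule \<Gamma>_unique[OF y]) (simp add: \<Gamma>_eq[OF y] dG_sym[OF y, of _ v u] add.commute)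
  have l: "linear (\<lambda>u. \<Gamma> y u v)" for v
  proof (rule linearI)
    show "\<Gamma> y (a + b) v = \<Gamma> y a v + \<Gamma> y b v" for a b
      by (rule \<Gamma>_unique[OF y]) (simp add: linear_add[OF G_linear(2)[OF y]] \<Gamma>_eq[OF y] linear_add[OF dG_linear(1)[OF y]] linear_add[OF dG_linear(2)[OF y]] field_simps)
    show "\<Gamma> y (c *\<^sub>R a) v = c *\<^sub>R \<Gamma> y a v" for c a
      by (rule \<Gamma>_unique[OF y]) (simp add: linear_cmul[OF G_linear(2)[OF y]] \<Gamma>_eq[OF y] linear_cmul[OF dG_linear(1)[OF y]] linear_cmul[OF dG_linear(2)[OF y]] field_simps)
  qed
  moreover have "\<Gamma> y u = (\<lambda>v. \<Gamma> y v u)" for u using s by auto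
  ultimately have "linear (\<Gamma> y u)" for u by metis
  then show ?thesis using l by (simp add: bilinear_def)
qed

lemma \<Gamma>_smooth: "smooth_on D (\<lambda>y. \<Gamma> y u v)"
proof (rule smooth_representing_vector[OF open_D subset_refl])
  have "smooth_on D (\<lambda>y. dG y a b c)" for a b c unfolding dG_def by (rule smooth_on_fderiv[OF smooth])
  then have "smooth_on D (\<lambda>y. (1/2) *\<^sub>R (dG y u v b + dG y v u b - dG y b u v))" for b
    by (intro smooth_on_scaleR smooth_on_diff smooth_on_add smooth_on_const open_D)
  then show "smooth_on D (\<lambda>y. (dG y u v b + dG y v u b - dG y b u v) / 2)" for b by simp
qed (rule \<Gamma>_eq)

text \<open>The two Koszul formulas add up to a single derivative of the metric.\<close>

lemma metric_compatible: "y \<in> D \<Longrightarrow> G y (\<Gamma> y u v) w + G y v (\<Gamma> y u w) = dG y u v w"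
  using \<Gamma>_eq[of y u v w] \<Gamma>_eq[of y u w v] sym[of y v "\<Gamma> y u w"] dG_sym[of y] by (simp add: field_simps)

lemma parallel_preserves_metric:
  assumes J: "open J" "is_interval J" and t0: "t0 \<in> J" and Y: "\<And>t. t \<in> J \<Longrightarrow> Y t \<in> D"
    and dY: "\<And>t. t \<in> J \<Longrightarrow> (Y has_vector_derivative Y' t) (at t)"
    and dV: "\<And>t. t \<in> J \<Longrightarrow> (V has_vector_derivative - \<Gamma> (Y t) (Y' t) (V t)) (at t)"
    and dW: "\<And>t. t \<in> J \<Longrightarrow> (W has_vector_derivative - \<Gamma> (Y t) (Y' t) (W t)) (at t)" and t: "t \<in> J"
  shows "G (Y t) (V t) (W t) = G (Y t0) (V t0) (W t0)"
proof -
  have "((\<lambda>t. G (Y t) (V t) (W t)) has_derivative (\<lambda>h. 0)) (at t)" if t: "t \<in> J" for t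
  proof -
    note y = Y[OF t]
    have "((\<lambda>t. G (Y t) (V t) (W t)) has_derivative
      (\<lambda>h. fderiv (\<lambda>z. G z (V t) (W t)) (Y t) (h *\<^sub>R Y' t) + G (Y t) (h *\<^sub>R - \<Gamma> (Y t) (Y' t) (V t)) (W t) + G (Y t) (V t) (h *\<^sub>R - \<Gamma> (Y t) (Y' t) (W t)))) (at t)"
      using has_derivative_bilinear_field[where B=G, OF open_D y bil G_differentiable[OF y]
          dY[OF t, unfolded has_vector_derivative_def] dV[OF t, unfolded has_vector_derivative_def] dW[OF t, unfolded has_vector_derivative_def]] .
    moreover have "fderiv (\<lambda>z. G z (V t) (W t)) (Y t) (h *\<^sub>R Y' t) + G (Y t) (h *\<^sub>R - \<Gamma> (Y t) (Y' t) (V t)) (W t) + G (Y t) (V t) (h *\<^sub>R - \<Gamma> (Y t) (Y' t) (W t)) = 0" for h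
    proof -
      have "fderiv (\<lambda>z. G z (V t) (W t)) (Y t) (h *\<^sub>R Y' t) = h * dG (Y t) (Y' t) (V t) (W t)"
        using linear_cmul[OF dG_linear(1)[OF y]] by (simp add: dG_def)
      then show ?thesis unfolding metric_compatible[OF y, symmetric]
        by (simp only: linear_cmul[OF G_linear(1)[OF y]] linear_cmul[OF G_linear(2)[OF y]] linear_neg[OF G_linear(1)[OF y]] linear_neg[OF G_linear(2)[OF y]])
          (simp add: algebra_simps)
    qed
    ultimately show ?thesis by simp
  qed
  then show ?thesis
    using has_derivative_zero_unique[of J "\<lambda>t. G (Y t) (V t) (W t)" t0 t] J t0 t is_interval_convex
    by (metis has_derivative_at_withinI)
qed

end

text \<open>Differentiating \<open>G y u v = G' (\<tau> y) (\<tau>' u) (\<tau>' v)\<close> produces, besides the derivative of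
  \<open>G'\<close>, two terms with second derivatives of \<open>\<tau>\<close>. In the Koszul combination the symmetry of the
  second derivative cancels all but one of them.\<close>

lemma christoffel_transformation:
  fixes G :: "'e::euclidean_space \<Rightarrow> 'e \<Rightarrow> 'e \<Rightarrow> real" and G' :: "'e \<Rightarrow> 'e \<Rightarrow> 'e \<Rightarrow> real" and \<tau> :: "'e \<Rightarrow> 'e"
  assumes "local_metric D G" "local_metric D' G'" and S: "open S" "S \<subseteq> D" "\<tau> ` S \<subseteq> D'"
    and \<tau>: "smooth_on S \<tau>" and surj: "\<And>y. y \<in> S \<Longrightarrow> surj (fderiv \<tau> y)"
    and G: "\<And>y u v. y \<in> S \<Longrightarrow> G y u v = G' (\<tau> y) (fderiv \<tau> y u) (fderiv \<tau> y v)" and y: "y \<in> S"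
  shows "fderiv \<tau> y (local_metric.\<Gamma> G y u v) =
    local_metric.\<Gamma> G' (\<tau> y) (fderiv \<tau> y u) (fderiv \<tau> y v) + fderiv (\<lambda>z. fderiv \<tau> z v) y u"
proof -
  interpret M: local_metric D G by fact
  interpret M': local_metric D' G' by fact
  define D2 where "D2 a b = fderiv (\<lambda>z. fderiv \<tau> z b) y a" for a b
  let ?L = "fderiv \<tau> y"
  have D2_sym: "D2 a b = D2 b a" for a b
    unfolding D2_def by (rule second_derivative_symmetric[OF S(1) y smooth_onD[OF \<tau>]])
  have y': "\<tau> y \<in> D'" "y \<in> D" using S y by auto
  have dd: "M.dG y a b c = M'.dG (\<tau> y) (?L a) (?L b) (?L c) + G' (\<tau> y) (D2 a b) (?L c) + G' (\<tau> y) (?L b) (D2 a c)" for a b c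
  proof -
    have d2: "((\<lambda>z. fderiv \<tau> z b) has_derivative (\<lambda>a. D2 a b)) (at y)" for b
      unfolding D2_def by (rule smooth_on_has_derivative[OF smooth_on_fderiv[OF \<tau>] y])
    have "((\<lambda>z. G' (\<tau> z) (fderiv \<tau> z b) (fderiv \<tau> z c)) has_derivative
      (\<lambda>a. fderiv (\<lambda>z. G' z (?L b) (?L c)) (\<tau> y) (?L a) + G' (\<tau> y) (D2 a b) (?L c) + G' (\<tau> y) (?L b) (D2 a c))) (at y)"
      using has_derivative_bilinear_field[where B=G', OF M'.open_D y'(1) M'.bil M'.G_differentiable[OF y'(1)]
          smooth_on_has_derivative[OF \<tau> y] d2 d2] .
    then have "((\<lambda>z. G z b c) has_derivative
      (\<lambda>a. fderiv (\<lambda>z. G' z (?L b) (?L c)) (\<tau> y) (?L a) + G' (\<tau> y) (D2 a b) (?L c) + G' (\<tau> y) (?L b) (D2 a c))) (at y)"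
      by (rule has_derivative_transform_within_open[OF _ S(1) y]) (simp add: G)
    from fderiv_eq[OF this] show ?thesis by (simp add: M.dG_def M'.dG_def)
  qed
  obtain z where z: "?L z = M'.\<Gamma> (\<tau> y) (?L u) (?L v) + D2 u v" using surj[OF y] by (metis surjD)
  have "M.\<Gamma> y u v = z"
  proof (rule M.\<Gamma>_unique[OF y'(2)])
    fix w
    show "G y z w = (M.dG y u v w + M.dG y v u w - M.dG y w u v) / 2"
      unfolding G[OF y] z dd linear_add[OF M'.G_linear(2)[OF y'(1)]] M'.\<Gamma>_eq[OF y'(1)]
      using M'.sym[OF y'(1)] D2_sym by (simp add: field_simps)
  qed
  then show ?thesis using z by (simp add: D2_def)
qed

section \<open>Charts and coordinate changes\<close>

lemma chart_inv_left: "is_chart c \<Longrightarrow> x \<in> fst c \<Longrightarrow> chart_inv c (snd c x) = x"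
  unfolding is_chart_def by (meson homeomorphism_apply1)

lemma chart_inv_right:
  "is_chart c \<Longrightarrow> y \<in> snd c ` fst c \<Longrightarrow> snd c (chart_inv c y) = y"
  "is_chart c \<Longrightarrow> y \<in> snd c ` fst c \<Longrightarrow> chart_inv c y \<in> fst c"
  by (auto simp: chart_inv_left)

lemma chart_open: "is_chart c \<Longrightarrow> open (fst c)" "is_chart c \<Longrightarrow> open (snd c ` fst c)"
  by (auto simp: is_chart_def)

lemma chart_continuous: "is_chart c \<Longrightarrow> continuous_on (fst c) (snd c)"
  "is_chart c \<Longrightarrow> continuous_on (snd c ` fst c) (chart_inv c)"
  by (auto simp: is_chart_def homeomorphism_def)

lemma chart_preimage_open:
  assumes c: "is_chart c" and V: "open V" shows "open {x \<in> fst c. snd c x \<in> V}"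
proof -
  have "open (snd c -` V \<inter> fst c)"
    using continuous_on_open_vimage[OF chart_open(1)[OF c], THEN iffD1, OF chart_continuous(1)[OF c]] V by blast
  then show ?thesis by (simp add: vimage_def Int_def conj_commute)
qed

lemma chart_image_open:
  assumes c: "is_chart c" and U: "open U" shows "open (snd c ` (fst c \<inter> U))"
proof -
  have "open (chart_inv c -` U \<inter> snd c ` fst c)"
    using continuous_on_open_vimage[OF chart_open(2)[OF c], THEN iffD1, OF chart_continuous(2)[OF c]] U by blast
  moreover have "chart_inv c -` U \<inter> snd c ` fst c = snd c ` (fst c \<inter> U)"
    using chart_inv_left[OF c] by auto
  ultimately show ?thesis by simp
qed

lemma chart_inv_image_open:
  assumes c: "is_chart c" and V: "open V" "V \<subseteq> snd c ` fst c" shows "open (chart_inv c ` V)"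
proof -
  have "chart_inv c ` V = {x \<in> fst c. snd c x \<in> V}"
    using V(2) chart_inv_left[OF c] chart_inv_right[OF c] by (force simp: image_iff)
  then show ?thesis using chart_preimage_open[OF c V(1)] by simp
qed

lemma transition_at: "is_chart c \<Longrightarrow> x \<in> fst c \<Longrightarrow> transition c c' (snd c x) = snd c' x"
  by (simp add: transition_def chart_inv_left)

text \<open>Indexed by the point of the manifold instead of its coordinates, so that the chain rule
  reads as a cocycle identity.\<close>

definition jacobian :: "('m, 'n::finite) chart \<Rightarrow> ('m, 'n) chart \<Rightarrow> 'm \<Rightarrow> 'n model \<Rightarrow> 'n model" where
  "jacobian c c' x = fderiv (transition c c') (snd c x)"

context smooth_manifold
begin

lemma atlas_subset_maximal: "c \<in> A \<Longrightarrow> c \<in> maximal_atlas A"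
  by (simp add: maximal_atlas_def charts compat)

lemma maximal_is_chart: "c \<in> maximal_atlas A \<Longrightarrow> is_chart c"
  by (simp add: maximal_atlas_def)

lemma chart_at: "chart_at A p \<in> A" "p \<in> fst (chart_at A p)"
proof -
  have "\<exists>c. c \<in> A \<and> p \<in> fst c" using cover by blast
  from someI_ex[OF this] show "chart_at A p \<in> A" "p \<in> fst (chart_at A p)" by (auto simp: chart_at_def)
qed

lemma chart_at_maximal: "chart_at A p \<in> maximal_atlas A"
  by (rule atlas_subset_maximal[OF chart_at(1)])

lemma overlap_open:
  "c \<in> maximal_atlas A \<Longrightarrow> c' \<in> maximal_atlas A \<Longrightarrow> open (snd c ` (fst c \<inter> fst c'))"
  by (intro chart_image_open chart_open maximal_is_chart)

text \<open>Near each point a transition between two charts of the maximal atlas factors through a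
  chart of the atlas itself.\<close>

lemma smooth_transition:
  assumes c: "c \<in> maximal_atlas A" and c': "c' \<in> maximal_atlas A"
  shows "smooth_on (snd c ` (fst c \<inter> fst c')) (transition c c')"
proof (rule smooth_on_local)
  note ch = maximal_is_chart[OF c] maximal_is_chart[OF c']
  fix y assume "y \<in> snd c ` (fst c \<inter> fst c')"
  then obtain x where x: "x \<in> fst c" "x \<in> fst c'" "y = snd c x" by auto
  define a where "a = chart_at A x"
  have a: "a \<in> A" "x \<in> fst a" "is_chart a" using chart_at charts by (auto simp: a_def)
  define S where "S = snd c ` (fst c \<inter> (fst c' \<inter> fst a))"
  have oS: "open S" unfolding S_def by (intro chart_image_open ch open_Int chart_open a)
  have oT: "open (snd a ` (fst a \<inter> fst c'))" by (intro chart_image_open chart_open ch a)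
  have 1: "smooth_on (snd a ` (fst a \<inter> fst c')) (transition a c')"
    using c' a(1) by (auto simp: maximal_atlas_def compatible_def Int_commute)
  have 2: "smooth_on S (transition c a)"
    using c a(1) by (auto simp: maximal_atlas_def compatible_def S_def intro: smooth_on_subset)
  have "transition c a ` S \<subseteq> snd a ` (fst a \<inter> fst c')"
  proof (rule image_subsetI)
    fix y assume "y \<in> S"
    then obtain z where "z \<in> fst c" "z \<in> fst c'" "z \<in> fst a" "y = snd c z" unfolding S_def by blast
    then show "transition c a y \<in> snd a ` (fst a \<inter> fst c')" by (simp add: transition_at ch)
  qed
  from smooth_on_compose[OF oS oT 1 2 this]
  have "smooth_on S (\<lambda>y. transition a c' (transition c a y))" .
  then have "smooth_on S (transition c c')"
    by (rule smooth_on_cong[OF oS, THEN iffD1, rotated]) (auto simp: S_def transition_at ch a)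
  moreover have "y \<in> S" using x a by (auto simp: S_def)
  ultimately show "\<exists>T. open T \<and> y \<in> T \<and> smooth_on T (transition c c')" using oS by blast
qed

lemma jacobian_has_derivative:
  assumes "c \<in> maximal_atlas A" "c' \<in> maximal_atlas A" "x \<in> fst c" "x \<in> fst c'"
  shows "(transition c c' has_derivative jacobian c c' x) (at (snd c x))"
  unfolding jacobian_def by (rule smooth_on_has_derivative[OF smooth_transition]) (use assms in auto)

lemma jacobian_linear:
  assumes "c \<in> maximal_atlas A" "c' \<in> maximal_atlas A" "x \<in> fst c" "x \<in> fst c'"
  shows "linear (jacobian c c' x)"
  using jacobian_has_derivative[OF assms] has_derivative_linear by blast

lemma jacobian_compose:
  assumes c: "c \<in> maximal_atlas A" "c' \<in> maximal_atlas A" "c'' \<in> maximal_atlas A"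
    and x: "x \<in> fst c" "x \<in> fst c'" "x \<in> fst c''"
  shows "jacobian c c'' x v = jacobian c' c'' x (jacobian c c' x v)"
proof -
  note ch = c[THEN maximal_is_chart]
  define S where "S = snd c ` (fst c \<inter> (fst c' \<inter> fst c''))"
  have oS: "open S" unfolding S_def by (intro chart_image_open ch open_Int chart_open)
  have "(transition c' c'' has_derivative jacobian c' c'' x) (at (transition c c' (snd c x)))"
    using jacobian_has_derivative[OF c(2,3) x(2,3)] by (simp add: transition_at ch x)
  from has_derivative_compose[OF jacobian_has_derivative[OF c(1,2) x(1,2)] this]
  have "((\<lambda>y. transition c' c'' (transition c c' y)) has_derivative (\<lambda>v. jacobian c' c'' x (jacobian c c' x v))) (at (snd c x))" .
  then have "(transition c c'' has_derivative (\<lambda>v. jacobian c' c'' x (jacobian c c' x v))) (at (snd c x))"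
    by (rule has_derivative_transform_within_open[OF _ oS]) (use x in \<open>auto simp: S_def transition_at ch\<close>)
  from fderiv_eq[OF this] show ?thesis by (simp add: jacobian_def)
qed

lemma jacobian_self:
  assumes c: "c \<in> maximal_atlas A" and x: "x \<in> fst c"
  shows "jacobian c c x v = v"
proof -
  note ch = maximal_is_chart[OF c]
  have "(transition c c has_derivative (\<lambda>v. v)) (at (snd c x))"
    by (rule has_derivative_transform_within_open[OF has_derivative_ident chart_open(2)[OF ch]]) (use x in \<open>auto simp: transition_at ch\<close>)
  from fderiv_eq[OF this] show ?thesis by (simp add: jacobian_def)
qed

lemma jacobian_inverse:
  assumes "c \<in> maximal_atlas A" "c' \<in> maximal_atlas A" "x \<in> fst c" "x \<in> fst c'"
  shows "jacobian c' c x (jacobian c c' x v) = v"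
  using jacobian_compose[of c c' c x v] jacobian_self[of c x v] assms by simp

lemma components_jacobian: "components A c x v = jacobian (chart_at A x) c x v"
  by (simp add: components_def jacobian_def)

lemma from_components_jacobian: "from_components A c x v = jacobian c (chart_at A x) x v"
  by (simp add: from_components_def jacobian_def)

lemma components_from_components [simp]:
  "c \<in> maximal_atlas A \<Longrightarrow> x \<in> fst c \<Longrightarrow> components A c x (from_components A c x v) = v"
  "c \<in> maximal_atlas A \<Longrightarrow> x \<in> fst c \<Longrightarrow> from_components A c x (components A c x v) = v"
  by (simp_all add: components_jacobian from_components_jacobian jacobian_inverse chart_at_maximal chart_at(2))

lemma components_linear: "c \<in> maximal_atlas A \<Longrightarrow> x \<in> fst c \<Longrightarrow> linear (components A c x)"
  using jacobian_linear[OF chart_at_maximal _ chart_at(2), of c x] by (simp add: components_jacobian[abs_def])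

lemma from_components_linear: "c \<in> maximal_atlas A \<Longrightarrow> x \<in> fst c \<Longrightarrow> linear (from_components A c x)"
  using jacobian_linear[OF _ chart_at_maximal _ chart_at(2), of c x] by (simp add: from_components_jacobian[abs_def])

lemma components_change:
  assumes "c \<in> maximal_atlas A" "c' \<in> maximal_atlas A" "x \<in> fst c" "x \<in> fst c'"
  shows "components A c' x v = jacobian c c' x (components A c x v)"
  unfolding components_jacobian by (rule jacobian_compose) (use assms chart_at_maximal chart_at in auto)

lemma smooth_into_chart_inv:
  assumes c: "c \<in> maximal_atlas A" and S: "open S" and f: "smooth_on S f" "f ` S \<subseteq> snd c ` fst c"
  shows "smooth_into A S (\<lambda>x. chart_inv c (f x))"
  unfolding smooth_into_def
proof (intro conjI ballI)
  note ch = maximal_is_chart[OF c]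
  show ct: "continuous_on S (\<lambda>x. chart_inv c (f x))"
    by (rule continuous_on_compose2[OF chart_continuous(2)[OF ch] smooth_on_continuous[OF f(1)] f(2)])
  fix a assume a: "a \<in> A"
  let ?S = "{x \<in> S. chart_inv c (f x) \<in> fst a}"
  have "open ((\<lambda>x. chart_inv c (f x)) -` fst a \<inter> S)"
    using continuous_on_open_vimage[OF S, THEN iffD1, OF ct] chart_open(1)[OF charts[OF a]] by blast
  then have oS: "open ?S" by (simp add: vimage_def Int_def conj_commute)
  have "smooth_on ?S (\<lambda>x. transition c a (f x))"
  proof (rule smooth_on_compose[OF oS overlap_open[OF c atlas_subset_maximal[OF a]] smooth_transition[OF c atlas_subset_maximal[OF a]]])
    show "smooth_on ?S f" by (rule smooth_on_subset[OF f(1)]) auto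
    show "f ` ?S \<subseteq> snd c ` (fst c \<inter> fst a)"
      using f(2) chart_inv_right[OF ch] by (force simp: image_iff)
  qed
  then show "smooth_on ?S (snd a \<circ> (\<lambda>x. chart_inv c (f x)))" by (simp add: transition_def o_def)
qed

lemma smooth_into_coordinates:
  assumes c: "c \<in> maximal_atlas A" and S: "open S" and f: "smooth_into A S f"
  shows "smooth_on {x \<in> S. f x \<in> fst c} (\<lambda>x. snd c (f x))" "open {x \<in> S. f x \<in> fst c}"
proof -
  have op: "open {x \<in> S. f x \<in> U}" if "open U" for U
  proof -
    have "open (f -` U \<inter> S)"
      using continuous_on_open_vimage[OF S, THEN iffD1, of f] f that by (auto simp: smooth_into_def)
    then show ?thesis by (simp add: vimage_def Int_def conj_commute)
  qed
  note ch = maximal_is_chart[OF c]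
  show "open {x \<in> S. f x \<in> fst c}" by (rule op[OF chart_open(1)[OF ch]])
  show "smooth_on {x \<in> S. f x \<in> fst c} (\<lambda>x. snd c (f x))"
  proof (rule smooth_on_local)
    fix x assume x: "x \<in> {x \<in> S. f x \<in> fst c}"
    define a where "a = chart_at A (f x)"
    have a: "a \<in> A" "f x \<in> fst a" "a \<in> maximal_atlas A" using chart_at atlas_subset_maximal by (auto simp: a_def)
    note cha = maximal_is_chart[OF a(3)]
    let ?T = "{x \<in> S. f x \<in> fst c \<inter> fst a}"
    have oT: "open ?T" by (intro op open_Int chart_open ch cha)
    have "smooth_on ?T (\<lambda>x. transition a c (snd a (f x)))"
    proof (rule smooth_on_compose[OF oT overlap_open[OF a(3) c] smooth_transition[OF a(3) c]])
      show "smooth_on ?T (\<lambda>x. snd a (f x))"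
        using f a(1) by (auto simp: smooth_into_def o_def intro: smooth_on_subset)
    qed auto
    then have "smooth_on ?T (\<lambda>x. snd c (f x))"
      by (rule smooth_on_cong[OF oT, THEN iffD1, rotated]) (simp add: transition_at cha)
    then show "\<exists>T. open T \<and> x \<in> T \<and> smooth_on T (\<lambda>x. snd c (f x))" using oT x a by blast
  qed
qed

lemma velocity_components:
  assumes c: "c \<in> maximal_atlas A" and J: "open J" "t \<in> J" and \<gamma>: "smooth_into A J \<gamma>" and t: "\<gamma> t \<in> fst c"
  shows "((\<lambda>s. snd c (\<gamma> s)) has_vector_derivative components A c (\<gamma> t) (velocity A \<gamma> t)) (at t)"
proof -
  define a where "a = chart_at A (\<gamma> t)"
  have a: "a \<in> maximal_atlas A" "\<gamma> t \<in> fst a" using chart_at_maximal chart_at by (auto simp: a_def)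
  note s = smooth_into_coordinates[OF a(1) J(1) \<gamma>]
  note sc = smooth_into_coordinates[OF c J(1) \<gamma>]
  have "(\<lambda>s. snd a (\<gamma> s)) differentiable at t"
    by (rule smooth_on_differentiable[OF s(1)]) (use J a in auto)
  then have 1: "((\<lambda>s. snd a (\<gamma> s)) has_vector_derivative velocity A \<gamma> t) (at t)"
    by (simp add: velocity_def a_def o_def vector_derivative_works)
  have 2: "(transition a c has_derivative jacobian a c (\<gamma> t)) (at (snd a (\<gamma> t)))"
    by (rule jacobian_has_derivative[OF a(1) c a(2) t])
  from has_derivative_compose[OF 1[unfolded has_vector_derivative_def] 2]
  have "((\<lambda>s. transition a c (snd a (\<gamma> s))) has_vector_derivative jacobian a c (\<gamma> t) (velocity A \<gamma> t)) (at t)"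
    by (simp add: has_vector_derivative_def linear_cmul[OF jacobian_linear[OF a(1) c a(2) t]])
  then have "((\<lambda>s. snd c (\<gamma> s)) has_vector_derivative jacobian a c (\<gamma> t) (velocity A \<gamma> t)) (at t)"
    by (rule has_vector_derivative_transform_within_open[OF _ open_Int[OF s(2) sc(2)]])
      (use J a t in \<open>auto simp: transition_at maximal_is_chart\<close>)
  then show ?thesis by (simp add: components_jacobian a_def)
qed

end

section \<open>The metric and its connection in coordinates\<close>

lemma lorentz_form_nondegenerate:
  fixes B :: "'n::finite model \<Rightarrow> 'n model \<Rightarrow> real"
  assumes B: "lorentz_form B" and z: "\<And>w. B z w = 0"
  shows "z = 0"
proof -
  obtain L :: "'n model \<Rightarrow> 'n model" where L: "linear L" "bij L"
    "\<And>u v. B (L u) (L v) = - (fst u * fst v) + snd u \<bullet> snd v"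
    using B by (auto simp: lorentz_form_def)
  obtain u where u: "z = L u" using L(2) by (metis bij_pointE)
  have "- (fst u * fst (- fst u, snd u)) + snd u \<bullet> snd (- fst u, snd u) = 0"
    using z[of "L (- fst u, snd u)"] L(3) u by metis
  then have "fst u * fst u + snd u \<bullet> snd u = 0" by simp
  then have "fst u = 0" "snd u = 0"
    using zero_le_square[of "fst u"] inner_ge_zero[of "snd u"] by (auto simp: add_nonneg_eq_0_iff)
  then have "u = 0" by (simp add: prod_eq_iff)
  then show ?thesis using u L(1) by (simp add: linear_0)
qed

context lorentzian_manifold
begin

abbreviation gc :: "('m, 'n) chart \<Rightarrow> 'n model \<Rightarrow> 'n model \<Rightarrow> 'n model \<Rightarrow> real" where
  "gc \<equiv> metric_in_chart A g"

lemma g_bilinear: "bilinear (g x)" and g_sym: "g x u v = g x v u"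
  using lorentz[of x] unfolding lorentz_form_def by blast+

lemma metric_at: "is_chart c \<Longrightarrow> x \<in> fst c \<Longrightarrow> gc c (snd c x) u v = g x (from_components A c x u) (from_components A c x v)"
  by (simp add: metric_in_chart_def chart_inv_left)

lemma g_components:
  assumes "c \<in> maximal_atlas A" "x \<in> fst c"
  shows "g x u v = gc c (snd c x) (components A c x u) (components A c x v)"
  using assms by (simp add: metric_at maximal_is_chart)

lemma metric_change:
  assumes "c \<in> maximal_atlas A" "c' \<in> maximal_atlas A" "x \<in> fst c" "x \<in> fst c'"
  shows "gc c (snd c x) u v = gc c' (snd c' x) (jacobian c c' x u) (jacobian c c' x v)"
proof -
  have "gc c (snd c x) u v = g x (from_components A c x u) (from_components A c x v)"
    using assms by (simp add: metric_at maximal_is_chart)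
  also have "\<dots> = gc c' (snd c' x) (components A c' x (from_components A c x u)) (components A c' x (from_components A c x v))"
    by (rule g_components[OF assms(2,4)])
  finally show ?thesis using assms by (simp add: components_change[of c c'])
qed

lemma metric_bilinear:
  assumes "c \<in> maximal_atlas A" "y \<in> snd c ` fst c"
  shows "bilinear (gc c y)"
proof -
  obtain x where x: "x \<in> fst c" "y = snd c x" using assms by auto
  have "gc c y = (\<lambda>u v. g x (from_components A c x u) (from_components A c x v))"
    using assms x by (intro ext) (simp add: metric_at maximal_is_chart)
  moreover have "linear (\<lambda>u. g x v (from_components A c x u))" "linear (\<lambda>u. g x (from_components A c x u) v)" for v
    using g_bilinear[of x] linear_compose[OF from_components_linear[OF assms(1) x(1)], of "g x v"]
      linear_compose[OF from_components_linear[OF assms(1) x(1)], of "\<lambda>u. g x u v"]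
    unfolding bilinear_def o_def by blast+
  ultimately show ?thesis unfolding bilinear_def by simp
qed

lemma local_metric: assumes c: "c \<in> maximal_atlas A" shows "local_metric (snd c ` fst c) (gc c)"
proof
  note ch = maximal_is_chart[OF c]
  show "open (snd c ` fst c)" by (rule chart_open[OF ch])
  show "bilinear (gc c y)" if "y \<in> snd c ` fst c" for y by (rule metric_bilinear[OF c that])
  show "gc c y u v = gc c y v u" for y u v by (simp add: metric_in_chart_def Let_def g_sym)
  show "z = 0" if y: "y \<in> snd c ` fst c" and z: "\<And>w. gc c y z w = 0" for y z
  proof -
    obtain x where x: "x \<in> fst c" "y = snd c x" using y by auto
    have "g x (from_components A c x z) w = 0" for w
      using z[of "components A c x w"] x c by (simp add: metric_at ch)
    then have "from_components A c x z = 0" by (rule lorentz_form_nondegenerate[OF lorentz])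
    then have "components A c x (from_components A c x z) = 0"
      using linear_0[OF components_linear[OF c x(1)]] by metis
    then show ?thesis using c x by simp
  qed
  show "smooth_on (snd c ` fst c) (\<lambda>y. gc c y u v)" for u v
  proof (rule smooth_on_local)
    fix y assume "y \<in> snd c ` fst c"
    then obtain x where x: "x \<in> fst c" "y = snd c x" by auto
    define a where "a = chart_at A x"
    have a: "a \<in> A" "x \<in> fst a" "a \<in> maximal_atlas A" using chart_at atlas_subset_maximal by (auto simp: a_def)
    let ?S = "snd c ` (fst c \<inter> fst a)"
    have oS: "open ?S" by (rule overlap_open[OF c a(3)])
    have sm: "smooth_on ?S (\<lambda>y. fderiv (transition c a) y w)" for w
      by (rule smooth_on_fderiv[OF smooth_transition[OF c a(3)]])
    have "smooth_on ?S (\<lambda>y. gc a (transition c a y) (fderiv (transition c a) y u) (fderiv (transition c a) y v))"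
    proof (rule smooth_on_bilinear_field[OF oS chart_open(2)[OF charts[OF a(1)]], where B="gc a"])
      show "bilinear (gc a y)" if "y \<in> snd a ` fst a" for y by (rule metric_bilinear[OF a(3) that])
      show "transition c a ` ?S \<subseteq> snd a ` fst a" by (auto simp: transition_at ch)
    qed (intro smooth_metric[OF a(1)] smooth_transition[OF c a(3)] sm)+
    then have "smooth_on ?S (\<lambda>y. gc c y u v)"
    proof (rule smooth_on_cong[OF oS, THEN iffD1, rotated])
      fix y assume "y \<in> ?S"
      then obtain x where x: "x \<in> fst c" "x \<in> fst a" "y = snd c x" by auto
      then show "gc a (transition c a y) (fderiv (transition c a) y u) (fderiv (transition c a) y v) = gc c y u v"
        using metric_change[OF c a(3) x(1,2), of u v] by (simp add: transition_at ch jacobian_def)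
    qed
    then show "\<exists>T. open T \<and> y \<in> T \<and> smooth_on T (\<lambda>y. gc c y u v)" using oS x a by blast
  qed
qed

lemma christoffel_eq: "c \<in> maximal_atlas A \<Longrightarrow> christoffel A g c = local_metric.\<Gamma> (gc c)"
  by (intro ext) (simp add: christoffel_def metric_deriv_def local_metric.\<Gamma>_def[OF local_metric] local_metric.dG_def[OF local_metric])

lemma christoffel_change:
  assumes c: "c \<in> maximal_atlas A" "c' \<in> maximal_atlas A" and x: "x \<in> fst c" "x \<in> fst c'"
  shows "jacobian c c' x (christoffel A g c (snd c x) u v) =
    christoffel A g c' (snd c' x) (jacobian c c' x u) (jacobian c c' x v)
     + fderiv (\<lambda>y. fderiv (transition c c') y v) (snd c x) u"
proof -
  note ch = c[THEN maximal_is_chart]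
  show ?thesis
    unfolding christoffel_eq[OF c(1)] christoffel_eq[OF c(2)] jacobian_def
      transition_at[OF ch(1) x(1), of c', symmetric]
  proof (rule christoffel_transformation[OF local_metric[OF c(1)] local_metric[OF c(2)] overlap_open[OF c]])
    show "surj (fderiv (transition c c') y)" if y: "y \<in> snd c ` (fst c \<inter> fst c')" for y
    proof -
      obtain z where z: "z \<in> fst c" "z \<in> fst c'" "y = snd c z" using y by auto
      have "jacobian c c' z (jacobian c' c z w) = w" for w by (rule jacobian_inverse[OF c(2,1) z(2,1)])
      then show ?thesis unfolding surj_def z(3) jacobian_def by metis
    qed
    show "gc c y u v = gc c' (transition c c' y) (fderiv (transition c c') y u) (fderiv (transition c c') y v)"
      if y: "y \<in> snd c ` (fst c \<inter> fst c')" for y u v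
    proof -
      obtain z where z: "z \<in> fst c" "z \<in> fst c'" "y = snd c z" using y by auto
      then show ?thesis using metric_change[OF c z(1,2), of u v] by (simp add: transition_at ch jacobian_def)
    qed
  qed (use x in \<open>auto simp: transition_at ch smooth_transition[OF c]\<close>)
qed

text \<open>Parallelism can be verified in a single chart, because the inhomogeneous term in the
  transformation law of the Christoffel symbols cancels the derivative of the Jacobian matrix.\<close>

lemma parallel_along_chartI:
  assumes c: "c \<in> maximal_atlas A" and J: "open J" and Y: "\<And>t. t \<in> J \<Longrightarrow> Y t \<in> snd c ` fst c"
    and sY: "smooth_on J Y" and dY: "\<And>t. t \<in> J \<Longrightarrow> (Y has_vector_derivative Y' t) (at t)"
    and dV: "\<And>t. t \<in> J \<Longrightarrow> (V has_vector_derivative - christoffel A g c (Y t) (Y' t) (V t)) (at t)"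
    and X: "\<And>t. t \<in> J \<Longrightarrow> components A c (chart_inv c (Y t)) (X t) = V t"
  shows "parallel_along A g J (\<lambda>t. chart_inv c (Y t)) X"
    and "\<And>t. t \<in> J \<Longrightarrow> components A c (chart_inv c (Y t)) (velocity A (\<lambda>t. chart_inv c (Y t)) t) = Y' t"
proof -
  note ch = maximal_is_chart[OF c]
  let ?\<gamma> = "\<lambda>t. chart_inv c (Y t)"
  have sm: "smooth_into A J ?\<gamma>" by (rule smooth_into_chart_inv[OF c J sY]) (use Y in auto)
  have \<gamma>: "?\<gamma> t \<in> fst c" "snd c (?\<gamma> t) = Y t" if "t \<in> J" for t using chart_inv_right[OF ch Y[OF that]] by auto
  show vel: "components A c (?\<gamma> t) (velocity A ?\<gamma> t) = Y' t" if t: "t \<in> J" for t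
  proof -
    have "((\<lambda>s. snd c (?\<gamma> s)) has_vector_derivative components A c (?\<gamma> t) (velocity A ?\<gamma> t)) (at t)"
      by (rule velocity_components[OF c J t sm \<gamma>(1)[OF t]])
    then have "(Y has_vector_derivative components A c (?\<gamma> t) (velocity A ?\<gamma> t)) (at t)"
      by (rule has_vector_derivative_transform_within_open[OF _ J t]) (rule \<gamma>(2))
    then show ?thesis using dY[OF t] vector_derivative_unique_at by blast
  qed
  show "parallel_along A g J ?\<gamma> X"
    unfolding parallel_along_def
  proof (intro ballI impI)
    fix a t assume a: "a \<in> A" and t: "t \<in> J" and ta: "?\<gamma> t \<in> fst a"
    note am = atlas_subset_maximal[OF a]
    let ?x = "?\<gamma> t" and ?\<tau> = "transition c a"
    let ?O = "snd c ` (fst c \<inter> fst a)"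
    have YO: "Y s \<in> ?O" if "s \<in> J" "?\<gamma> s \<in> fst a" for s using \<gamma>[OF that(1)] that(2) by (metis IntI imageI)
    have oN: "open {s \<in> J. ?\<gamma> s \<in> fst a}" by (rule smooth_into_coordinates(2)[OF am J sm])
    have "((\<lambda>s. fderiv ?\<tau> (Y s) (V s)) has_derivative
       (\<lambda>h. fderiv (\<lambda>y. fderiv ?\<tau> y (V t)) (Y t) (h *\<^sub>R Y' t) + fderiv ?\<tau> (Y t) (h *\<^sub>R - christoffel A g c (Y t) (Y' t) (V t)))) (at t)"
    proof (rule has_derivative_linear_field[where Y=Y and x=t and D="?O" and L="\<lambda>y. fderiv ?\<tau> y", OF overlap_open[OF c am] YO[OF t ta]])
      show "linear (fderiv ?\<tau> y)" if "y \<in> ?O" for y by (rule smooth_on_linear_fderiv[OF smooth_transition[OF c am] that])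
      show "(\<lambda>y. fderiv ?\<tau> y v) differentiable at (Y t)" for v
        by (rule smooth_on_differentiable[OF smooth_on_fderiv[OF smooth_transition[OF c am]] YO[OF t ta]])
    qed (use dY[OF t] dV[OF t] in \<open>simp_all add: has_vector_derivative_def\<close>)
    then have "((\<lambda>s. fderiv ?\<tau> (Y s) (V s)) has_vector_derivative
       fderiv (\<lambda>y. fderiv ?\<tau> y (V t)) (Y t) (Y' t) - fderiv ?\<tau> (Y t) (christoffel A g c (Y t) (Y' t) (V t))) (at t)"
      using linear_cmul[OF smooth_on_linear_fderiv[OF smooth_on_fderiv[OF smooth_transition[OF c am]] YO[OF t ta]]]
        linear_cmul[OF smooth_on_linear_fderiv[OF smooth_transition[OF c am] YO[OF t ta]]]
        linear_neg[OF smooth_on_linear_fderiv[OF smooth_transition[OF c am] YO[OF t ta]]]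
      by (simp add: has_vector_derivative_def algebra_simps)
    moreover have "fderiv ?\<tau> (Y t) (christoffel A g c (Y t) (Y' t) (V t)) =
        christoffel A g a (snd a ?x) (jacobian c a ?x (Y' t)) (jacobian c a ?x (V t)) + fderiv (\<lambda>y. fderiv ?\<tau> y (V t)) (Y t) (Y' t)"
      using christoffel_change[OF c am \<gamma>(1)[OF t] ta, of "Y' t" "V t"] by (simp add: jacobian_def \<gamma>(2)[OF t])
    moreover have "jacobian c a ?x (Y' t) = components A a ?x (velocity A ?\<gamma> t)" "jacobian c a ?x (V t) = components A a ?x (X t)"
      using components_change[OF c am \<gamma>(1)[OF t] ta] vel[OF t] X[OF t] by simp_all
    ultimately have "((\<lambda>s. fderiv ?\<tau> (Y s) (V s)) has_vector_derivative
       - christoffel A g a (snd a ?x) (components A a ?x (velocity A ?\<gamma> t)) (components A a ?x (X t))) (at t)" by simp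
    then show "((\<lambda>s. components A a (?\<gamma> s) (X s)) has_vector_derivative
       - christoffel A g a (snd a ?x) (components A a ?x (velocity A ?\<gamma> t)) (components A a ?x (X t))) (at t)"
    proof (rule has_vector_derivative_transform_within_open[OF _ oN])
      fix s assume s: "s \<in> {s \<in> J. ?\<gamma> s \<in> fst a}"
      then show "fderiv ?\<tau> (Y s) (V s) = components A a (?\<gamma> s) (X s)"
        using components_change[OF c am \<gamma>(1) , of s "X s"] X[of s] by (simp add: jacobian_def \<gamma>(2))
    qed (use t ta in simp)
  qed
qed

lemma geodesic_chartI:
  assumes c: "c \<in> maximal_atlas A" and J: "open J" "is_interval J" and Y: "\<And>t. t \<in> J \<Longrightarrow> Y t \<in> snd c ` fst c"
    and sY: "smooth_on J Y" and dY: "\<And>t. t \<in> J \<Longrightarrow> (Y has_vector_derivative V t) (at t)"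
    and dV: "\<And>t. t \<in> J \<Longrightarrow> (V has_vector_derivative - christoffel A g c (Y t) (V t) (V t)) (at t)"
  shows "geodesic A g J (\<lambda>t. chart_inv c (Y t))"
    and "\<And>t. t \<in> J \<Longrightarrow> velocity A (\<lambda>t. chart_inv c (Y t)) t = from_components A c (chart_inv c (Y t)) (V t)"
proof -
  note ch = maximal_is_chart[OF c]
  let ?\<gamma> = "\<lambda>t. chart_inv c (Y t)"
  have \<gamma>: "?\<gamma> t \<in> fst c" if "t \<in> J" for t using chart_inv_right[OF ch Y[OF that]] by auto
  have "components A c (?\<gamma> t) (velocity A ?\<gamma> t) = V t" if "t \<in> J" for t
    by (rule parallel_along_chartI(2)[OF c J(1) Y sY dY dV _ that, where X="\<lambda>t. from_components A c (?\<gamma> t) (V t)"])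
      (simp_all add: c \<gamma>)
  note v = this
  show "velocity A ?\<gamma> t = from_components A c (?\<gamma> t) (V t)" if "t \<in> J" for t
    using v[OF that] c \<gamma>[OF that] by (metis components_from_components(2))
  show "geodesic A g J ?\<gamma>"
    unfolding geodesic_def
    by (intro conjI J smooth_into_chart_inv[OF c J(1) sY] parallel_along_chartI(1)[OF c J(1) Y sY dY dV v]) (use Y in auto)
qed

end

section \<open>Geodesics and the exponential map\<close>

lemma ode_unique:
  fixes f :: "'a::euclidean_space \<Rightarrow> 'a"
  assumes D: "open D" "Ck_on (Suc 0) D f" and J: "open J" "is_interval J" "t0 \<in> J"
    and y: "\<And>t. t \<in> J \<Longrightarrow> y t \<in> D \<and> (y has_vector_derivative f (y t)) (at t)"
    and z: "\<And>t. t \<in> J \<Longrightarrow> z t \<in> D \<and> (z has_vector_derivative f (z t)) (at t)"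
    and eq: "y t0 = z t0" and t: "t \<in> J"
  shows "y t = z t"
proof -
  let ?E = "{t \<in> J. y t = z t}"
  have "continuous_on J (\<lambda>t. y t - z t)"
    using y z by (intro continuous_on_diff continuous_at_imp_continuous_on ballI) (auto intro: has_vector_derivative_continuous)
  then have "closedin (top_of_set J) {t \<in> J. y t - z t = 0}" by (rule continuous_closedin_preimage_constant)
  then have cl: "closedin (top_of_set J) ?E" by simp
  have "open ?E"
    unfolding open_subopen[of ?E]
  proof clarify
    fix s assume s: "s \<in> J" "y s = z s"
    have "\<forall>\<^sub>F t in nhds s. y t = z t" by (rule ode_locally_unique[OF D J(1) s(1) y z s(2)])
    moreover have "\<forall>\<^sub>F t in nhds s. t \<in> J" using J(1) s(1) eventually_nhds by blast
    ultimately have "\<forall>\<^sub>F t in nhds s. t \<in> ?E" by eventually_elim simp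
    then show "\<exists>T. open T \<and> s \<in> T \<and> T \<subseteq> ?E" unfolding eventually_nhds by auto
  qed
  then have "openin (top_of_set J) ?E" by (simp add: open_openin_trans J(1))
  with cl have "?E = {} \<or> ?E = J" using is_interval_connected[OF J(2)] connected_clopen by blast
  then show ?thesis using J(3) eq t by blast
qed

context local_metric
begin

text \<open>The vector field on phase space whose integral curves are the geodesics with their
  velocities.\<close>

definition spray :: "'e \<times> 'e \<Rightarrow> 'e \<times> 'e" where "spray p = (snd p, - \<Gamma> (fst p) (snd p) (snd p))"

lemma smooth_\<Gamma>_fields:
  assumes "open S" "smooth_on S y" "y ` S \<subseteq> D" "smooth_on S u" "smooth_on S v"
  shows "smooth_on S (\<lambda>x. \<Gamma> (y x) (u x) (v x))"
  by (rule smooth_on_bilinear_field[where B=\<Gamma>, OF assms(1) open_D \<Gamma>_bilinear \<Gamma>_smooth assms(2-5)])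

lemma smooth_G_fields:
  assumes "open S" "smooth_on S y" "y ` S \<subseteq> D" "smooth_on S u" "smooth_on S v"
  shows "smooth_on S (\<lambda>x. G (y x) (u x) (v x))"
  by (rule smooth_on_bilinear_field[where B=G, OF assms(1) open_D bil smooth assms(2-5)])

lemma open_phase_space: "open (D \<times> (UNIV :: 'e set))" by (intro open_Times open_D open_UNIV)

lemma spray_smooth: "smooth_on (D \<times> UNIV) spray"
  unfolding spray_def
  by (intro smooth_on_Pair smooth_on_minus smooth_\<Gamma>_fields open_phase_space smooth_on_fst smooth_on_snd smooth_on_id) auto

lemma \<Gamma>_scale: "y \<in> D \<Longrightarrow> \<Gamma> y (a *\<^sub>R v) (a *\<^sub>R v) = (a * a) *\<^sub>R \<Gamma> y v v"
  using \<Gamma>_bilinear[of y] by (simp add: bilinear_lmul bilinear_rmul)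

lemma \<Gamma>_zero: "y \<in> D \<Longrightarrow> \<Gamma> y 0 v = 0" "y \<in> D \<Longrightarrow> \<Gamma> y u 0 = 0"
  using \<Gamma>_bilinear[of y] by (simp_all add: bilinear_lzero bilinear_rzero)

text \<open>Reparametrizing an integral curve of the spray by a constant factor again gives an integral
  curve; this turns a flow that exists for a short time into geodesics that exist on \<open>{-2<..<2}\<close>
  for small initial velocities.\<close>

lemma spray_rescale:
  assumes "(c has_vector_derivative spray (c (a * t))) (at (a * t))" "fst (c (a * t)) \<in> D"
  shows "((\<lambda>t. (fst (c (a * t)), a *\<^sub>R snd (c (a * t)))) has_vector_derivative
     spray (fst (c (a * t)), a *\<^sub>R snd (c (a * t)))) (at t)"
proof -
  have "((\<lambda>t. c (a * t)) has_vector_derivative a *\<^sub>R spray (c (a * t))) (at t)"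
    using has_vector_derivative_affine_shift[of c _ a t 0] assms(1) by simp
  then have "((\<lambda>t. fst (c (a * t))) has_vector_derivative a *\<^sub>R snd (c (a * t))) (at t)"
    "((\<lambda>t. snd (c (a * t))) has_vector_derivative a *\<^sub>R - \<Gamma> (fst (c (a * t))) (snd (c (a * t))) (snd (c (a * t)))) (at t)"
    by (auto dest: bounded_linear.has_vector_derivative[OF bounded_linear_fst]
        bounded_linear.has_vector_derivative[OF bounded_linear_snd] simp: spray_def)
  then have "((\<lambda>t. (fst (c (a * t)), a *\<^sub>R snd (c (a * t)))) has_vector_derivative
     (a *\<^sub>R snd (c (a * t)), a *\<^sub>R (a *\<^sub>R - \<Gamma> (fst (c (a * t))) (snd (c (a * t))) (snd (c (a * t)))))) (at t)"
    by (intro has_vector_derivative_Pair bounded_linear.has_vector_derivative[OF bounded_linear_scaleR_right])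
  then show ?thesis by (simp add: spray_def \<Gamma>_scale[OF assms(2)])
qed

lemma geodesic_flow:
  assumes y0: "y0 \<in> D"
  obtains \<epsilon> c where "\<epsilon> > 0" "smooth_on ({-2<..<2} \<times> ball (y0, 0) \<epsilon>) c"
    "\<And>s p. s \<in> {-2<..<2} \<Longrightarrow> p \<in> ball (y0, 0) \<epsilon> \<Longrightarrow> fst (c (s, p)) \<in> D \<and>
      ((\<lambda>s. c (s, p)) has_vector_derivative spray (c (s, p))) (at s)"
    "\<And>p. p \<in> ball (y0, 0) \<epsilon> \<Longrightarrow> c (0, p) = p"
proof -
  obtain \<delta> \<rho> \<phi> where d: "\<delta> > 0" "\<rho> > 0" "\<And>k. Ck_on k ({-\<delta><..<\<delta>} \<times> ball (y0, 0) \<rho>) \<phi>"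
    "\<And>t X. t \<in> {-\<delta><..<\<delta>} \<Longrightarrow> X \<in> ball (y0, 0) \<rho> \<Longrightarrow> \<phi> (t, X) \<in> D \<times> UNIV"
    "\<And>X. X \<in> ball (y0, 0) \<rho> \<Longrightarrow> \<phi> (0, X) = X"
    "\<And>t X. t \<in> {-\<delta><..<\<delta>} \<Longrightarrow> X \<in> ball (y0, 0) \<rho> \<Longrightarrow> ((\<lambda>s. \<phi> (s, X)) has_vector_derivative spray (\<phi> (t, X))) (at t)"
    using smooth_local_flow[OF open_phase_space _ smooth_onD[OF spray_smooth], of "(y0, 0)"] y0 by blast
  \<comment> \<open>Rescaling time by the factor \<open>a\<close> turns the time interval of the flow into \<open>{-2<..<2}\<close>;
    initial velocities are divided by \<open>a\<close> in exchange, which restricts them to a smaller ball.\<close>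
  define a where "a = \<delta> / 2"
  have a: "a > 0" using d(1) by (simp add: a_def)
  define \<epsilon> where "\<epsilon> = \<rho> / (1 + 1 / a)"
  have pos: "1 + 1 / a > 0" using a by (simp add: add_pos_pos)
  have eps: "\<epsilon> > 0" using pos d(2) by (simp add: \<epsilon>_def)
  define \<psi> where "\<psi> p = (fst p, (1/a) *\<^sub>R snd p)" for p :: "'e \<times> 'e"
  have bl: "bounded_linear \<psi>"
    unfolding \<psi>_def by (intro bounded_linear_Pair bounded_linear_fst bounded_linear_scaleR_right[THEN bounded_linear_compose] bounded_linear_snd)
  have \<psi>: "\<psi> p \<in> ball (y0, 0) \<rho>" if p: "p \<in> ball (y0, 0) \<epsilon>" for p
  proof -
    have "norm (\<psi> p - (y0, 0)) \<le> norm (fst p - y0) + norm ((1/a) *\<^sub>R snd p)"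
      using norm_Pair_le[of "fst p - y0" "(1/a) *\<^sub>R snd p"] by (simp add: \<psi>_def)
    also have "\<dots> \<le> norm (p - (y0, 0)) + (1/a) * norm (p - (y0, 0))"
      using norm_fst_le[of "fst p - y0" "snd p"] norm_snd_le[of "snd p" "fst p - y0"] a
      by (cases p) (intro add_mono, auto intro!: mult_left_mono divide_right_mono)
    also have "\<dots> = (1 + 1/a) * norm (p - (y0, 0))" by (simp add: algebra_simps)
    also have "\<dots> < (1 + 1/a) * \<epsilon>"
      using p pos by (intro mult_strict_left_mono) (auto simp: dist_norm norm_minus_commute)
    also have "\<dots> = \<rho>" using pos by (simp add: \<epsilon>_def)
    finally show ?thesis by (simp add: dist_norm norm_minus_commute)
  qed
  define c where "c z = (fst (\<phi> (a * fst z, \<psi> (snd z))), a *\<^sub>R snd (\<phi> (a * fst z, \<psi> (snd z))))" for z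
  have as: "a * s \<in> {-\<delta><..<\<delta>}" if "s \<in> {-2<..<2}" for s
  proof -
    have "\<bar>a * s\<bar> < a * 2" using that a by (auto simp: abs_mult)
    then show ?thesis by (auto simp: a_def)
  qed
  show ?thesis
  proof (rule that[OF eps])
    let ?S = "{-2<..<2::real} \<times> ball (y0, 0::'e) \<epsilon>"
    have oS: "open ?S" "open ({-\<delta><..<\<delta>} \<times> ball (y0, 0::'e) \<rho>)" by (intro open_Times open_ball open_greaterThanLessThan)+
    have "smooth_on ?S (\<lambda>z. \<phi> (a * fst z, \<psi> (snd z)))"
    proof (rule smooth_on_compose[OF oS smooth_onI[OF d(3)]])
      have "smooth_on ?S (\<lambda>z. (a *\<^sub>R fst z, \<psi> (snd z)))"
        by (intro smooth_on_Pair oS smooth_on_scaleR smooth_on_const smooth_on_fst smooth_on_id smooth_on_linear_comp[OF _ bl] smooth_on_snd)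
      then show "smooth_on ?S (\<lambda>z. (a * fst z, \<psi> (snd z)))" by simp
      show "(\<lambda>z. (a * fst z, \<psi> (snd z))) ` ?S \<subseteq> {-\<delta><..<\<delta>} \<times> ball (y0, 0) \<rho>"
      proof (rule image_subsetI)
        fix z :: "real \<times> 'e \<times> 'e" assume "z \<in> ?S"
        then have "fst z \<in> {-2<..<2}" "snd z \<in> ball (y0, 0) \<epsilon>" by (auto simp: mem_Times_iff simp del: mem_ball)
        then show "(a * fst z, \<psi> (snd z)) \<in> {-\<delta><..<\<delta>} \<times> ball (y0, 0) \<rho>" using as \<psi> by blast
      qed
    qed
    then show "smooth_on ?S c"
      unfolding c_def by (intro smooth_on_Pair oS smooth_on_fst smooth_on_snd smooth_on_scaleR smooth_on_const)
    show "c (0, p) = p" if "p \<in> ball (y0, 0) \<epsilon>" for p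
      using d(5)[OF \<psi>[OF that]] a by (simp add: c_def \<psi>_def)
    show "fst (c (s, p)) \<in> D \<and> ((\<lambda>s. c (s, p)) has_vector_derivative spray (c (s, p))) (at s)"
      if "s \<in> {-2<..<2}" "p \<in> ball (y0, 0) \<epsilon>" for s p
      using spray_rescale[of "\<lambda>s. \<phi> (s, \<psi> p)" a s] d(4,6)[OF as[OF that(1)] \<psi>[OF that(2)]]
      by (auto simp: c_def mem_Times_iff)
  qed
qed

lemma geodesic_flow_unique:
  assumes J: "open J" "is_interval J" "0 \<in> J" "t \<in> J" and eq: "c 0 = c' 0"
    and c: "\<And>s. s \<in> J \<Longrightarrow> fst (c s) \<in> D \<and> (c has_vector_derivative spray (c s)) (at s)"
    and c': "\<And>s. s \<in> J \<Longrightarrow> fst (c' s) \<in> D \<and> (c' has_vector_derivative spray (c' s)) (at s)"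
  shows "c t = c' t"
proof (rule ode_unique[where y=c and z=c' and f=spray, OF open_phase_space smooth_onD[OF spray_smooth] J(1,2,3) _ _ eq J(4)])
  show "c s \<in> D \<times> UNIV \<and> (c has_vector_derivative spray (c s)) (at s)"
    "c' s \<in> D \<times> UNIV \<and> (c' has_vector_derivative spray (c' s)) (at s)" if "s \<in> J" for s
    using c[OF that] c'[OF that] by (simp_all add: mem_Times_iff)
qed

text \<open>Two uniqueness arguments determine the differential of \<open>(y, v) \<mapsto> exp\<^sub>y v\<close> at a zero vector:
  geodesics with velocity \<open>0\<close> are constant, and \<open>exp\<^sub>y (r v)\<close> is the geodesic with velocity \<open>v\<close> at time
  \<open>r\<close>.\<close>

lemma local_exponential:
  assumes y0: "y0 \<in> D"
  obtains \<epsilon> c where "\<epsilon> > 0" "smooth_on ({-2<..<2} \<times> ball (y0, 0) \<epsilon>) c"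
    "\<And>s p. s \<in> {-2<..<2} \<Longrightarrow> p \<in> ball (y0, 0) \<epsilon> \<Longrightarrow> fst (c (s, p)) \<in> D \<and>
      ((\<lambda>s. c (s, p)) has_vector_derivative spray (c (s, p))) (at s)"
    "\<And>p. p \<in> ball (y0, 0) \<epsilon> \<Longrightarrow> c (0, p) = p"
    "\<And>y. (y, 0::'e) \<in> ball (y0, 0) \<epsilon> \<Longrightarrow> fst (c (1, (y, 0))) = y"
    "((\<lambda>p. fst (c (1, p))) has_derivative (\<lambda>(a, b). a + b)) (at (y0, 0))"
proof -
  obtain \<epsilon> c where e: "\<epsilon> > 0" and sc: "smooth_on ({-2<..<2} \<times> ball (y0, 0) \<epsilon>) c"
    and ode: "\<And>s p. s \<in> {-2<..<2} \<Longrightarrow> p \<in> ball (y0, 0) \<epsilon> \<Longrightarrow> fst (c (s, p)) \<in> D \<and>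
      ((\<lambda>s. c (s, p)) has_vector_derivative spray (c (s, p))) (at s)"
    and init: "\<And>p. p \<in> ball (y0, 0) \<epsilon> \<Longrightarrow> c (0, p) = p"
    using geodesic_flow[OF y0] by blast
  have still: "c (s, (y, 0)) = (y, 0)" if s: "s \<in> {-2<..<2}" and y: "(y, 0::'e) \<in> ball (y0, 0) \<epsilon>" for s y
  proof (rule geodesic_flow_unique[where J="{-2<..<2}" and c="\<lambda>s. c (s, (y, 0))" and c'="\<lambda>s. (y, 0)"])
    have "y \<in> D" using ode[of 0 "(y, 0)"] init[OF y] y by auto
    then show "fst (y, 0) \<in> D \<and> ((\<lambda>s. (y, 0)) has_vector_derivative spray (y, 0)) (at s)" for s
      by (simp add: spray_def \<Gamma>_zero zero_prod_def[symmetric])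
  qed (use s y ode init in \<open>auto simp: is_interval_1\<close>)
  have scale: "c (1, (y0, r *\<^sub>R v)) = (fst (c (r, (y0, v))), r *\<^sub>R snd (c (r, (y0, v))))"
    if r: "\<bar>r\<bar> < 1" and v: "(y0, v) \<in> ball (y0, 0) \<epsilon>" for r v
  proof -
    have "norm (r *\<^sub>R v) \<le> norm v" using r by (simp add: mult_left_le_one_le)
    then have rv: "(y0, r *\<^sub>R v) \<in> ball (y0, 0) \<epsilon>" using v by (simp add: dist_norm norm_Pair)
    have rs: "r * s \<in> {-2<..<2}" if "s \<in> {-2<..<2}" for s
    proof -
      have "\<bar>r * s\<bar> \<le> \<bar>s\<bar>" using r by (simp add: abs_mult mult_left_le_one_le)
      then show ?thesis using that by auto
    qed
    have "c (1, (y0, r *\<^sub>R v)) = (fst (c (r * 1, (y0, v))), r *\<^sub>R snd (c (r * 1, (y0, v))))"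
      by (rule geodesic_flow_unique[where J="{-2<..<2}" and c="\<lambda>s. c (s, (y0, r *\<^sub>R v))"
            and c'="\<lambda>s. (fst (c (r * s, (y0, v))), r *\<^sub>R snd (c (r * s, (y0, v))))"])
        (use ode[OF _ rv] ode[OF rs v] init[OF rv] init[OF v] spray_rescale[of "\<lambda>s. c (s, (y0, v))" r] in
          \<open>auto simp: is_interval_1\<close>)
    then show ?thesis by simp
  qed
  let ?ex = "\<lambda>p. fst (c (1, p))"
  have oS: "open ({-2<..<2::real} \<times> ball (y0, 0::'e) \<epsilon>)" by (intro open_Times open_ball open_greaterThanLessThan)
  have "smooth_on (ball (y0, 0) \<epsilon>) (\<lambda>p. c (1, p))"
    by (rule smooth_on_compose[OF open_ball oS sc]) (auto intro!: smooth_on_Pair)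
  then have "smooth_on (ball (y0, 0) \<epsilon>) ?ex" by (rule smooth_on_fst[OF open_ball])
  then have D: "(?ex has_derivative fderiv ?ex (y0, 0)) (at (y0, 0))"
    by (rule smooth_on_has_derivative) (use e in simp)
  have lin: "linear (fderiv ?ex (y0, 0))" using D has_derivative_linear by blast
  have 1: "fderiv ?ex (y0, 0) (a, 0) = a" for a
  proof -
    have "((\<lambda>y. (y, 0::'e)) has_derivative (\<lambda>a. (a, 0))) (at y0)" by (auto intro!: derivative_eq_intros)
    from has_derivative_compose[OF this D]
    have "((\<lambda>y. ?ex (y, 0)) has_derivative (\<lambda>a. fderiv ?ex (y0, 0) (a, 0))) (at y0)" .
    moreover have "((\<lambda>y. ?ex (y, 0)) has_derivative (\<lambda>a. a)) (at y0)"
      by (rule has_derivative_transform_within_open[OF has_derivative_ident open_ball[of y0 \<epsilon>]])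
        (use e still in \<open>auto simp: dist_norm norm_Pair\<close>)
    ultimately show ?thesis using has_derivative_unique by metis
  qed
  have 2: "fderiv ?ex (y0, 0) (0, b) = b" for b
  proof -
    \<comment> \<open>By linearity it suffices to treat vectors short enough for the flow.\<close>
    define v where "v = (\<epsilon> / (2 * (norm b + 1))) *\<^sub>R b"
    have "norm v < \<epsilon>"
    proof -
      have p: "0 < 2 * (norm b + 1)" by (simp add: add_nonneg_pos)
      have "norm v = \<epsilon> * (norm b / (2 * (norm b + 1)))" using e by (simp add: v_def)
      also have "\<dots> < \<epsilon> * 1" by (intro mult_strict_left_mono e) (unfold pos_divide_less_eq[OF p], smt (verit) norm_ge_zero)
      finally show ?thesis by simp
    qed
    then have v: "(y0, v) \<in> ball (y0, 0) \<epsilon>" by (simp add: dist_norm norm_Pair)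
    have "((\<lambda>r. ?ex ((y0, 0) + r *\<^sub>R (0, v))) has_vector_derivative fderiv ?ex (y0, 0) (0, v)) (at 0)"
      by (rule has_vector_derivative_along_line) (use D in \<open>simp add: zero_prod_def[symmetric]\<close>)
    moreover have "((\<lambda>r. ?ex ((y0, 0) + r *\<^sub>R (0, v))) has_vector_derivative v) (at 0)"
    proof (rule has_vector_derivative_transform_within_open[of "\<lambda>r. fst (c (r, (y0, v)))" _ _ "{-1<..<1}"])
      have "((\<lambda>r. c (r, (y0, v))) has_vector_derivative spray (y0, v)) (at 0)"
        using ode[of 0 "(y0, v)"] v init[OF v] by simp
      then show "((\<lambda>r. fst (c (r, (y0, v)))) has_vector_derivative v) (at 0)"
        by (auto dest: bounded_linear.has_vector_derivative[OF bounded_linear_fst] simp: spray_def)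
      show "fst (c (r, (y0, v))) = ?ex ((y0, 0) + r *\<^sub>R (0, v))" if "r \<in> {-1<..<1}" for r
        using scale[OF _ v, of r] that by (simp add: abs_less_iff)
    qed auto
    ultimately have "fderiv ?ex (y0, 0) (0, v) = v" by (rule vector_derivative_unique_at)
    moreover have "(0::'e, v) = (\<epsilon> / (2 * (norm b + 1))) *\<^sub>R (0, b)" by (simp add: v_def)
    ultimately have "(\<epsilon> / (2 * (norm b + 1))) *\<^sub>R fderiv ?ex (y0, 0) (0, b) = (\<epsilon> / (2 * (norm b + 1))) *\<^sub>R b"
      using linear_cmul[OF lin] by (metis v_def)
    moreover have "\<epsilon> / (2 * (norm b + 1)) \<noteq> 0" using e by (simp add: add_nonneg_eq_0_iff)
    ultimately show ?thesis using scaleR_left_imp_eq by blast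
  qed
  have "fderiv ?ex (y0, 0) = (\<lambda>(a, b). a + b)"
  proof (rule ext, clarify)
    fix a b
    have "fderiv ?ex (y0, 0) ((a, 0) + (0, b)) = a + b" unfolding linear_add[OF lin] 1 2 ..
    then show "fderiv ?ex (y0, 0) (a, b) = a + b" by simp
  qed
  then have "(?ex has_derivative (\<lambda>(a, b). a + b)) (at (y0, 0))" using D by simp
  then show ?thesis using that[OF e sc] ode init still by auto
qed

end

context lorentzian_manifold
begin

lemma geodesic_in_chart:
  assumes \<gamma>: "geodesic A g J \<gamma>" and c: "c \<in> A" and t: "t \<in> J" "\<gamma> t \<in> fst c"
  shows "((\<lambda>s. (snd c (\<gamma> s), components A c (\<gamma> s) (velocity A \<gamma> s))) has_vector_derivative
    local_metric.spray (gc c) (snd c (\<gamma> t), components A c (\<gamma> t) (velocity A \<gamma> t))) (at t)"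
proof -
  note cm = atlas_subset_maximal[OF c]
  have J: "open J" and s: "smooth_into A J \<gamma>" and p: "parallel_along A g J \<gamma> (velocity A \<gamma>)"
    using \<gamma> by (auto simp: geodesic_def)
  show ?thesis
    unfolding local_metric.spray_def[OF local_metric[OF cm]] fst_conv snd_conv christoffel_eq[OF cm, symmetric]
    by (rule has_vector_derivative_Pair[OF velocity_components[OF cm J t(1) s t(2)]
          p[unfolded parallel_along_def, rule_format, OF c t]])
qed

text \<open>The times at which two geodesics agree to first order form an open and closed set.
  Openness is uniqueness of solutions in a chart. For the complement, either the points differ,
  and the Hausdorff property applies, or the velocities do, and continuity of their components
  in a chart applies.\<close>

lemma geodesic_unique:
  assumes g1: "geodesic A g J1 \<gamma>1" and g2: "geodesic A g J2 \<gamma>2" and t0: "t0 \<in> J1" "t0 \<in> J2"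
    and eq: "\<gamma>1 t0 = \<gamma>2 t0" "velocity A \<gamma>1 t0 = velocity A \<gamma>2 t0" and t: "t \<in> J1" "t \<in> J2"
  shows "\<gamma>1 t = \<gamma>2 t"
proof -
  define J where "J = J1 \<inter> J2"
  define E where "E = {t \<in> J. \<gamma>1 t = \<gamma>2 t \<and> velocity A \<gamma>1 t = velocity A \<gamma>2 t}"
  have J: "open J" "connected J" and s1: "smooth_into A J1 \<gamma>1" and s2: "smooth_into A J2 \<gamma>2" and oJ: "open J1" "open J2"
    using g1 g2 by (auto simp: geodesic_def J_def is_interval_Int is_interval_connected)
  define st where "st c \<gamma> s = (snd c (\<gamma> s), components A c (\<gamma> s) (velocity A \<gamma> s))" for c :: "('m, 'n) chart" and \<gamma> s
  have ode1: "(st c \<gamma>1 has_vector_derivative local_metric.spray (gc c) (st c \<gamma>1 s)) (at s)" if "c \<in> A" "s \<in> J1" "\<gamma>1 s \<in> fst c" for c s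
    using geodesic_in_chart[OF g1 that] by (simp add: st_def[abs_def])
  have ode2: "(st c \<gamma>2 has_vector_derivative local_metric.spray (gc c) (st c \<gamma>2 s)) (at s)" if "c \<in> A" "s \<in> J2" "\<gamma>2 s \<in> fst c" for c s
    using geodesic_in_chart[OF g2 that] by (simp add: st_def[abs_def])
  have stE: "s \<in> E \<longleftrightarrow> st c \<gamma>1 s = st c \<gamma>2 s" if c: "c \<in> A" "\<gamma>1 s \<in> fst c" "\<gamma>2 s \<in> fst c" and "s \<in> J" for c s
  proof
    show "s \<in> E \<Longrightarrow> st c \<gamma>1 s = st c \<gamma>2 s" by (simp add: E_def st_def)
    assume "st c \<gamma>1 s = st c \<gamma>2 s"
    then have "snd c (\<gamma>1 s) = snd c (\<gamma>2 s)" "components A c (\<gamma>1 s) (velocity A \<gamma>1 s) = components A c (\<gamma>2 s) (velocity A \<gamma>2 s)"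
      by (simp_all add: st_def)
    moreover from this(1) have "\<gamma>1 s = \<gamma>2 s" using chart_inv_left[OF charts[OF c(1)]] c by metis
    ultimately show "s \<in> E"
      using components_from_components(2)[OF atlas_subset_maximal[OF c(1)] c(2)] \<open>s \<in> J\<close> unfolding E_def by (metis (mono_tags, lifting) mem_Collect_eq)
  qed
  have near: "\<exists>N. open N \<and> s \<in> N \<and> N \<subseteq> J \<and> (\<forall>r\<in>N. \<gamma>1 r \<in> fst c \<and> \<gamma>2 r \<in> fst c)"
    if "c \<in> A" "s \<in> J" "\<gamma>1 s \<in> fst c" "\<gamma>2 s \<in> fst c" for c s
  proof -
    let ?N = "{r \<in> J1. \<gamma>1 r \<in> fst c} \<inter> {r \<in> J2. \<gamma>2 r \<in> fst c}"
    have "open ?N"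
      using smooth_into_coordinates(2)[OF atlas_subset_maximal[OF that(1)] oJ(1) s1]
        smooth_into_coordinates(2)[OF atlas_subset_maximal[OF that(1)] oJ(2) s2] by (rule open_Int)
    then show ?thesis using that by (intro exI[of _ ?N]) (auto simp: J_def)
  qed
  have "open E"
    unfolding open_subopen[of E]
  proof
    fix s assume s: "s \<in> E"
    define c where "c = chart_at A (\<gamma>1 s)"
    have c: "c \<in> A" "\<gamma>1 s \<in> fst c" "\<gamma>2 s \<in> fst c" "s \<in> J" using s chart_at by (auto simp: c_def E_def)
    interpret M: local_metric "snd c ` fst c" "gc c" by (rule local_metric[OF atlas_subset_maximal[OF c(1)]])
    obtain N where N: "open N" "s \<in> N" "N \<subseteq> J" "\<And>r. r \<in> N \<Longrightarrow> \<gamma>1 r \<in> fst c \<and> \<gamma>2 r \<in> fst c"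
      using near[OF c(1,4,2,3)] by blast
    have "\<forall>\<^sub>F r in nhds s. st c \<gamma>1 r = st c \<gamma>2 r"
    proof (rule ode_locally_unique[OF M.open_phase_space smooth_onD[OF M.spray_smooth] N(1,2)])
      show "st c \<gamma>1 s = st c \<gamma>2 s" using stE[OF c] s by simp
      fix r assume r: "r \<in> N"
      then have "r \<in> J1" "r \<in> J2" using N(3) by (auto simp: J_def)
      then show "st c \<gamma>1 r \<in> snd c ` fst c \<times> UNIV \<and> (st c \<gamma>1 has_vector_derivative M.spray (st c \<gamma>1 r)) (at r)"
        "st c \<gamma>2 r \<in> snd c ` fst c \<times> UNIV \<and> (st c \<gamma>2 has_vector_derivative M.spray (st c \<gamma>2 r)) (at r)"
        using N(4)[OF r] ode1[OF c(1), of r] ode2[OF c(1), of r] by (auto simp: st_def)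
    qed
    moreover have "\<forall>\<^sub>F r in nhds s. r \<in> N" using N(1,2) eventually_nhds by blast
    ultimately have "\<forall>\<^sub>F r in nhds s. r \<in> E" by eventually_elim (use stE[OF c(1)] N in blast)
    then show "\<exists>T. open T \<and> s \<in> T \<and> T \<subseteq> E" unfolding eventually_nhds by blast
  qed
  moreover have "open (J - E)"
    unfolding open_subopen[of "J - E"]
  proof
    fix s assume s: "s \<in> J - E"
    show "\<exists>T. open T \<and> s \<in> T \<and> T \<subseteq> J - E"
    proof (cases "\<gamma>1 s = \<gamma>2 s")
      case False
      then obtain U V where UV: "open U" "open V" "\<gamma>1 s \<in> U" "\<gamma>2 s \<in> V" "U \<inter> V = {}"
        using hausdorff[OF False] by blast
      have o: "open {r \<in> I. \<gamma> r \<in> W}" if "open I" "open W" "smooth_into A I \<gamma>" for I W \<gamma>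
      proof -
        have "open (\<gamma> -` W \<inter> I)" using continuous_on_open_vimage[OF that(1), of \<gamma>] that by (auto simp: smooth_into_def)
        then show ?thesis by (simp add: vimage_def Int_def conj_commute)
      qed
      show ?thesis
        using o[OF oJ(1) UV(1) s1] o[OF oJ(2) UV(2) s2] s UV
        by (intro exI[of _ "{r \<in> J1. \<gamma>1 r \<in> U} \<inter> {r \<in> J2. \<gamma>2 r \<in> V}"]) (auto simp: J_def E_def)
    next
      case True
      define c where "c = chart_at A (\<gamma>1 s)"
      have c: "c \<in> A" "\<gamma>1 s \<in> fst c" "\<gamma>2 s \<in> fst c" "s \<in> J" using s True chart_at[of "\<gamma>1 s"] by (auto simp: c_def)
      obtain N where N: "open N" "s \<in> N" "N \<subseteq> J" "\<And>r. r \<in> N \<Longrightarrow> \<gamma>1 r \<in> fst c \<and> \<gamma>2 r \<in> fst c"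
        using near[OF c(1,4,2,3)] by blast
      have "continuous_on N (\<lambda>r. st c \<gamma>1 r - st c \<gamma>2 r)"
      proof (intro continuous_on_diff continuous_at_imp_continuous_on ballI)
        fix r assume r: "r \<in> N"
        then have "r \<in> J1" "r \<in> J2" using N(3) by (auto simp: J_def)
        then show "isCont (st c \<gamma>1) r" "isCont (st c \<gamma>2) r"
          using N(4)[OF r] ode1[OF c(1), of r] ode2[OF c(1), of r] has_vector_derivative_continuous by blast+
      qed
      then have "open ((\<lambda>r. st c \<gamma>1 r - st c \<gamma>2 r) -` (- {0}) \<inter> N)"
        using continuous_on_open_vimage[OF N(1)] by blast
      moreover have "r \<in> J - E \<longleftrightarrow> st c \<gamma>1 r - st c \<gamma>2 r \<noteq> 0" if "r \<in> N" for r
        using stE[OF c(1), of r] N(3,4) that by auto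
      ultimately show ?thesis
        using s N(2) by (intro exI[of _ "(\<lambda>r. st c \<gamma>1 r - st c \<gamma>2 r) -` (- {0}) \<inter> N"]) blast
    qed
  qed
  moreover have "E \<inter> (J - E) \<inter> J = {}" "J \<subseteq> E \<union> (J - E)" "E \<inter> J \<noteq> {}"
    using t0 eq by (auto simp: E_def J_def)
  ultimately have "(J - E) \<inter> J = {}" using connectedD[OF J(2), of E "J - E"] by blast
  then show ?thesis using t by (auto simp: J_def E_def)
qed

lemma exp_map_eq:
  assumes "exp_rel A g p v q" shows "exp_map A g p v = q" "v \<in> exp_domain A g p"
proof -
  have "q' = q" if q': "exp_rel A g p v q'" for q'
  proof -
    obtain \<gamma> J where 1: "geodesic A g J \<gamma>" "{0..1} \<subseteq> J" "\<gamma> 0 = p" "velocity A \<gamma> 0 = v" "\<gamma> 1 = q"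
      using assms by (auto simp: exp_rel_def)
    obtain \<gamma>' J' where 2: "geodesic A g J' \<gamma>'" "{0..1} \<subseteq> J'" "\<gamma>' 0 = p" "velocity A \<gamma>' 0 = v" "\<gamma>' 1 = q'"
      using q' by (auto simp: exp_rel_def)
    have "\<gamma>' 1 = \<gamma> 1" by (rule geodesic_unique[OF 2(1) 1(1), of 0]) (use 1 2 in \<open>auto simp: subset_iff\<close>)
    then show ?thesis using 1 2 by simp
  qed
  then show "exp_map A g p v = q" unfolding exp_map_def using assms by (intro the_equality)
  show "v \<in> exp_domain A g p" using assms by (auto simp: exp_domain_def)
qed

end

section \<open>Parallel orthonormal frames along normal geodesics\<close>

lemma open_positive_set:
  assumes "open S" "continuous_on S (f :: 'a::topological_space \<Rightarrow> real)" shows "open {x \<in> S. 0 < f x}"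
  using continuous_open_preimage[OF assms(2,1) open_greaterThan[of 0]] by (simp add: vimage_def Int_def)

locale minkowski_at_origin = local_metric D G
  for D :: "'n::finite model set" and G +
  assumes zero_D: "0 \<in> D" and G_zero: "G 0 u v = - (fst u * fst v) + snd u \<bullet> snd v"
begin

text \<open>The field is minus the gradient of the first coordinate, normalized: the gradient is
  orthogonal to the level sets of that coordinate, and it is timelike near the origin.\<close>

lemma unit_normal_field:
  obtains N \<nu> where "open N" "0 \<in> N" "N \<subseteq> D" "smooth_on N \<nu>" "\<nu> 0 = (1, 0)"
    "\<And>y. y \<in> N \<Longrightarrow> G y (\<nu> y) (\<nu> y) = -1" "\<And>y w. y \<in> N \<Longrightarrow> G y (\<nu> y) (0, w) = 0"
proof -
  have "\<exists>z. \<forall>w. G y z w = - fst w" if "y \<in> D" for y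
    by (rule ex_representing_vector[OF that]) (auto intro!: linearI)
  then obtain n where n: "\<And>y w. y \<in> D \<Longrightarrow> G y (n y) w = - fst w" by metis
  have sn: "smooth_on D n"
    by (rule smooth_representing_vector[OF open_D subset_refl _ n]) auto
  have n0: "n 0 = (1, 0)"
    by (rule representing_vector_unique[OF zero_D]) (simp only: n[OF zero_D], simp add: G_zero)
  have sG: "smooth_on D (\<lambda>y. - G y (n y) (n y))"
    by (intro smooth_on_minus smooth_G_fields open_D smooth_on_id sn) auto
  define N where "N = {y \<in> D. 0 < - G y (n y) (n y)}"
  have N: "open N" "N \<subseteq> D" "0 \<in> N"
    using open_positive_set[OF open_D smooth_on_continuous[OF sG]] zero_D
    by (auto simp: N_def G_zero n0)
  \<comment> \<open>The gradient is timelike on \<open>N\<close>, hence the sign under the root.\<close>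
  define l where "l y = inverse (sqrt (- G y (n y) (n y)))" for y
  have sl: "smooth_on N l"
    unfolding l_def by (rule smooth_on_sqrt(2)[OF N(1) smooth_on_subset[OF sG N(2)]]) (simp add: N_def)
  show ?thesis
  proof (rule that[OF N(1,3,2), of "\<lambda>y. l y *\<^sub>R n y"])
    show "smooth_on N (\<lambda>y. l y *\<^sub>R n y)"
      by (intro smooth_on_scaleR N(1) sl smooth_on_subset[OF sn N(2)])
    show "l 0 *\<^sub>R n 0 = (1, 0)" by (simp add: l_def n0 G_zero)
    fix y assume y: "y \<in> N"
    then have yD: "y \<in> D" and p: "0 < - G y (n y) (n y)" by (auto simp: N_def)
    have "G y (l y *\<^sub>R n y) (l y *\<^sub>R n y) = (l y)\<^sup>2 * G y (n y) (n y)"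
      by (simp add: linear_cmul[OF G_linear(1)[OF yD]] linear_cmul[OF G_linear(2)[OF yD]] power2_eq_square)
    also have "(l y)\<^sup>2 = inverse (- G y (n y) (n y))"
      using p by (simp add: l_def power_inverse)
    finally show "G y (l y *\<^sub>R n y) (l y *\<^sub>R n y) = -1" using p by simp
    show "G y (l y *\<^sub>R n y) (0, w) = 0" for w
      by (simp add: linear_cmul[OF G_linear(2)[OF yD]] n[OF yD])
  qed
qed

text \<open>The Gram-Schmidt process, one index at a time. The projection onto \<open>\<nu>\<close> enters with a plus
  sign because \<open>\<nu>\<close> has square \<open>-1\<close>. At the origin the process changes nothing, so the vectors to
  be normalized are spacelike near the origin.\<close>

lemma gram_schmidt_frame:
  assumes N0: "open N0" "0 \<in> N0" "N0 \<subseteq> D" and \<nu>: "smooth_on N0 \<nu>" "\<nu> 0 = (1, 0)" "\<And>y. y \<in> N0 \<Longrightarrow> G y (\<nu> y) (\<nu> y) = -1"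
  shows "\<exists>N e. open N \<and> 0 \<in> N \<and> N \<subseteq> N0 \<and> (\<forall>i\<in>K. smooth_on N (e i) \<and> e i 0 = (0, axis i 1)) \<and>
    (\<forall>y\<in>N. \<forall>i\<in>K. G y (\<nu> y) (e i y) = 0 \<and> (\<forall>j\<in>K. G y (e i y) (e j y) = (if i = j then 1 else 0)))"
  using finite[of K]
proof (induction K rule: finite_induct)
  case empty
  then show ?case using N0 by auto
next
  case (insert i K)
  obtain N e where N: "open N" "0 \<in> N" "N \<subseteq> N0" and e: "\<And>j. j \<in> K \<Longrightarrow> smooth_on N (e j)" "\<And>j. j \<in> K \<Longrightarrow> e j 0 = (0, axis j 1)"
    and on: "\<And>y j. y \<in> N \<Longrightarrow> j \<in> K \<Longrightarrow> G y (\<nu> y) (e j y) = 0"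
      "\<And>y j k. y \<in> N \<Longrightarrow> j \<in> K \<Longrightarrow> k \<in> K \<Longrightarrow> G y (e j y) (e k y) = (if j = k then 1 else 0)"
    using insert.IH by blast
  have ND: "N \<subseteq> D" using N N0 by blast
  have s\<nu>: "smooth_on N \<nu>" by (rule smooth_on_subset[OF \<nu>(1) N(3)])
  define b where "b = (0 :: real, axis i (1::real) :: real ^ 'n)"
  define f where "f y = b + G y b (\<nu> y) *\<^sub>R \<nu> y - (\<Sum>j\<in>K. G y b (e j y) *\<^sub>R e j y)" for y
  have sf: "smooth_on N f"
    unfolding f_def
    by (intro smooth_on_diff smooth_on_add smooth_on_sum smooth_on_scaleR smooth_G_fields N(1) smooth_on_const smooth_on_id s\<nu> e(1))
      (use ND in auto)
  have lin: "G y (f y) w = G y b w + G y b (\<nu> y) * G y (\<nu> y) w - (\<Sum>j\<in>K. G y b (e j y) * G y (e j y) w)" if "y \<in> N" for y w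
  proof -
    have "y \<in> D" using that ND by auto
    note l = G_linear(2)[OF this]
    show ?thesis unfolding f_def by (simp add: linear_add[OF l] linear_diff[OF l] linear_sum[OF l] linear_cmul[OF l])
  qed
  have f\<nu>: "G y (f y) (\<nu> y) = 0" if "y \<in> N" for y
  proof -
    have "G y (e j y) (\<nu> y) = 0" if "j \<in> K" for j using on(1)[OF \<open>y \<in> N\<close> that] sym[of y "e j y" "\<nu> y"] \<open>y \<in> N\<close> ND by auto
    then show ?thesis using lin[OF that, of "\<nu> y"] \<nu>(3)[of y] that N(3) by auto
  qed
  have fe: "G y (f y) (e k y) = 0" if "y \<in> N" "k \<in> K" for y k
  proof -
    have "(\<Sum>j\<in>K. G y b (e j y) * G y (e j y) (e k y)) = (\<Sum>j\<in>K. if j = k then G y b (e j y) else 0)"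
      by (rule sum.cong) (use on(2)[OF that(1) _ that(2)] in auto)
    also have "\<dots> = G y b (e k y)" using that(2) insert.hyps(1) by (simp add: sum.delta)
    finally show ?thesis using lin[OF that(1), of "e k y"] on(1)[OF that] by simp
  qed
  have f0: "f 0 = b"
  proof -
    have "G 0 b (e j 0) = 0" if "j \<in> K" for j
      using that insert.hyps(2) by (auto simp: e(2) G_zero b_def inner_axis_axis)
    then show ?thesis by (simp add: f_def \<nu>(2) G_zero b_def)
  qed
  have sG: "smooth_on N (\<lambda>y. G y (f y) (f y))"
    by (intro smooth_G_fields N(1) smooth_on_id sf) (use ND in auto)
  define N' where "N' = {y \<in> N. 0 < G y (f y) (f y)}"
  have N': "open N'" "N' \<subseteq> N" "0 \<in> N'"
    using open_positive_set[OF N(1) smooth_on_continuous[OF sG]] N(2)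
    by (auto simp: N'_def f0 b_def G_zero inner_axis_axis)
  define l where "l y = inverse (sqrt (G y (f y) (f y)))" for y
  have sl: "smooth_on N' l"
    unfolding l_def by (rule smooth_on_sqrt(2)[OF N'(1) smooth_on_subset[OF sG N'(2)]]) (simp add: N'_def)
  define e' where "e' = e(i := \<lambda>y. l y *\<^sub>R f y)"
  have e'i: "e' i y = l y *\<^sub>R f y" and e'j: "j \<in> K \<Longrightarrow> e' j = e j" for y j
    using insert.hyps(2) by (auto simp: e'_def)
  have 1: "smooth_on N' (e' j) \<and> e' j 0 = (0, axis j 1)" if "j \<in> insert i K" for j
  proof (cases "j = i")
    case True
    have "smooth_on N' (\<lambda>y. l y *\<^sub>R f y)" by (intro smooth_on_scaleR N'(1) sl smooth_on_subset[OF sf N'(2)])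
    moreover have "l 0 = 1" by (simp add: l_def f0 b_def G_zero inner_axis_axis)
    ultimately show ?thesis using True by (simp add: e'_def f0) (simp add: b_def)
  next
    case False
    then show ?thesis using that e N'(2) e'j by (auto intro: smooth_on_subset)
  qed
  have 2: "G y (\<nu> y) (e' j y) = 0 \<and> (\<forall>k\<in>insert i K. G y (e' j y) (e' k y) = (if j = k then 1 else 0))"
    if y: "y \<in> N'" and j: "j \<in> insert i K" for y j
  proof -
    have yN: "y \<in> N" "y \<in> D" and p: "0 < G y (f y) (f y)" using y ND by (auto simp: N'_def)
    note s = linear_cmul[OF G_linear(1)[OF yN(2)]] linear_cmul[OF G_linear(2)[OF yN(2)]]
    have ii: "G y (e' i y) (e' i y) = 1"
    proof -
      have "G y (e' i y) (e' i y) = (l y)\<^sup>2 * G y (f y) (f y)" by (simp add: e'i s power2_eq_square)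
      also have "(l y)\<^sup>2 = inverse (G y (f y) (f y))" using p by (simp add: l_def power_inverse)
      finally show ?thesis using p by simp
    qed
    have ik: "G y (e' i y) (e' k y) = 0" "G y (e' k y) (e' i y) = 0" if "k \<in> K" for k
      using fe[OF yN(1) that] sym[OF yN(2)] that by (simp_all add: e'i e'j s)
    have i\<nu>: "G y (\<nu> y) (e' i y) = 0" using f\<nu>[OF yN(1)] sym[OF yN(2)] by (simp add: e'i s)
    show ?thesis
      using ii ik i\<nu> on(1)[OF yN(1)] on(2)[OF yN(1)] e'j j insert.hyps(2) by (cases "j = i") auto
  qed
  show ?case using N' N(3) 1 2 by (intro exI[of _ N'] exI[of _ e']) blast
qed

text \<open>Geodesics and the parallel transport of a frame along them, as one autonomous system.\<close>

definition frame_field :: "('n model \<times> 'n model) \<times> ('n model ^ 'n) \<Rightarrow> ('n model \<times> 'n model) \<times> ('n model ^ 'n)" where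
  "frame_field p = (spray (fst p), \<chi> i. - \<Gamma> (fst (fst p)) (snd (fst p)) (snd p $ i))"

lemma frame_field_smooth: "smooth_on ((D \<times> UNIV) \<times> UNIV) frame_field"
proof -
  have o: "open ((D \<times> (UNIV :: 'n model set)) \<times> (UNIV :: ('n model ^ 'n) set))"
    by (intro open_Times open_D open_UNIV)
  have 1: "smooth_on ((D \<times> UNIV) \<times> (UNIV :: ('n model ^ 'n) set)) (\<lambda>p. spray (fst p))"
    by (rule smooth_on_compose[OF o open_phase_space spray_smooth]) (auto intro!: smooth_on_fst o)
  have "smooth_on ((D \<times> UNIV) \<times> (UNIV :: ('n model ^ 'n) set)) (\<lambda>p. \<Gamma> (fst (fst p)) (snd (fst p)) (snd p $ i))" for i
    by (intro smooth_\<Gamma>_fields o smooth_on_fst smooth_on_snd smooth_on_vec_nth smooth_on_id) auto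
  then show ?thesis
    unfolding frame_field_def by (intro smooth_on_Pair smooth_on_vec_lambda smooth_on_minus o 1)
qed

end

text \<open>Positions \<open>Y\<close>, velocities \<open>V\<close> and parallel frames \<open>E\<close> of geodesics orthogonal to the slice
  of vanishing first coordinate, as functions of the time and of the starting point in the
  slice.\<close>

locale adapted_frame = minkowski_at_origin D G
  for D :: "'n::finite model set" and G +
  fixes \<delta> :: real and Y V :: "real \<times> (real ^ 'n) \<Rightarrow> 'n model" and E :: "'n \<Rightarrow> real \<times> (real ^ 'n) \<Rightarrow> 'n model"
  assumes \<delta>: "\<delta> > 0"
    and sY: "smooth_on ({-\<delta><..<\<delta>} \<times> ball 0 \<delta>) Y" and sV: "smooth_on ({-\<delta><..<\<delta>} \<times> ball 0 \<delta>) V"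
    and sE: "\<And>i. smooth_on ({-\<delta><..<\<delta>} \<times> ball 0 \<delta>) (E i)"
    and odeY: "\<And>t x. t \<in> {-\<delta><..<\<delta>} \<Longrightarrow> x \<in> ball 0 \<delta> \<Longrightarrow> Y (t, x) \<in> D \<and>
      ((\<lambda>s. Y (s, x)) has_vector_derivative V (t, x)) (at t) \<and>
      ((\<lambda>s. V (s, x)) has_vector_derivative - \<Gamma> (Y (t, x)) (V (t, x)) (V (t, x))) (at t)"
    and odeE: "\<And>t x i. t \<in> {-\<delta><..<\<delta>} \<Longrightarrow> x \<in> ball 0 \<delta> \<Longrightarrow>
      ((\<lambda>s. E i (s, x)) has_vector_derivative - \<Gamma> (Y (t, x)) (V (t, x)) (E i (t, x))) (at t)"
    and Y0: "\<And>x. x \<in> ball 0 \<delta> \<Longrightarrow> Y (0, x) = (0, x)" and V0: "V (0, 0) = (1, 0)" and E0: "\<And>i. E i (0, 0) = (0, axis i 1)"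
    and perp: "\<And>x w. x \<in> ball 0 \<delta> \<Longrightarrow> G (0, x) (V (0, x)) (0, w) = 0"
    and VV: "\<And>t x. t \<in> {-\<delta><..<\<delta>} \<Longrightarrow> x \<in> ball 0 \<delta> \<Longrightarrow> G (Y (t, x)) (V (t, x)) (V (t, x)) = -1"
    and VE: "\<And>t x i. t \<in> {-\<delta><..<\<delta>} \<Longrightarrow> x \<in> ball 0 \<delta> \<Longrightarrow> G (Y (t, x)) (V (t, x)) (E i (t, x)) = 0"
    and EE: "\<And>t x i j. t \<in> {-\<delta><..<\<delta>} \<Longrightarrow> x \<in> ball 0 \<delta> \<Longrightarrow> G (Y (t, x)) (E i (t, x)) (E j (t, x)) = (if i = j then 1 else 0)"

context minkowski_at_origin
begin

text \<open>All the data come from the flow of \<open>frame_field\<close>, started from the orthonormal frames on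
  the slice; parallel transport preserves their inner products.\<close>

lemma ex_adapted_frame: "\<exists>\<delta> Y V E. adapted_frame D G \<delta> Y V E"
proof -
  obtain N0 \<nu> where N0: "open N0" "0 \<in> N0" "N0 \<subseteq> D" and \<nu>: "smooth_on N0 \<nu>" "\<nu> 0 = (1, 0)"
    "\<And>y. y \<in> N0 \<Longrightarrow> G y (\<nu> y) (\<nu> y) = -1" and \<nu>p: "\<And>y w. y \<in> N0 \<Longrightarrow> G y (\<nu> y) (0, w) = 0"
    using unit_normal_field by blast
  obtain N e where N: "open N" "0 \<in> N" "N \<subseteq> N0" and e: "\<And>i. smooth_on N (e i)" "\<And>i. e i 0 = (0, axis i 1)"
    and e\<nu>: "\<And>y i. y \<in> N \<Longrightarrow> G y (\<nu> y) (e i y) = 0"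
    and ee: "\<And>y i j. y \<in> N \<Longrightarrow> G y (e i y) (e j y) = (if i = j then 1 else 0)"
    using gram_schmidt_frame[OF N0 \<nu>, of UNIV] by blast
  define X0 where "X0 = ((0 :: 'n model, (1, 0) :: 'n model), (\<chi> i. (0, axis i 1)) :: 'n model ^ 'n)"
  have o: "open ((D \<times> (UNIV :: 'n model set)) \<times> (UNIV :: ('n model ^ 'n) set))"
    by (intro open_Times open_D open_UNIV)
  have X0: "X0 \<in> (D \<times> UNIV) \<times> UNIV" using zero_D by (simp add: X0_def)
  obtain \<delta>1 \<rho> \<phi> where d: "\<delta>1 > 0" "\<rho> > 0" "\<And>k. Ck_on k ({-\<delta>1<..<\<delta>1} \<times> ball X0 \<rho>) \<phi>"
    and \<phi>D: "\<And>t X. t \<in> {-\<delta>1<..<\<delta>1} \<Longrightarrow> X \<in> ball X0 \<rho> \<Longrightarrow> \<phi> (t, X) \<in> (D \<times> UNIV) \<times> UNIV"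
    and \<phi>0: "\<And>X. X \<in> ball X0 \<rho> \<Longrightarrow> \<phi> (0, X) = X"
    and \<phi>': "\<And>t X. t \<in> {-\<delta>1<..<\<delta>1} \<Longrightarrow> X \<in> ball X0 \<rho> \<Longrightarrow> ((\<lambda>s. \<phi> (s, X)) has_vector_derivative frame_field (\<phi> (t, X))) (at t)"
    using smooth_local_flow[OF o X0 smooth_onD[OF frame_field_smooth]] by blast
  define N1 where "N1 = (\<lambda>x::real^'n. (0::real, x)) -` N"
  have N1: "open N1" "0 \<in> N1"
    using N(2) by (auto simp: N1_def zero_prod_def intro!: open_vimage N(1) continuous_intros)
  define Z where "Z x = (((0::real, x), \<nu> (0, x)), \<chi> i. e i (0, x))" for x :: "real ^ 'n"
  have sP: "smooth_on N1 (\<lambda>x::real^'n. (0::real, x))" by (intro smooth_on_Pair N1 smooth_on_const smooth_on_id)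
  have sub: "(\<lambda>x::real^'n. (0::real, x)) ` N1 \<subseteq> N" by (auto simp: N1_def)
  have sZ: "smooth_on N1 Z"
    unfolding Z_def
    by (intro smooth_on_Pair smooth_on_vec_lambda N1 sP smooth_on_compose[OF N1(1) N(1) e(1) sP sub]
        smooth_on_compose[OF N1(1) N(1) smooth_on_subset[OF \<nu>(1) N(3)] sP sub])
  have Z0: "Z 0 = X0" using \<nu>(2) e(2) by (simp add: Z_def X0_def zero_prod_def[symmetric])
  have "open (Z -` ball X0 \<rho> \<inter> N1)"
    using continuous_on_open_vimage[OF N1(1), THEN iffD1, OF smooth_on_continuous[OF sZ]] open_ball by blast
  moreover have "0 \<in> Z -` ball X0 \<rho> \<inter> N1" using N1 d Z0 by simp
  ultimately obtain r where r: "r > 0" "ball 0 r \<subseteq> Z -` ball X0 \<rho> \<inter> N1" by (meson openE)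
  define \<delta> where "\<delta> = min r \<delta>1"
  have \<delta>: "\<delta> > 0" "\<delta> \<le> \<delta>1" using r d by (auto simp: \<delta>_def)
  have Zin: "Z x \<in> ball X0 \<rho>" "(0, x) \<in> N" if "x \<in> ball 0 \<delta>" for x
  proof -
    have "x \<in> ball 0 r" using that by (simp add: \<delta>_def)
    then have "x \<in> Z -` ball X0 \<rho> \<inter> N1" using r(2) by blast
    then show "Z x \<in> ball X0 \<rho>" "(0, x) \<in> N" by (auto simp: N1_def)
  qed
  have tin: "t \<in> {-\<delta>1<..<\<delta>1}" if "t \<in> {-\<delta><..<\<delta>}" for t using that \<delta> by auto
  define c where "c z = \<phi> (fst z, Z (snd z))" for z
  define Y where "Y z = fst (fst (c z))" for z
  define V where "V z = snd (fst (c z))" for z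
  define E where "E i z = snd (c z) $ i" for i z
  let ?\<Omega> = "{-\<delta><..<\<delta>} \<times> ball (0 :: real^'n) \<delta>"
  have o\<Omega>: "open ?\<Omega>" by (intro open_Times open_ball open_greaterThanLessThan)
  have sc: "smooth_on ?\<Omega> c"
    unfolding c_def
  proof (rule smooth_on_compose[OF o\<Omega> _ smooth_onI[OF d(3)]])
    have "smooth_on ?\<Omega> (\<lambda>z. Z (snd z))"
      by (rule smooth_on_compose[OF o\<Omega> N1(1) sZ]) (use Zin in \<open>auto simp: N1_def intro!: smooth_on_snd o\<Omega>\<close>)
    then show "smooth_on ?\<Omega> (\<lambda>z. (fst z, Z (snd z)))" by (intro smooth_on_Pair smooth_on_fst o\<Omega> smooth_on_id)
    show "(\<lambda>z. (fst z, Z (snd z))) ` ?\<Omega> \<subseteq> {-\<delta>1<..<\<delta>1} \<times> ball X0 \<rho>"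
    proof (rule image_subsetI)
      fix z assume "z \<in> ?\<Omega>"
      then have "fst z \<in> {-\<delta><..<\<delta>}" "snd z \<in> ball 0 \<delta>" by (simp_all only: mem_Times_iff)
      then show "(fst z, Z (snd z)) \<in> {-\<delta>1<..<\<delta>1} \<times> ball X0 \<rho>" using tin Zin(1) by blast
    qed
    show "open ({-\<delta>1<..<\<delta>1} \<times> ball X0 \<rho>)" by (intro open_Times open_ball open_greaterThanLessThan)
  qed
  have YD: "Y (t, x) \<in> D" if "t \<in> {-\<delta><..<\<delta>}" "x \<in> ball 0 \<delta>" for t x
    using \<phi>D[OF tin[OF that(1)] Zin(1)[OF that(2)]] by (simp add: Y_def c_def mem_Times_iff)
  have ode: "((\<lambda>s. Y (s, x)) has_vector_derivative V (t, x)) (at t)"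
      "((\<lambda>s. V (s, x)) has_vector_derivative - \<Gamma> (Y (t, x)) (V (t, x)) (V (t, x))) (at t)"
      "((\<lambda>s. E i (s, x)) has_vector_derivative - \<Gamma> (Y (t, x)) (V (t, x)) (E i (t, x))) (at t)"
    if "t \<in> {-\<delta><..<\<delta>}" "x \<in> ball 0 \<delta>" for t x i
  proof -
    have c': "((\<lambda>s. c (s, x)) has_vector_derivative frame_field (c (t, x))) (at t)"
      using \<phi>'[OF tin[OF that(1)] Zin(1)[OF that(2)]] by (simp add: c_def)
    note F = bounded_linear.has_vector_derivative[OF bounded_linear_fst]
      and S = bounded_linear.has_vector_derivative[OF bounded_linear_snd]
      and I = bounded_linear.has_vector_derivative[OF bounded_linear_vec_nth]
    show "((\<lambda>s. Y (s, x)) has_vector_derivative V (t, x)) (at t)"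
      using F[OF F[OF c']] by (simp add: Y_def V_def frame_field_def spray_def)
    show "((\<lambda>s. V (s, x)) has_vector_derivative - \<Gamma> (Y (t, x)) (V (t, x)) (V (t, x))) (at t)"
      using S[OF F[OF c']] by (simp add: Y_def V_def frame_field_def spray_def)
    show "((\<lambda>s. E i (s, x)) has_vector_derivative - \<Gamma> (Y (t, x)) (V (t, x)) (E i (t, x))) (at t)"
      using I[OF S[OF c'], of i] by (simp add: Y_def V_def E_def frame_field_def)
  qed
  have c0: "Y (0, x) = (0, x)" "V (0, x) = \<nu> (0, x)" "E i (0, x) = e i (0, x)" if "x \<in> ball 0 \<delta>" for x i
    using \<phi>0[OF Zin(1)[OF that]] by (simp_all add: Y_def V_def E_def c_def Z_def)
  have z\<delta>: "0 \<in> {-\<delta><..<\<delta>}" "0 \<in> ball (0 :: real^'n) \<delta>" using \<delta> by auto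
  have cons: "G (Y (t, x)) (U (t, x)) (W (t, x)) = G (0, x) (U (0, x)) (W (0, x))"
    if "t \<in> {-\<delta><..<\<delta>}" and x: "x \<in> ball 0 \<delta>" and "U = V \<or> U = E i" "W = V \<or> W = E j" for t x U W i j
    using parallel_preserves_metric[where Y="\<lambda>s. Y (s, x)" and Y'="\<lambda>s. V (s, x)" and V="\<lambda>s. U (s, x)" and W="\<lambda>s. W (s, x)"
        and J="{-\<delta><..<\<delta>}" and ?t0.0=0 and t=t] that ode YD c0(1)[OF x] z\<delta>(1)
    by (auto simp: is_interval_1)
  have "adapted_frame D G \<delta> Y V E"
  proof unfold_locales
    show "\<delta> > 0" by (rule \<delta>(1))
    show "smooth_on ?\<Omega> Y" "smooth_on ?\<Omega> V" "smooth_on ?\<Omega> (E i)" for i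
      unfolding Y_def V_def E_def by (intro smooth_on_fst smooth_on_snd smooth_on_vec_nth o\<Omega> sc)+
    show "V (0, 0) = (1, 0)" "E i (0, 0) = (0, axis i 1)" for i
      using c0(2,3)[OF z\<delta>(2)] \<nu>(2) e(2) by (simp_all add: zero_prod_def)
    fix x :: "real ^ 'n" assume x: "x \<in> ball 0 \<delta>"
    have xN: "(0, x) \<in> N" "(0, x) \<in> N0" using Zin(2)[OF x] N by auto
    show "G (0, x) (V (0, x)) (0, w) = 0" for w using \<nu>p[OF xN(2)] by (simp add: c0[OF x])
    fix t assume t: "t \<in> {-\<delta><..<\<delta>}"
    show "G (Y (t, x)) (V (t, x)) (V (t, x)) = -1" using cons[where U=V and W=V, OF t x] \<nu>(3)[OF xN(2)] by (simp add: c0[OF x])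
    show "G (Y (t, x)) (V (t, x)) (E i (t, x)) = 0" for i
      using cons[where U=V and W="E i" and j=i, OF t x] e\<nu>[OF xN(1)] by (simp add: c0[OF x])
    show "G (Y (t, x)) (E i (t, x)) (E j (t, x)) = (if i = j then 1 else 0)" for i j
      using cons[where U="E i" and W="E j" and i=i and j=j, OF t x] ee[OF xN(1)] by (simp add: c0[OF x])
    show "Y (t, x) \<in> D \<and> ((\<lambda>s. Y (s, x)) has_vector_derivative V (t, x)) (at t) \<and>
      ((\<lambda>s. V (s, x)) has_vector_derivative - \<Gamma> (Y (t, x)) (V (t, x)) (V (t, x))) (at t)"
      using YD[OF t x] ode[OF t x] by blast
    show "((\<lambda>s. E i (s, x)) has_vector_derivative - \<Gamma> (Y (t, x)) (V (t, x)) (E i (t, x))) (at t)" for i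
      by (rule ode(3)[OF t x])
  qed (rule c0(1))
  then show ?thesis by blast
qed

end

section \<open>Lipschitz perturbations of a shear\<close>

lemma inj_derivative_if_expanding:
  fixes f :: "'a::euclidean_space \<Rightarrow> 'b::euclidean_space"
  assumes f: "(f has_derivative f') (at x)" and S: "open S" "x \<in> S"
    and e: "\<And>y. y \<in> S \<Longrightarrow> norm (y - x) \<le> C * norm (f y - f x)"
  shows "inj f'"
proof -
  have lin: "linear f'" using f has_derivative_linear by blast
  have "v = 0" if v: "f' v = 0" for v
  proof -
    define e where "e = 1 / (2 * (\<bar>C\<bar> + 1))"
    have e: "e > 0" "C * e \<le> 1/2" by (auto simp: e_def divide_simps)
    obtain d where d: "d > 0" "\<And>y. norm (y - x) < d \<Longrightarrow> norm (f y - f x - f' (y - x)) \<le> e * norm (y - x)"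
      using f e unfolding has_derivative_at_alt by blast
    obtain r where r: "r > 0" "ball x r \<subseteq> S" using S openE by blast
    define s where "s = min d r / (2 * (norm v + 1))"
    have p: "0 < 2 * (norm v + 1)" by (simp add: add_nonneg_pos)
    have s: "s > 0" using d r p by (simp add: s_def)
    have "norm (s *\<^sub>R v) = min d r * (norm v / (2 * (norm v + 1)))" using d r by (simp add: s_def)
    also have "\<dots> < min d r * 1"
      using d r by (intro mult_strict_left_mono) (unfold pos_divide_less_eq[OF p], smt (verit) norm_ge_zero, simp)
    finally have sv: "norm (s *\<^sub>R v) < min d r" by simp
    then have "x + s *\<^sub>R v \<in> S" using r(2) by (auto simp: dist_norm subset_iff)
    from e(1) have n: "0 \<le> norm (s *\<^sub>R v)" by simp
    have "norm (f (x + s *\<^sub>R v) - f x) \<le> e * norm (s *\<^sub>R v)"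
      using d(2)[of "x + s *\<^sub>R v"] sv linear_cmul[OF lin] v by simp
    then have "\<bar>C\<bar> * norm (f (x + s *\<^sub>R v) - f x) \<le> \<bar>C\<bar> * (e * norm (s *\<^sub>R v))" by (rule mult_left_mono) simp
    moreover have "norm (s *\<^sub>R v) \<le> C * norm (f (x + s *\<^sub>R v) - f x)"
      using assms(4)[OF \<open>x + s *\<^sub>R v \<in> S\<close>] by simp
    moreover have "C * norm (f (x + s *\<^sub>R v) - f x) \<le> \<bar>C\<bar> * norm (f (x + s *\<^sub>R v) - f x)" by (rule mult_right_mono) auto
    moreover have "\<bar>C\<bar> * (e * norm (s *\<^sub>R v)) \<le> (1/2) * norm (s *\<^sub>R v)"
    proof -
      have "\<bar>C\<bar> * e \<le> 1/2" by (simp add: e_def divide_simps)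
      from mult_right_mono[OF this n] show ?thesis by (simp add: mult.assoc)
    qed
    ultimately have "norm (s *\<^sub>R v) \<le> 0" by linarith
    then have "s *\<^sub>R v = 0" by (simp only: norm_le_zero_iff)
    then show "v = 0" using s by simp
  qed
  then show ?thesis unfolding linear_injective_0[OF lin] by blast
qed

text \<open>The map \<open>K\<close> is almost the sum of its arguments. The factor \<open>1/8\<close> is \<open>1/2\<close> divided by the
  Lipschitz constant \<open>4\<close> in \<open>lift_le_shear\<close>. The radii \<open>\<eta>/16\<close> below keep all arguments of \<open>K\<close>
  that occur inside the ball of radius \<open>\<eta>\<close>.\<close>

locale near_additive =
  fixes K :: "'n::finite model \<times> 'n model \<Rightarrow> 'n model" and \<eta> :: real
  assumes \<eta>: "0 < \<eta>" and smooth_K: "smooth_on (ball 0 \<eta>) K"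
    and near: "\<And>p q. p \<in> ball 0 \<eta> \<Longrightarrow> q \<in> ball 0 \<eta> \<Longrightarrow>
      norm (K p - K q - ((fst p + snd p) - (fst q + snd q))) \<le> (1/8) * norm (p - q)"
begin

text \<open>With the second argument \<open>0\<close> the map \<open>K\<close> is itself a Lipschitz perturbation of the
  identity. For the map \<open>K\<close> of the Temple construction this means that the geodesics pass
  through every point near the origin.\<close>

lemma covers_by_base_points: "ball (K 0) (\<eta> / 32) \<subseteq> (\<lambda>a. K (a, 0)) ` ball 0 (\<eta> / 16)"
proof -
  have "ball (K (0, 0)) (\<eta> / 16 / 2) \<subseteq> (\<lambda>a. K (a, 0)) ` ball 0 (\<eta> / 16)"
  proof (rule near_identity_image)
    fix a b :: "'n model" assume "a \<in> ball 0 (\<eta> / 16)" "b \<in> ball 0 (\<eta> / 16)"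
    then have "(a, 0::'n model) \<in> ball 0 \<eta>" "(b, 0::'n model) \<in> ball 0 \<eta>" using \<eta> by (auto simp: norm_Pair)
    from near[OF this] have "norm (K (a, 0) - K (b, 0) - (a - b)) \<le> (1/8) * norm (a - b)"
      by (simp add: norm_Pair)
    then show "norm (K (a, 0) - K (b, 0) - (a - b)) \<le> (1/2) * norm (a - b)"
      using norm_ge_zero[of "a - b"] by linarith
  qed
  then show ?thesis by (simp add: zero_prod_def)
qed

text \<open>With this substitution \<open>K\<close> becomes the Temple map along the geodesic that starts at
  \<open>snd a\<close>, with time measured from \<open>fst a\<close>.\<close>

definition lift :: "real \<times> (real ^ 'n) \<Rightarrow> 'n model \<Rightarrow> 'n model \<times> 'n model" where
  "lift a z = ((fst z + fst a, snd a), (norm (snd z), snd z))"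

abbreviation C :: "'n model set" where "C \<equiv> cylinder (\<eta> / 16) (\<eta> / 16)"
abbreviation axis_C :: "'n model set" where "axis_C \<equiv> {-(\<eta> / 16)<..<\<eta> / 16} \<times> {0}"

lemma lift_in_ball:
  assumes a: "\<bar>fst a\<bar> < \<eta> / 16" "norm (snd a) < \<eta> / 16" and z: "z \<in> C"
  shows "lift a z \<in> ball 0 \<eta>"
proof -
  have z': "\<bar>fst z\<bar> < \<eta> / 16" "norm (snd z) < \<eta> / 16" using z by (auto simp: cylinder_def)
  have "norm (lift a z) \<le> norm (fst z + fst a, snd a) + norm (norm (snd z), snd z)"
    unfolding lift_def by (rule norm_Pair_le)
  also have "\<dots> \<le> (\<bar>fst z + fst a\<bar> + norm (snd a)) + (norm (snd z) + norm (snd z))"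
    using norm_Pair_le[of "fst z + fst a" "snd a"] norm_Pair_le[of "norm (snd z)" "snd z"] by simp
  also have "\<dots> < \<eta>" using a z' \<eta> by linarith
  finally show ?thesis by simp
qed

definition shear :: "'n model \<Rightarrow> 'n model" where "shear z = (fst z + norm (snd z), snd z)"

lemma shear_expanding: "norm (p - q) \<le> 3 * norm (shear p - shear q)"
  and lift_le_shear: "norm (lift a p - lift a q) \<le> 4 * norm (shear p - shear q)"
proof -
  let ?N = "norm (shear p - shear q)"
  have s: "norm (snd p - snd q) \<le> ?N" "\<bar>(fst p + norm (snd p)) - (fst q + norm (snd q))\<bar> \<le> ?N"
    using norm_snd_le[of "snd p - snd q" "(fst p + norm (snd p)) - (fst q + norm (snd q))"]
      norm_fst_le[of "(fst p + norm (snd p)) - (fst q + norm (snd q))" "snd p - snd q"]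
    by (simp_all add: shear_def)
  have n: "\<bar>norm (snd p) - norm (snd q)\<bar> \<le> ?N" using norm_triangle_ineq3[of "snd p" "snd q"] s(1) by linarith
  have t: "\<bar>fst p - fst q\<bar> \<le> 2 * ?N" using s(2) n by linarith
  have "norm (p - q) \<le> \<bar>fst p - fst q\<bar> + norm (snd p - snd q)"
    using norm_Pair_le[of "fst (p - q)" "snd (p - q)"] unfolding prod.collapse by simp
  then show "norm (p - q) \<le> 3 * ?N" using t s by linarith
  have "norm (lift a p - lift a q) \<le> norm (fst p - fst q, 0 :: real^'n) + norm (norm (snd p) - norm (snd q), snd p - snd q)"
    using norm_Pair_le[of "(fst p - fst q, 0 :: real^'n)" "(norm (snd p) - norm (snd q), snd p - snd q)"]
    by (simp add: lift_def)
  also have "\<dots> \<le> \<bar>fst p - fst q\<bar> + (\<bar>norm (snd p) - norm (snd q)\<bar> + norm (snd p - snd q))"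
    using norm_Pair_le[of "norm (snd p) - norm (snd q)" "snd p - snd q"] by (simp add: norm_Pair)
  finally show "norm (lift a p - lift a q) \<le> 4 * ?N" using t s n by linarith
qed

context
  fixes a :: "real \<times> (real ^ 'n)"
  assumes a: "\<bar>fst a\<bar> < \<eta> / 16" "norm (snd a) < \<eta> / 16"
begin

abbreviation P :: "'n model \<Rightarrow> 'n model" where "P z \<equiv> K (lift a z)"

text \<open>The difference of two arguments of \<open>K\<close> is controlled by the difference of their images
  under the shear, in spite of the term \<open>|z|\<close>, since the inverse of the shear is Lipschitz as
  well.\<close>

lemma P_near_shear:
  assumes "p \<in> C" "q \<in> C"
  shows "norm (P p - P q - (shear p - shear q)) \<le> (1/2) * norm (shear p - shear q)"
proof -
  have "(fst (lift a p) + snd (lift a p)) - (fst (lift a q) + snd (lift a q)) = shear p - shear q"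
    by (simp add: lift_def shear_def)
  then show ?thesis
    using near[OF lift_in_ball[OF a assms(1)] lift_in_ball[OF a assms(2)]] lift_le_shear[of a p q] by simp
qed

lemma P_expanding:
  assumes "p \<in> C" "q \<in> C"
  shows "norm (p - q) \<le> 6 * norm (P p - P q)"
proof -
  have "norm (P p - P q) \<ge> (1/2) * norm (shear p - shear q)"
    using P_near_shear[OF assms] norm_triangle_sub[of "shear p - shear q" "P p - P q"]
      norm_minus_commute[of "P p - P q" "shear p - shear q"] by simp
  then show ?thesis using shear_expanding[of p q] by simp
qed

text \<open>The image of a ball under the inverse shear \<open>u\<close> lies in the cylinder, and \<open>P\<close> after \<open>u\<close> is
  a Lipschitz perturbation of the identity.\<close>

lemma P_covers: "ball (P 0) (\<eta> / 64) \<subseteq> P ` C"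
proof -
  define u where "u b = (fst b - norm (snd b), snd b)" for b :: "'n model"
  have uC: "u b \<in> C" if "b \<in> ball 0 (\<eta> / 32)" for b
  proof -
    have "\<bar>fst b\<bar> < \<eta> / 32" "norm (snd b) < \<eta> / 32"
      using that norm_fst_le[of "fst b" "snd b"] norm_snd_le[of "snd b" "fst b"] by auto
    then have "- (\<eta> / 16) < fst b - norm (snd b)" "fst b - norm (snd b) < \<eta> / 16" "norm (snd b) < \<eta> / 16"
      using norm_ge_zero[of "snd b"] by linarith+
    then show ?thesis by (simp add: u_def cylinder_def)
  qed
  have su: "shear (u b) = b" for b by (simp add: shear_def u_def)
  have "ball (P (u 0)) (\<eta> / 32 / 2) \<subseteq> (\<lambda>b. P (u b)) ` ball 0 (\<eta> / 32)"
    by (rule near_identity_image) (use P_near_shear[OF uC uC] su in auto)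
  then show ?thesis using uC by (auto simp: u_def zero_prod_def)
qed

lemma open_C: "open C" "open (C - axis_C)"
proof -
  show "open C" by (simp add: cylinder_def open_Times)
  moreover have "C - axis_C = C - UNIV \<times> {0}" by (auto simp: cylinder_def)
  ultimately show "open (C - axis_C)" by (simp add: open_Diff closed_Times)
qed

lemma P_inj: "inj_on P C"
proof (rule inj_onI)
  fix p q assume "p \<in> C" "q \<in> C" "P p = P q"
  then have "norm (p - q) \<le> 0" using P_expanding[of p q] by simp
  then show "p = q" by simp
qed

lemma P_continuous: "continuous_on C P"
proof (rule continuous_on_compose2[OF smooth_on_continuous[OF smooth_K]])
  show "continuous_on C (lift a)" unfolding lift_def by (intro continuous_intros)
qed (use lift_in_ball[OF a] in blast)

lemma P_homeomorphism: "homeomorphism C (P ` C) P (inv_into C P)"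
proof (rule homeomorphismI[OF P_continuous])
  show "continuous_on (P ` C) (inv_into C P)"
    unfolding continuous_on_iff
  proof (intro ballI allI impI)
    fix y and e :: real assume y: "y \<in> P ` C" and e: "0 < e"
    show "\<exists>d>0. \<forall>y'\<in>P ` C. dist y' y < d \<longrightarrow> dist (inv_into C P y') (inv_into C P y) < e"
    proof (intro exI[of _ "e / 6"] conjI ballI impI)
      fix y' assume y': "y' \<in> P ` C" "dist y' y < e / 6"
      have "norm (inv_into C P y' - inv_into C P y) \<le> 6 * norm (y' - y)"
        using P_expanding[OF inv_into_into[OF y'(1)] inv_into_into[OF y]] f_inv_into_f[OF y'(1)] f_inv_into_f[OF y] by simp
      then show "dist (inv_into C P y') (inv_into C P y) < e" using y'(2) by (simp add: dist_norm)
    qed (use e in simp)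
  qed
next
  show "inv_into C P ` P ` C \<subseteq> C" by (rule image_subsetI) (rule inv_into_into)
  show "inv_into C P (P x) = x" if "x \<in> C" for x by (rule inv_into_f_f[OF P_inj that])
  show "P (inv_into C P y) = y" if "y \<in> P ` C" for y by (rule f_inv_into_f[OF that])
qed simp

lemma P_smooth: "smooth_on (C - axis_C) P"
proof (rule smooth_on_compose[OF open_C(2) open_ball smooth_K])
  have "smooth_on (C - axis_C) (\<lambda>z. snd z \<bullet> snd z)"
    by (intro smooth_on_inner smooth_on_snd smooth_on_id open_C)
  moreover have "0 < snd z \<bullet> snd z" if "z \<in> C - axis_C" for z using that by (auto simp: cylinder_def)
  ultimately have "smooth_on (C - axis_C) (\<lambda>z. norm (snd z))"
    unfolding norm_eq_sqrt_inner by (rule smooth_on_sqrt(1)[OF open_C(2)])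
  then show "smooth_on (C - axis_C) (lift a)"
    unfolding lift_def by (intro smooth_on_Pair smooth_on_add smooth_on_fst smooth_on_snd smooth_on_id smooth_on_const open_C)
qed (use lift_in_ball[OF a] in blast)

lemma P_open: "open (P ` (C - axis_C))"
  by (rule invariance_of_domain[OF smooth_on_continuous[OF P_smooth] open_C(2)]) (rule inj_on_subset[OF P_inj], blast)

lemma P_inverse_smooth: "smooth_on (P ` (C - axis_C)) (inv_into (C - axis_C) P)"
proof (rule smooth_onI, rule Ck_on_inverse_function[OF open_C(2) P_open smooth_onD[OF P_smooth]])
  have inj: "inj_on P (C - axis_C)" by (rule inj_on_subset[OF P_inj]) blast
  show "inj (fderiv P z)" if z: "z \<in> C - axis_C" for z
    by (rule inj_derivative_if_expanding[OF smooth_on_has_derivative[OF P_smooth z] open_C(2) z, of 6])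
      (use z P_expanding in blast)
  have "inv_into (C - axis_C) P y = inv_into C P y" if "y \<in> P ` (C - axis_C)" for y
    using that inv_into_f_f[OF inj] inv_into_f_f[OF P_inj] by fastforce
  then show "continuous_on (P ` (C - axis_C)) (inv_into (C - axis_C) P)"
    using continuous_on_subset[OF homeomorphism_cont2[OF P_homeomorphism], of "P ` (C - axis_C)"]
    by (metis (no_types, lifting) Diff_subset continuous_on_cong image_mono)
  show "inv_into (C - axis_C) P ` P ` (C - axis_C) \<subseteq> C - axis_C" by (rule image_subsetI) (rule inv_into_into)
  show "P (inv_into (C - axis_C) P y) = y" if "y \<in> P ` (C - axis_C)" for y by (rule f_inv_into_f[OF that])
qed

end

end

section \<open>The Temple map in coordinates\<close>

text \<open>In addition to the frames, \<open>c\<close> is the geodesic flow near the zero vector at the origin, so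
  that \<open>fst (c (1, (y, v)))\<close> is the exponential map in coordinates.\<close>

locale temple_data = adapted_frame D G \<delta> Y V E
  for D :: "'n::finite model set" and G \<delta> Y V E +
  fixes \<epsilon> :: real and c :: "real \<times> ('n model \<times> 'n model) \<Rightarrow> 'n model \<times> 'n model"
  assumes \<epsilon>: "\<epsilon> > 0" and sc: "smooth_on ({-2<..<2} \<times> ball (0, 0) \<epsilon>) c"
    and odec: "\<And>s p. s \<in> {-2<..<2} \<Longrightarrow> p \<in> ball (0, 0) \<epsilon> \<Longrightarrow> fst (c (s, p)) \<in> D \<and>
      ((\<lambda>s. c (s, p)) has_vector_derivative spray (c (s, p))) (at s)"
    and c0: "\<And>p. p \<in> ball (0, 0) \<epsilon> \<Longrightarrow> c (0, p) = p"
    and c_still: "\<And>y. (y, 0 :: 'n model) \<in> ball (0, 0) \<epsilon> \<Longrightarrow> fst (c (1, (y, 0))) = y"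
    and c_deriv: "((\<lambda>p. fst (c (1, p))) has_derivative (\<lambda>(a, b). a + b)) (at (0, 0))"
begin

definition frame_vector :: "'n model \<times> 'n model \<Rightarrow> 'n model" where
  "frame_vector p = fst (snd p) *\<^sub>R V (fst p) + (\<Sum>i\<in>UNIV. (snd (snd p) $ i) *\<^sub>R E i (fst p))"

definition state :: "'n model \<times> 'n model \<Rightarrow> 'n model \<times> 'n model" where
  "state p = (Y (fst p), frame_vector p)"

definition K :: "'n model \<times> 'n model \<Rightarrow> 'n model" where "K p = fst (c (1, state p))"

lemma Y_derivative: "(Y has_derivative (\<lambda>a. a)) (at 0)"
proof -
  have o: "(0 :: 'n model) \<in> {-\<delta><..<\<delta>} \<times> ball 0 \<delta>" using \<delta> by (simp add: zero_prod_def)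
  note D = smooth_on_has_derivative[OF sY o]
  have lin: "linear (fderiv Y 0)" using D has_derivative_linear by blast
  have 1: "fderiv Y 0 (1, 0) = (1, 0)"
  proof (rule vector_derivative_unique_at)
    show "((\<lambda>s. Y (0 + s *\<^sub>R (1, 0))) has_vector_derivative fderiv Y 0 (1, 0)) (at 0)"
      by (rule has_vector_derivative_along_line) (use D in \<open>simp add: zero_prod_def\<close>)
    show "((\<lambda>s. Y (0 + s *\<^sub>R (1, 0))) has_vector_derivative (1, 0)) (at 0)"
      using odeY[of 0 0] \<delta> by (simp add: V0)
  qed
  have 2: "fderiv Y 0 (0, w) = (0, w)" for w
  proof (rule vector_derivative_unique_at)
    show "((\<lambda>s. Y (0 + s *\<^sub>R (0, w))) has_vector_derivative fderiv Y 0 (0, w)) (at 0)"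
      by (rule has_vector_derivative_along_line) (use D in \<open>simp add: zero_prod_def\<close>)
    have op: "open ((\<lambda>s. s *\<^sub>R w) -` ball 0 \<delta>)" by (intro open_vimage open_ball continuous_intros)
    show "((\<lambda>s. Y (0 + s *\<^sub>R (0, w))) has_vector_derivative (0, w)) (at 0)"
    proof (rule has_vector_derivative_transform_within_open[OF _ op])
      show "((\<lambda>s. s *\<^sub>R (0::real, w)) has_vector_derivative (0, w)) (at 0)"
        unfolding has_vector_derivative_def by (rule bounded_linear_imp_has_derivative[OF bounded_linear_scaleR_left])
      show "s *\<^sub>R (0, w) = Y (0 + s *\<^sub>R (0, w))" if "s \<in> (\<lambda>s. s *\<^sub>R w) -` ball 0 \<delta>" for s
        using Y0[of "s *\<^sub>R w"] that by simp
    qed (use \<delta> in simp)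
  qed
  have "fderiv Y 0 a = a" for a
  proof -
    have "fderiv Y 0 (fst a *\<^sub>R (1, 0) + (0, snd a)) = fst a *\<^sub>R (1, 0) + (0, snd a)"
      unfolding linear_add[OF lin] linear_cmul[OF lin] 1 2 ..
    then show ?thesis by simp
  qed
  then have "fderiv Y 0 = (\<lambda>a. a)" by (rule ext)
  then show ?thesis using D by simp
qed

text \<open>At the origin \<open>Y\<close> has the identity as derivative, and the frame is the standard basis, so
  that \<open>K\<close> has derivative \<open>(a, b) \<mapsto> a + b\<close> there; near the origin this holds up to a small
  Lipschitz error. The set \<open>B\<close> collects further open conditions on \<open>a\<close>.\<close>

lemma temple_kernel:
  assumes B: "open B" "(0 :: 'n model) \<in> B"
  obtains \<eta> where "\<eta> \<le> \<delta>" "near_additive K \<eta>" "ball 0 \<eta> \<subseteq> B" "\<And>p. p \<in> ball 0 \<eta> \<Longrightarrow> state p \<in> ball (0, 0) \<epsilon>"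
proof -
  let ?\<Omega> = "{-\<delta><..<\<delta>} \<times> ball (0 :: real ^ 'n) \<delta>"
  have o\<Omega>: "open ?\<Omega>" by (intro open_Times open_ball open_greaterThanLessThan)
  have z\<Omega>: "(0 :: 'n model) \<in> ?\<Omega>" using \<delta> by (simp add: zero_prod_def)
  let ?S = "(?\<Omega> \<inter> B) \<times> (UNIV :: 'n model set)"
  have oS: "open ?S" by (intro open_Times open_Int o\<Omega> B open_UNIV)
  have f: "smooth_on ?S (\<lambda>p. h (fst p))" if "smooth_on ?\<Omega> h" for h :: "'n model \<Rightarrow> 'n model"
    by (rule smooth_on_compose[OF oS o\<Omega> that]) (auto intro!: smooth_on_fst oS)
  have s_state: "smooth_on ?S state"
    unfolding state_def frame_vector_def
    by (intro smooth_on_Pair smooth_on_add smooth_on_scaleR smooth_on_sum smooth_on_vec_nth smooth_on_fst smooth_on_snd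
        smooth_on_id oS f sY sV sE)
  have state0: "state 0 = (0, 0)"
    using Y0[of 0] \<delta> by (simp add: state_def frame_vector_def zero_prod_def prod_eq_iff fst_sum snd_sum)
  define Dom where "Dom = state -` ball (0, 0) \<epsilon> \<inter> ?S"
  have oDom: "open Dom"
    unfolding Dom_def using continuous_open_preimage[OF smooth_on_continuous[OF s_state] oS open_ball] by (simp add: Int_commute)
  have zDom: "0 \<in> Dom" using z\<Omega> B \<epsilon> state0 by (simp add: Dom_def mem_Times_iff)
  have oc: "open ({-2<..<2::real} \<times> ball (0 :: 'n model, 0 :: 'n model) \<epsilon>)" by (intro open_Times open_ball open_greaterThanLessThan)
  have sDom: "smooth_on Dom state" by (rule smooth_on_subset[OF s_state]) (simp add: Dom_def)
  have sK: "smooth_on Dom K"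
    unfolding K_def
    by (intro smooth_on_fst oDom smooth_on_compose[OF oDom oc sc] smooth_on_Pair smooth_on_const sDom)
      (auto simp: Dom_def)
  have dK: "(K has_derivative (\<lambda>p. fst p + snd p)) (at 0)"
  proof -
    have dV: "(V has_derivative fderiv V 0) (at 0)" by (rule smooth_on_has_derivative[OF sV z\<Omega>])
    have dE: "(E i has_derivative fderiv (E i) 0) (at 0)" for i by (rule smooth_on_has_derivative[OF sE z\<Omega>])
    have cf: "((\<lambda>p :: 'n model \<times> 'n model. h (fst p)) has_derivative (\<lambda>p. h' (fst p))) (at 0)" if "(h has_derivative h') (at 0)" for h h' :: "'n model \<Rightarrow> 'n model"
    proof -
      have "(fst has_derivative fst) (at (0 :: 'n model \<times> 'n model))"
        by (rule bounded_linear_imp_has_derivative[OF bounded_linear_fst])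
      from has_derivative_compose[OF this, of h h'] that show ?thesis by simp
    qed
    have 1: "((\<lambda>p :: 'n model \<times> 'n model. Y (fst p)) has_derivative (\<lambda>p. fst p)) (at 0)" by (rule cf[OF Y_derivative])
    have bn: "bounded_linear (\<lambda>p :: 'n model \<times> 'n model. snd (snd p) $ i)" for i
      by (intro bounded_linear_compose[OF bounded_linear_vec_nth] bounded_linear_compose[OF bounded_linear_snd] bounded_linear_snd)
    have bf: "bounded_linear (\<lambda>p :: 'n model \<times> 'n model. fst (snd p))"
      by (intro bounded_linear_compose[OF bounded_linear_fst] bounded_linear_snd)
    have "(frame_vector has_derivative (\<lambda>p. (fst (snd (0 :: 'n model \<times> 'n model)) *\<^sub>R fderiv V 0 (fst p) + fst (snd p) *\<^sub>R V (fst (0 :: 'n model \<times> 'n model)))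
       + (\<Sum>i\<in>UNIV. (snd (snd (0 :: 'n model \<times> 'n model)) $ i) *\<^sub>R fderiv (E i) 0 (fst p) + (snd (snd p) $ i) *\<^sub>R E i (fst (0 :: 'n model \<times> 'n model))))) (at 0)"
      unfolding frame_vector_def
      by (intro has_derivative_add has_derivative_sum has_derivative_scaleR bounded_linear_imp_has_derivative bn bf cf[OF dV] cf[OF dE])
    moreover have "(\<lambda>p. (fst (snd (0 :: 'n model \<times> 'n model)) *\<^sub>R fderiv V 0 (fst p) + fst (snd p) *\<^sub>R V (fst (0 :: 'n model \<times> 'n model)))
       + (\<Sum>i\<in>UNIV. (snd (snd (0 :: 'n model \<times> 'n model)) $ i) *\<^sub>R fderiv (E i) 0 (fst p) + (snd (snd p) $ i) *\<^sub>R E i (fst (0 :: 'n model \<times> 'n model))))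
       = snd"
    proof (rule ext)
      fix p :: "'n model \<times> 'n model"
      have z: "fst (0 :: 'n model \<times> 'n model) = (0, 0)" by (simp add: zero_prod_def)
      have "(\<Sum>i\<in>UNIV. (w $ i) *\<^sub>R axis i (1::real)) = w" for w :: "real ^ 'n"
        by (rule vec_eq_iff[THEN iffD2]) (auto simp: axis_def if_distrib cong: if_cong)
      then show "(fst (snd (0 :: 'n model \<times> 'n model)) *\<^sub>R fderiv V 0 (fst p) + fst (snd p) *\<^sub>R V (fst (0 :: 'n model \<times> 'n model)))
       + (\<Sum>i\<in>UNIV. (snd (snd (0 :: 'n model \<times> 'n model)) $ i) *\<^sub>R fderiv (E i) 0 (fst p) + (snd (snd p) $ i) *\<^sub>R E i (fst (0 :: 'n model \<times> 'n model)))
       = snd p"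
        unfolding z V0 E0 by (simp add: prod_eq_iff fst_sum snd_sum)
    qed
    ultimately have 2: "(frame_vector has_derivative snd) (at 0)" by (simp only:)
    have "(state has_derivative (\<lambda>p. (fst p, snd p))) (at 0)"
      unfolding state_def by (rule has_derivative_Pair[OF 1 2])
    from has_derivative_compose[OF this, of "\<lambda>p. fst (c (1, p))" "\<lambda>(a, b). a + b"] c_deriv
    show ?thesis by (simp add: state0 K_def[abs_def] case_prod_beta')
  qed
  have "{0} \<subseteq> Dom" "(0::real) < 1/8" using zDom by auto
  then obtain \<eta>0 where e0: "\<eta>0 > 0" "\<And>x. x \<in> {0} \<Longrightarrow> ball x \<eta>0 \<subseteq> Dom"
    "\<And>x y z. x \<in> {0} \<Longrightarrow> y \<in> ball x \<eta>0 \<Longrightarrow> z \<in> ball x \<eta>0 \<Longrightarrow> norm (K y - K z - fderiv K x (y - z)) \<le> (1/8) * norm (y - z)"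
    using C1_strict_derivative_uniform[OF oDom smooth_onD[OF sK], of "{0}" "1/8"] by (metis compact_sing)
  obtain r where r: "r > 0" "ball 0 r \<subseteq> B" using B openE by blast
  define \<eta> where "\<eta> = min \<eta>0 (min r \<delta>)"
  have sub: "ball 0 \<eta> \<subseteq> Dom" using e0(2)[of 0] by (auto simp: \<eta>_def)
  show ?thesis
  proof (rule that[of \<eta>])
    show "near_additive K \<eta>"
    proof
      show "0 < \<eta>" using e0(1) r \<delta> by (simp add: \<eta>_def)
      show "smooth_on (ball 0 \<eta>) K" by (rule smooth_on_subset[OF sK sub])
      show "norm (K p - K q - ((fst p + snd p) - (fst q + snd q))) \<le> (1/8) * norm (p - q)"
        if "p \<in> ball 0 \<eta>" "q \<in> ball 0 \<eta>" for p q
        using e0(3)[of 0 p q] that by (simp add: fderiv_eq[OF dK] \<eta>_def algebra_simps)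
    qed
    show "\<eta> \<le> \<delta>" "ball 0 \<eta> \<subseteq> B" using r by (auto simp: \<eta>_def)
    show "state p \<in> ball (0, 0) \<epsilon>" if "p \<in> ball 0 \<eta>" for p using sub that by (auto simp: Dom_def)
  qed
qed

end

section \<open>Adapted charts\<close>

context smooth_manifold
begin

lemma restrict_chart:
  assumes c: "c \<in> maximal_atlas A" and U: "open U"
  shows "(fst c \<inter> U, snd c) \<in> maximal_atlas A"
    and "\<And>y. y \<in> snd c ` (fst c \<inter> U) \<Longrightarrow> chart_inv (fst c \<inter> U, snd c) y = chart_inv c y"
proof -
  note ch = maximal_is_chart[OF c]
  let ?r = "(fst c \<inter> U, snd c)"
  have inj: "inj_on (snd c) (fst c)" by (rule inj_on_inverseI[of _ "chart_inv c"]) (rule chart_inv_left[OF ch])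
  show eq: "chart_inv ?r y = chart_inv c y" if y: "y \<in> snd c ` (fst c \<inter> U)" for y
  proof -
    obtain x where x: "x \<in> fst c" "x \<in> U" "y = snd c x" using y by auto
    have "inv_into (fst c \<inter> U) (snd c) (snd c x) = x"
      by (rule inv_into_f_f) (use x inj in \<open>auto intro: inj_on_subset\<close>)
    then show ?thesis using x chart_inv_left[OF ch x(1)] by (simp add: chart_inv_def)
  qed
  have "homeomorphism (fst c \<inter> U) (snd c ` (fst c \<inter> U)) (snd c) (chart_inv c)"
    using ch by (auto simp: is_chart_def intro: homeomorphism_of_subsets)
  then have "homeomorphism (fst c \<inter> U) (snd c ` (fst c \<inter> U)) (snd c) (chart_inv ?r)"
    using eq by (simp add: homeomorphism_def cong: continuous_on_cong image_cong)
  then have isc: "is_chart ?r"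
    using chart_open(1)[OF ch] chart_image_open[OF ch U] U by (simp add: is_chart_def open_Int)
  moreover have "compatible ?r c'" if c': "c' \<in> A" for c'
  proof -
    note c'm = atlas_subset_maximal[OF c']
    have o: "open (snd c ` (fst c \<inter> (U \<inter> fst c')))" "open (snd c' ` (fst c' \<inter> (fst c \<inter> U)))"
      by (intro chart_image_open ch charts[OF c'] open_Int U chart_open)+
    have "smooth_on (snd c ` (fst c \<inter> (U \<inter> fst c'))) (transition c c')"
      by (rule smooth_on_subset[OF smooth_transition[OF c c'm]]) auto
    then have "smooth_on (snd c ` (fst c \<inter> (U \<inter> fst c'))) (transition ?r c')"
    proof (rule smooth_on_cong[OF o(1), THEN iffD1, rotated])
      fix z assume "z \<in> snd c ` (fst c \<inter> (U \<inter> fst c'))"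
      then have "z \<in> snd c ` (fst c \<inter> U)" by blast
      from eq[OF this] show "transition c c' z = transition ?r c' z" by (simp add: transition_def)
    qed
    moreover have "smooth_on (snd c' ` (fst c' \<inter> (fst c \<inter> U))) (transition c' c)"
      by (rule smooth_on_subset[OF smooth_transition[OF c'm c]]) auto
    ultimately show ?thesis
      by (simp add: compatible_def Int_assoc Int_commute[of "fst c'"] transition_def[of c'])
  qed
  ultimately show "?r \<in> maximal_atlas A" by (simp add: maximal_atlas_def)
qed

text \<open>The transition maps of the new chart are those of \<open>a\<close>, composed with an affine bijection
  whose linear part is \<open>L\<close>.\<close>

lemma affine_chart:
  fixes L :: "'n model \<Rightarrow> 'n model" and y0 :: "'n model"
  assumes a: "a \<in> maximal_atlas A" and L: "linear L" "bij L"
  defines "c \<equiv> (fst a, \<lambda>x. inv L (snd a x - y0))"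
  shows "c \<in> maximal_atlas A" and "\<And>x v. x \<in> fst a \<Longrightarrow> jacobian c a x v = L v"
proof -
  note ch = maximal_is_chart[OF a]
  have li: "linear (inv L)" using L bij_is_inj inj_linear_imp_inv_linear by blast
  have LI: "L (inv L z) = z" "inv L (L z) = z" for z using L(2) by (auto simp: bij_is_surj surj_f_inv_f bij_is_inj)
  have bl: "bounded_linear L" "bounded_linear (inv L)" using L li by (auto simp: linear_conv_bounded_linear)
  define \<psi> where "\<psi> z = L z + y0" for z
  have s\<psi>: "smooth_on S \<psi>" if "open S" for S
    unfolding \<psi>_def by (intro smooth_on_add that smooth_on_bounded_linear bl smooth_on_const)
  have key: "z = snd c x \<longleftrightarrow> \<psi> z = snd a x" for x z
  proof
    show "z = snd c x \<Longrightarrow> \<psi> z = snd a x" by (simp add: \<psi>_def c_def LI)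
    assume "\<psi> z = snd a x"
    then have "L z = snd a x - y0" by (simp add: \<psi>_def eq_diff_eq)
    then show "z = snd c x" using LI(2)[of z] by (simp add: c_def)
  qed
  have im: "snd c ` X = \<psi> -` (snd a ` X)" for X
    unfolding image_def vimage_def key by simp
  have \<psi>c: "\<psi> (snd c x) = snd a x" for x by (simp add: \<psi>_def c_def LI)
  have inj: "inj_on (snd a) (fst a)" by (rule inj_on_inverseI[of _ "chart_inv a"]) (rule chart_inv_left[OF ch])
  have ci: "chart_inv c z = chart_inv a (\<psi> z)" if z: "z \<in> snd c ` fst a" for z
  proof -
    obtain x where x: "x \<in> fst a" "z = snd c x" using z by auto
    have "inj_on (snd c) (fst c)"
      using inj \<psi>c unfolding inj_on_def c_def fst_conv by metis
    moreover have "x \<in> fst c" using x by (simp add: c_def)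
    ultimately have "chart_inv c z = x" unfolding chart_inv_def x(2) by (rule inv_into_f_f)
    then show ?thesis using chart_inv_left[OF ch x(1)] x \<psi>c by simp
  qed
  have c\<psi>: "continuous_on X \<psi>" for X unfolding \<psi>_def by (intro continuous_intros linear_continuous_on bl)
  have op: "open (\<psi> -` X)" if "open X" for X by (rule open_vimage[OF that c\<psi>])
  have cs: "continuous_on (fst a) (snd c)"
    unfolding c_def snd_conv
    by (intro bounded_linear.continuous_on[OF bl(2)] continuous_intros chart_continuous[OF ch])
  have cinv: "continuous_on (snd c ` fst a) (chart_inv c)"
  proof -
    have "continuous_on (snd c ` fst a) (\<lambda>z. chart_inv a (\<psi> z))"
      by (rule continuous_on_compose2[OF chart_continuous(2)[OF ch] c\<psi>]) (use \<psi>c in auto)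
    then show ?thesis using ci by (simp cong: continuous_on_cong)
  qed
  have left: "chart_inv c (snd c x) = x" if "x \<in> fst a" for x using ci[of "snd c x"] that \<psi>c chart_inv_left[OF ch] by simp
  have isc: "is_chart c"
    unfolding is_chart_def
  proof (intro conjI)
    show "open (fst c)" using chart_open[OF ch] by (simp add: c_def)
    have "open (snd c ` fst a)" unfolding im by (rule op[OF chart_open(2)[OF ch]])
    then show "open (snd c ` fst c)" by (simp add: c_def)
    have "homeomorphism (fst a) (snd c ` fst a) (snd c) (chart_inv c)"
      by (rule homeomorphismI[OF cs cinv]) (use left in auto)
    then show "homeomorphism (fst c) (snd c ` fst c) (snd c) (chart_inv c)" by (simp add: c_def)
  qed
  have fc: "fst c = fst a" by (simp add: c_def)
  have t1: "transition c b z = transition a b (\<psi> z)" if "z \<in> snd c ` fst a" for b z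
    using ci[OF that] by (simp add: transition_def)
  have "compatible c b" if b: "b \<in> A" for b
  proof -
    note bm = atlas_subset_maximal[OF b]
    have oab: "open (snd a ` (fst a \<inter> fst b))" "open (snd b ` (fst b \<inter> fst a))" by (intro overlap_open a bm)+
    have o: "open (snd c ` (fst a \<inter> fst b))" unfolding im by (rule op[OF oab(1)])
    have "smooth_on (snd c ` (fst a \<inter> fst b)) (\<lambda>z. transition a b (\<psi> z))"
      by (rule smooth_on_compose[OF o oab(1) smooth_transition[OF a bm] s\<psi>[OF o]]) (use \<psi>c in auto)
    then have 1: "smooth_on (snd c ` (fst a \<inter> fst b)) (transition c b)"
    proof (rule smooth_on_cong[OF o, THEN iffD1, rotated])
      fix z assume "z \<in> snd c ` (fst a \<inter> fst b)"
      then have "z \<in> snd c ` fst a" by blast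
      from t1[OF this] show "transition a b (\<psi> z) = transition c b z" by simp
    qed
    have "smooth_on (snd b ` (fst b \<inter> fst a)) (\<lambda>z. inv L (transition b a z - y0))"
      by (intro smooth_on_linear_comp[OF _ bl(2)] smooth_on_diff smooth_on_const oab smooth_transition bm a)
    then have 2: "smooth_on (snd b ` (fst b \<inter> fst a)) (transition b c)"
      by (simp add: transition_def c_def o_def)
    show ?thesis using 1 2 by (simp add: compatible_def fc Int_commute)
  qed
  then show "c \<in> maximal_atlas A" using isc by (simp add: maximal_atlas_def)
  show "jacobian c a x v = L v" if x: "x \<in> fst a" for x v
  proof -
    have o: "open (snd c ` fst a)" unfolding im by (rule op[OF chart_open(2)[OF ch]])
    have "(\<psi> has_derivative L) (at (snd c x))"
      unfolding \<psi>_def using bounded_linear_imp_has_derivative[OF bl(1)] by (auto intro!: derivative_eq_intros)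
    then have "(transition c a has_derivative L) (at (snd c x))"
      by (rule has_derivative_transform_within_open[OF _ o]) (use x \<psi>c left in \<open>auto simp: transition_def\<close>)
    from fderiv_eq[OF this] show ?thesis by (simp add: jacobian_def)
  qed
qed

text \<open>A transition between two slice charts maps the slice \<open>{y. fst y = 0}\<close> into itself, and
  therefore so does its derivative. Hence tangency to the hypersurface can be read off in any
  slice chart.\<close>

lemma slice_tangent:
  assumes c: "slice_chart A S c" and c': "slice_chart A S c'" and x: "x \<in> S" "x \<in> fst c" "x \<in> fst c'"
    and v: "fst (components A c x v) = 0"
  shows "fst (components A c' x v) = 0"
proof -
  have m: "c \<in> maximal_atlas A" "c' \<in> maximal_atlas A" using c c' by (auto simp: slice_chart_def)
  note ch = m[THEN maximal_is_chart]
  define w where "w = components A c x v"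
  let ?O = "snd c ` (fst c \<inter> fst c')"
  have D: "((\<lambda>s. transition c c' (snd c x + s *\<^sub>R w)) has_vector_derivative jacobian c c' x w) (at 0)"
    by (rule has_vector_derivative_along_line) (use jacobian_has_derivative[OF m x(2,3)] in simp)
  have op: "open ((\<lambda>s. snd c x + s *\<^sub>R w) -` ?O)"
    by (intro open_vimage overlap_open m continuous_intros)
  have 1: "((\<lambda>s. fst (transition c c' (snd c x + s *\<^sub>R w))) has_vector_derivative fst (jacobian c c' x w)) (at 0)"
    by (rule bounded_linear.has_vector_derivative[OF bounded_linear_fst D])
  have "((\<lambda>s. fst (transition c c' (snd c x + s *\<^sub>R w))) has_vector_derivative 0) (at 0)"
  proof (rule has_vector_derivative_transform_within_open[OF has_vector_derivative_const op])
    show "0 \<in> (\<lambda>s. snd c x + s *\<^sub>R w) -` ?O" using x by auto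
    fix s assume "s \<in> (\<lambda>s. snd c x + s *\<^sub>R w) -` ?O"
    then obtain z where z: "z \<in> fst c" "z \<in> fst c'" "snd c x + s *\<^sub>R w = snd c z" by auto
    have "fst (snd c z) = 0" using c x v z(3)[symmetric] by (simp add: slice_chart_def w_def)
    then have "z \<in> S" using c z by (simp add: slice_chart_def)
    then show "0 = fst (transition c c' (snd c x + s *\<^sub>R w))"
      using c' z by (simp add: transition_at ch slice_chart_def)
  qed
  then have "fst (jacobian c c' x w) = 0" using 1 vector_derivative_unique_at by blast
  then show ?thesis using components_change[OF m x(2,3), of v] by (simp add: w_def)
qed

end

context spacetime
begin

text \<open>A Lorentz frame at \<open>p\<close>, reversed in time if necessary, determines affine changes of a
  chart of the atlas. Since \<open>T p\<close> is timelike, the absolute value of its time component exceeds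
  the norm of its space component, so that the choice of sign makes it future directed.\<close>

lemma minkowski_chart:
  obtains c where "c \<in> maximal_atlas A" "p \<in> fst c" "snd c p = 0"
    "\<And>u v. gc c 0 u v = - (fst u * fst v) + snd u \<bullet> snd v"
    "norm (snd (components A c p (T p))) < fst (components A c p (T p))"
    "continuous_on (fst c) (\<lambda>x. components A c x (T x))"
proof -
  define a where "a = chart_at A p"
  have a: "a \<in> A" "p \<in> fst a" "a \<in> maximal_atlas A" using chart_at chart_at_maximal by (auto simp: a_def)
  obtain L0 :: "'n model \<Rightarrow> 'n model" where L0: "linear L0" "bij L0"
    "\<And>u v. g p (L0 u) (L0 v) = - (fst u * fst v) + snd u \<bullet> snd v"
    using lorentz[of p] unfolding lorentz_form_def by blast
  \<comment> \<open>The sign reverses time if \<open>T p\<close> points to the past of the frame given by \<open>L0\<close>.\<close>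
  define \<sigma> :: real where "\<sigma> = (if 0 \<le> fst (inv L0 (T p)) then 1 else -1)"
  have \<sigma>: "\<sigma> * \<sigma> = 1" by (simp add: \<sigma>_def)
  define R where "R u = (\<sigma> * fst u, snd u)" for u :: "'n model"
  have RR: "R (R u) = u" for u by (simp add: R_def \<sigma> mult.assoc[symmetric])
  have R: "linear R" "bij R"
    by (auto intro!: linearI simp: R_def algebra_simps, rule o_bij[of R R]) (auto simp: RR)
  define L where "L = L0 \<circ> R"
  have L: "linear L" "bij L"
    using linear_compose[OF R(1) L0(1)] bij_comp[OF R(2) L0(2)] by (simp_all add: L_def)
  have gL: "g p (L u) (L v) = - (fst u * fst v) + snd u \<bullet> snd v" for u v
  proof -
    have "(\<sigma> * fst u) * (\<sigma> * fst v) = (\<sigma> * \<sigma>) * (fst u * fst v)" by (simp only: mult_ac)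
    then show ?thesis by (simp add: L_def L0(3) R_def \<sigma>)
  qed
  define y0 where "y0 = snd a p"
  define c where "c = (fst a, \<lambda>x. inv L (snd a x - y0))"
  have c: "c \<in> maximal_atlas A" and jca: "\<And>x v. x \<in> fst a \<Longrightarrow> jacobian c a x v = L v"
    unfolding c_def by (rule affine_chart[OF a(3) L])+
  have fc: "fst c = fst a" by (simp add: c_def)
  have jac: "jacobian a c x v = inv L v" if "x \<in> fst a" for x v
  proof -
    have "L (jacobian a c x v) = v"
      using jacobian_inverse[OF a(3) c, of x v] jca that fc by simp
    then show ?thesis using L(2) by (metis bij_inv_eq_iff)
  qed
  have comp: "components A c x v = inv L (components A a x v)" if "x \<in> fst a" for x v
    using components_change[OF a(3) c, of x v] jac that fc by simp
  have li: "linear (inv L)" using L bij_is_inj inj_linear_imp_inv_linear by blast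
  have cp: "snd c p = 0" using linear_0[OF li] by (simp add: c_def y0_def)
  have compa: "components A a p v = v" for v
    using jacobian_self[OF a(3,2)] by (simp add: components_jacobian a_def[symmetric])
  define w where "w = inv L (T p)"
  have Tw: "T p = L w" using L(2) by (simp add: w_def bij_is_surj surj_f_inv_f)
  have compT: "components A c p (T p) = w" using comp[OF a(2), of "T p"] compa by (simp add: w_def)
  have "inv L (T p) = R (inv L0 (T p))"
  proof -
    have "L (R (inv L0 (T p))) = T p" using L0(2) by (simp add: L_def RR bij_is_surj surj_f_inv_f)
    then show ?thesis using L(2) by (metis bij_inv_eq_iff)
  qed
  then have w0: "0 \<le> fst w" by (auto simp: w_def R_def \<sigma>_def)
  have "g p (L w) (L w) < 0" using T_timelike[of p] Tw by simp
  then have "(norm (snd w))\<^sup>2 < (fst w)\<^sup>2" unfolding power2_norm_eq_inner by (simp add: gL power2_eq_square)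
  then have wn: "norm (snd w) < fst w" using w0 power2_less_imp_less by blast
  have met: "gc c 0 u v = - (fst u * fst v) + snd u \<bullet> snd v" for u v
  proof -
    have "gc c (snd c p) u v = gc a (snd a p) (L u) (L v)"
      using metric_change[OF c a(3), of p u v] jca[OF a(2)] a(2) fc by simp
    also have "\<dots> = g p (L u) (L v)"
      using g_components[OF a(3,2), of "L u" "L v"] compa by simp
    finally show ?thesis by (simp add: cp gL)
  qed
  have "continuous_on (fst a) (\<lambda>x. inv L (components A a x (T x)))"
    using li by (intro continuous_on_compose2[OF linear_continuous_on[of "inv L"] T_continuous[OF a(1)], of UNIV])
      (auto simp: linear_conv_bounded_linear)
  then have "continuous_on (fst c) (\<lambda>x. components A c x (T x))"
    using comp fc by (simp cong: continuous_on_cong)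
  then show ?thesis using that[OF c _ cp met] a(2) fc compT wn by simp
qed

end

section \<open>Temple charts\<close>

lemma smooth_into_cong:
  assumes S: "open S" and h: "smooth_into A S h" and eq: "\<And>x. x \<in> S \<Longrightarrow> f x = h x" and A: "\<And>c. c \<in> A \<Longrightarrow> open (fst c)"
  shows "smooth_into A S f"
  unfolding smooth_into_def
proof (intro conjI ballI)
  have ch: "continuous_on S h" using h by (simp add: smooth_into_def)
  then show "continuous_on S f" using eq by (simp cong: continuous_on_cong)
  fix c assume c: "c \<in> A"
  have e: "{x \<in> S. f x \<in> fst c} = {x \<in> S. h x \<in> fst c}" using eq by auto
  have "open (S \<inter> h -` fst c)" by (rule continuous_open_preimage[OF ch S A[OF c]])
  then have o: "open {x \<in> S. h x \<in> fst c}" by (simp add: vimage_def Int_def)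
  have "smooth_on {x \<in> S. h x \<in> fst c} (snd c \<circ> h)" using h c by (simp add: smooth_into_def)
  then show "smooth_on {x \<in> S. f x \<in> fst c} (snd c \<circ> f)"
    unfolding e by (rule smooth_on_cong[OF o, THEN iffD1, rotated]) (use eq in auto)
qed

context smooth_manifold
begin

text \<open>Since \<open>f\<close> is \<open>P\<close> followed by the inverse of a chart, its inverse in another chart is the
  inverse of \<open>P\<close> after a transition map.\<close>

lemma diffeomorphism_onto_image_chartI:
  assumes k: "k \<in> maximal_atlas A" and S: "open S" and P: "smooth_on S P" "P ` S \<subseteq> snd k ` fst k" "inj_on P S"
    "open (P ` S)" "smooth_on (P ` S) (inv_into S P)" and f: "\<And>x. x \<in> S \<Longrightarrow> f x = chart_inv k (P x)"
  shows "diffeomorphism_onto_image A S f"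
proof -
  note ch = maximal_is_chart[OF k]
  have fk: "f x \<in> fst k" "snd k (f x) = P x" if "x \<in> S" for x
    using chart_inv_right[OF ch, of "P x"] P(2) that by (auto simp: f)
  have inj: "inj_on f S" using fk(2) P(3) unfolding inj_on_def by metis
  have im: "f ` S = chart_inv k ` (P ` S)" using f by (simp add: image_image cong: image_cong)
  have o: "open (f ` S)" unfolding im by (rule chart_inv_image_open[OF ch P(4,2)])
  have s: "smooth_into A S f"
    by (rule smooth_into_cong[OF S smooth_into_chart_inv[OF k S P(1,2)] f]) (simp_all add: chart_open charts)
  have "smooth_on (snd c ` (f ` S \<inter> fst c)) (inv_into S f \<circ> chart_inv c)" if c: "c \<in> A" for c
  proof -
    note cm = atlas_subset_maximal[OF c]
    let ?O = "snd c ` (f ` S \<inter> fst c)"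
    have oO: "open ?O" using chart_image_open[OF charts[OF c] o] by (simp add: Int_commute)
    have pt: "\<exists>x. x \<in> S \<and> f x \<in> fst c \<and> y = snd c (f x)" if "y \<in> ?O" for y using that by blast
    have "smooth_on ?O (\<lambda>y. inv_into S P (transition c k y))"
    proof (rule smooth_on_compose[OF oO P(4,5)])
      show "smooth_on ?O (transition c k)"
        by (rule smooth_on_subset[OF smooth_transition[OF cm k]]) (use fk in blast)
      show "transition c k ` ?O \<subseteq> P ` S"
      proof (rule image_subsetI)
        fix y assume "y \<in> ?O"
        then obtain x where "x \<in> S" "f x \<in> fst c" "y = snd c (f x)" using pt by blast
        then show "transition c k y \<in> P ` S" using fk by (simp add: transition_at charts[OF c])
      qed
    qed
    then show ?thesis
    proof (rule smooth_on_cong[OF oO, THEN iffD1, rotated])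
      fix y assume "y \<in> ?O"
      then obtain x where x: "x \<in> S" "f x \<in> fst c" "y = snd c (f x)" using pt by blast
      then show "inv_into S P (transition c k y) = (inv_into S f \<circ> chart_inv c) y"
        using fk[OF x(1)] inv_into_f_f[OF inj x(1)] inv_into_f_f[OF P(3) x(1)]
        by (simp add: transition_at chart_inv_left charts[OF c])
    qed
  qed
  then have "smooth_from A (f ` S) (inv_into S f)" by (simp add: smooth_from_def)
  with inj o s show ?thesis by (simp add: diffeomorphism_onto_image_def)
qed

end

text \<open>The data of the previous sections, for the metric in a chart \<open>k\<close> around \<open>p\<close>, on a ball so
  small that the frames have the required causal character with respect to the time orientation
  and that the slice is spacelike.\<close>

locale temple_setup = spacetime A g T + temple_data "snd k ` fst k" "metric_in_chart A g k" \<delta> Y V E \<epsilon> c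
  for A :: "('m::{t2_space, second_countable_topology}, 'n::finite) chart set" and g :: "('m, 'n) metric_field"
    and T :: "('m, 'n) vector_field" and k :: "('m, 'n) chart" and \<delta> Y V E \<epsilon> c +
  fixes p :: 'm and \<eta> :: real
  assumes k: "k \<in> maximal_atlas A" and p: "p \<in> fst k" "snd k p = 0"
    and \<eta>\<delta>: "\<eta> \<le> \<delta>" and near_K: "near_additive K \<eta>"
    and state_in: "\<And>q. q \<in> ball 0 \<eta> \<Longrightarrow> state q \<in> ball (0, 0) \<epsilon>"
    and future_V: "\<And>a. a \<in> ball 0 \<eta> \<Longrightarrow>
      gc k (Y a) (V a) (components A k (chart_inv k (Y a)) (T (chart_inv k (Y a)))) < 0"
    and future_E: "\<And>a i. a \<in> ball 0 \<eta> \<Longrightarrow>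
      gc k (Y a) (E i a + V a) (components A k (chart_inv k (Y a)) (T (chart_inv k (Y a)))) < 0"
    and spacelike: "\<And>x w. (0 :: real, x) \<in> ball 0 \<eta> \<Longrightarrow> w \<noteq> 0 \<Longrightarrow> gc k (0, x) (0, w) (0, w) > 0"
begin

sublocale near_additive K \<eta> by (rule near_K)

lemmas isc = maximal_is_chart[OF k]
lemmas \<Gamma>k = christoffel_eq[OF k]

abbreviation \<Omega> :: "'n model set" where "\<Omega> \<equiv> {-\<delta><..<\<delta>} \<times> ball 0 \<delta>"

lemma in_\<Omega>: assumes "a \<in> ball 0 \<eta>" shows "fst a \<in> {-\<delta><..<\<delta>}" "snd a \<in> ball 0 \<delta>" "a \<in> \<Omega>"
proof -
  have "\<bar>fst a\<bar> < \<delta>" "norm (snd a) < \<delta>"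
    using assms \<eta>\<delta> norm_fst_le[of "fst a" "snd a"] norm_snd_le[of "snd a" "fst a"] by auto
  then show "fst a \<in> {-\<delta><..<\<delta>}" "snd a \<in> ball 0 \<delta>" by auto
  then show "a \<in> \<Omega>" by (simp add: mem_Times_iff)
qed

lemma Y_in: assumes "a \<in> ball 0 \<eta>" shows "Y a \<in> snd k ` fst k"
  using odeY[OF in_\<Omega>(1,2)[OF assms]] by simp

lemma Y_chart: assumes "a \<in> ball 0 \<eta>" shows "chart_inv k (Y a) \<in> fst k" "snd k (chart_inv k (Y a)) = Y a"
  using chart_inv_right[OF isc Y_in[OF assms]] by auto

lemma g_from_components: "g (chart_inv k y) (from_components A k (chart_inv k y) u) (from_components A k (chart_inv k y) v) = gc k y u v"
  by (simp add: metric_in_chart_def Let_def)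

lemma g_from_components_T:
  assumes "a \<in> ball 0 \<eta>"
  shows "g (chart_inv k (Y a)) (from_components A k (chart_inv k (Y a)) u) (T (chart_inv k (Y a))) =
    gc k (Y a) u (components A k (chart_inv k (Y a)) (T (chart_inv k (Y a))))"
  using g_components[OF k Y_chart(1)[OF assms]] Y_chart[OF assms] k by simp

lemma K_base: assumes "a \<in> ball 0 \<eta>" shows "K (a, 0) = Y a"
proof -
  have "(a, 0 :: 'n model) \<in> ball 0 \<eta>" using assms by (simp add: norm_Pair)
  from state_in[OF this] have "(Y a, 0 :: 'n model) \<in> ball (0, 0) \<epsilon>" by (simp add: state_def frame_vector_def)
  from c_still[OF this] show ?thesis by (simp add: K_def state_def frame_vector_def)
qed

lemma Y_zero: "Y 0 = 0"
  using Y0[of 0] \<delta> by (simp add: zero_prod_def)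

lemma K_zero: "K 0 = 0"
  using K_base[of 0] \<eta> Y_zero by (simp add: zero_prod_def)

lemma K_in: assumes "q \<in> ball 0 \<eta>" shows "K q \<in> snd k ` fst k"
  using odec[OF _ state_in[OF assms], of 1] by (simp add: K_def)

text \<open>For \<open>a = (\<tau>, x)\<close> the geodesic that starts at the slice point \<open>x\<close>, shifted in time by \<open>\<tau>\<close>.
  The geodesics of the normal family are the case \<open>\<tau> = 0\<close>, and Temple charts use the general
  case.\<close>

definition normal_curve :: "real \<times> (real ^ 'n) \<Rightarrow> real \<Rightarrow> 'm" where
  "normal_curve a t = chart_inv k (Y (t + fst a, snd a))"

definition frame_along :: "real \<times> (real ^ 'n) \<Rightarrow> 'n \<Rightarrow> real \<Rightarrow> 'n model" where
  "frame_along a i t = from_components A k (normal_curve a t) (E i (t + fst a, snd a))"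

context
  fixes a :: "real \<times> (real ^ 'n)" and \<alpha> :: real
  assumes J: "\<And>t. t \<in> {-\<alpha><..<\<alpha>} \<Longrightarrow> (t + fst a, snd a) \<in> ball 0 \<eta>"
begin

lemma shifted_curve:
  assumes t: "t \<in> {-\<alpha><..<\<alpha>}"
  shows "Y (t + fst a, snd a) \<in> snd k ` fst k"
    and "((\<lambda>t. Y (t + fst a, snd a)) has_vector_derivative V (t + fst a, snd a)) (at t)"
    and "((\<lambda>t. V (t + fst a, snd a)) has_vector_derivative
      - christoffel A g k (Y (t + fst a, snd a)) (V (t + fst a, snd a)) (V (t + fst a, snd a))) (at t)"
    and "((\<lambda>t. E i (t + fst a, snd a)) has_vector_derivative
      - christoffel A g k (Y (t + fst a, snd a)) (V (t + fst a, snd a)) (E i (t + fst a, snd a))) (at t)"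
proof -
  note b = J[OF t]
  note o = in_\<Omega>(1,2)[OF b, unfolded fst_conv snd_conv]
  show "Y (t + fst a, snd a) \<in> snd k ` fst k" by (rule Y_in[OF b])
  show "((\<lambda>t. Y (t + fst a, snd a)) has_vector_derivative V (t + fst a, snd a)) (at t)"
    using has_vector_derivative_affine_shift[of "\<lambda>s. Y (s, snd a)" _ 1 t "fst a"] odeY[OF o] by simp
  show "((\<lambda>t. V (t + fst a, snd a)) has_vector_derivative
      - christoffel A g k (Y (t + fst a, snd a)) (V (t + fst a, snd a)) (V (t + fst a, snd a))) (at t)"
    using has_vector_derivative_affine_shift[of "\<lambda>s. V (s, snd a)" _ 1 t "fst a"] odeY[OF o] by (simp add: \<Gamma>k)
  show "((\<lambda>t. E i (t + fst a, snd a)) has_vector_derivative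
      - christoffel A g k (Y (t + fst a, snd a)) (V (t + fst a, snd a)) (E i (t + fst a, snd a))) (at t)"
    using has_vector_derivative_affine_shift[of "\<lambda>s. E i (s, snd a)" _ 1 t "fst a"] odeE[OF o] by (simp add: \<Gamma>k)
qed

lemma shifted_smooth: "smooth_on {-\<alpha><..<\<alpha>} (\<lambda>t. Y (t + fst a, snd a))"
proof -
  have "open \<Omega>" by (intro open_Times open_ball open_greaterThanLessThan)
  then show ?thesis
    by (rule smooth_on_compose[OF open_greaterThanLessThan _ sY])
      (use in_\<Omega>(3)[OF J] in \<open>auto simp del: mem_ball intro!: smooth_on_Pair smooth_on_add\<close>)
qed

lemma normal_curve_geodesic:
  shows "geodesic A g {-\<alpha><..<\<alpha>} (normal_curve a)"
    and "\<And>t. t \<in> {-\<alpha><..<\<alpha>} \<Longrightarrow> velocity A (normal_curve a) t = from_components A k (normal_curve a t) (V (t + fst a, snd a))"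
  unfolding normal_curve_def[abs_def]
  by (rule geodesic_chartI[OF k open_greaterThanLessThan _ shifted_curve(1) shifted_smooth shifted_curve(2,3)], simp_all add: is_interval_1)+

lemma normal_curve_unit_future: "unit_future_geodesic A g T {-\<alpha><..<\<alpha>} (normal_curve a)"
  unfolding unit_future_geodesic_def
proof (intro conjI ballI normal_curve_geodesic(1))
  fix t assume t: "t \<in> {-\<alpha><..<\<alpha>}"
  note b = J[OF t]
  have gv: "g (normal_curve a t) (velocity A (normal_curve a) t) (velocity A (normal_curve a) t) = -1"
    unfolding normal_curve_geodesic(2)[OF t] unfolding normal_curve_def g_from_components
    using VV[OF in_\<Omega>(1,2)[OF b, unfolded fst_conv snd_conv]] .
  then show "g (normal_curve a t) (velocity A (normal_curve a) t) (velocity A (normal_curve a) t) = -1" .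
  show "future_timelike g T (normal_curve a t) (velocity A (normal_curve a) t)"
    unfolding future_timelike_def
  proof (intro conjI)
    show "g (normal_curve a t) (velocity A (normal_curve a) t) (velocity A (normal_curve a) t) < 0" using gv by simp
    show "g (normal_curve a t) (velocity A (normal_curve a) t) (T (normal_curve a t)) < 0"
      unfolding normal_curve_geodesic(2)[OF t] unfolding normal_curve_def g_from_components_T[OF b] by (rule future_V[OF b])
  qed
qed

lemma frame_along_parallel: "parallel_along A g {-\<alpha><..<\<alpha>} (normal_curve a) (frame_along a i)"
  unfolding normal_curve_def[abs_def]
  by (rule parallel_along_chartI(1)[OF k open_greaterThanLessThan shifted_curve(1) shifted_smooth shifted_curve(2) shifted_curve(4)[where i=i]])
    (simp_all add: frame_along_def normal_curve_def components_from_components(1)[OF k Y_chart(1)[OF J]])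

end

text \<open>With the bound \<open>\<eta>/16\<close> on the slice and \<open>\<eta>/8\<close> on the time, the arguments of \<open>Y\<close> stay in the
  ball of radius \<open>\<eta>\<close>.\<close>

definition S :: "'m set" where "S = {m \<in> fst k. fst (snd k m) = 0 \<and> norm (snd (snd k m)) < \<eta> / 16}"

definition k_slice :: "('m, 'n) chart" where
  "k_slice = (fst k \<inter> {m \<in> fst k. snd k m \<in> UNIV \<times> ball 0 (\<eta> / 16)}, snd k)"

lemma slice: "slice_chart A S k_slice"
proof -
  have "open {m \<in> fst k. snd k m \<in> UNIV \<times> ball 0 (\<eta> / 16)}"
    by (rule chart_preimage_open[OF isc]) (intro open_Times open_UNIV open_ball)
  from restrict_chart(1)[OF k this] show ?thesis
    by (auto simp: slice_chart_def k_slice_def S_def mem_Times_iff)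
qed

lemma S_in: "m \<in> S \<Longrightarrow> m \<in> fst k_slice" "m \<in> S \<Longrightarrow> m \<in> fst k"
  "m \<in> S \<Longrightarrow> snd k m = (0, snd (snd k m))" "m \<in> S \<Longrightarrow> norm (snd (snd k m)) < \<eta> / 16"
  by (auto simp: S_def k_slice_def mem_Times_iff prod_eq_iff)

lemma tangent_components:
  assumes m: "m \<in> S" and v: "tangent_to A S m v"
  shows "fst (components A k m v) = 0"
proof -
  obtain c' where c': "slice_chart A S c'" "m \<in> fst c'" "fst (components A c' m v) = 0"
    using v by (auto simp: tangent_to_def)
  have "components A k_slice m v = components A k m v"
    by (simp add: components_def transition_def k_slice_def)
  then show ?thesis using slice_tangent[OF c'(1) slice m c'(2) S_in(1)[OF m] c'(3)] by simp
qed

lemma S_ball: assumes "m \<in> S" shows "(0::real, snd (snd k m)) \<in> ball 0 \<eta>"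
  using S_in(4)[OF assms] \<eta> by (simp add: norm_Pair)

lemma S_spacelike: "spacelike_hypersurface A g S"
  unfolding spacelike_hypersurface_def
proof (intro ballI conjI allI impI)
  fix m assume m: "m \<in> S"
  show "\<exists>c. slice_chart A S c \<and> m \<in> fst c" using slice S_in(1)[OF m] by blast
  fix v assume v: "tangent_to A S m v" "v \<noteq> 0"
  define w where "w = snd (components A k m v)"
  have w: "components A k m v = (0, w)" using tangent_components[OF m v(1)] by (simp add: w_def prod_eq_iff)
  have "w \<noteq> 0"
  proof
    assume "w = 0"
    then have "components A k m v = 0" using w by (simp add: zero_prod_def)
    then have "v = from_components A k m 0" using components_from_components(2)[OF k S_in(2)[OF m], of v] by simp
    then show False using v(2) linear_0[OF from_components_linear[OF k S_in(2)[OF m]]] by simp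
  qed
  from spacelike[OF S_ball[OF m] this] show "g m v v > 0"
    using g_components[OF k S_in(2)[OF m], of v v] w S_in(3)[OF m] by simp
qed

definition F :: "'m \<Rightarrow> real \<Rightarrow> 'm" where "F m = normal_curve (0, snd (snd k m))"

lemma small_in_ball:
  assumes "\<bar>t\<bar> < \<eta> / 8" "norm x < \<eta> / 16"
  shows "(t, x :: real ^ 'n) \<in> ball 0 \<eta>"
  using norm_Pair_le[of t x] assms by simp

lemma F_normal_family: "normal_geodesic_family A g T S (\<eta> / 8) F"
  unfolding normal_geodesic_family_def
proof (intro conjI ballI allI impI)
  show "0 < \<eta> / 8" using \<eta> by simp
next
  fix m assume m: "m \<in> S"
  let ?x = "snd (snd k m)"
  have J: "(t + fst (0::real, ?x), snd (0::real, ?x)) \<in> ball 0 \<eta>" if "t \<in> {-(\<eta> / 8)<..<\<eta> / 8}" for t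
    using small_in_ball[of t ?x] that S_in(4)[OF m] by auto
  show "unit_future_geodesic A g T {-(\<eta> / 8)<..<\<eta> / 8} (F m)"
    unfolding F_def by (rule normal_curve_unit_future[OF J])
  have x\<delta>: "?x \<in> ball 0 \<delta>" using S_in(4)[OF m] \<eta>\<delta> \<eta> by simp
  have Ym: "chart_inv k (Y (0, ?x)) = m"
    using Y0[OF x\<delta>] S_in(3)[OF m] chart_inv_left[OF isc S_in(2)[OF m]] by simp
  show "F m 0 = m" by (simp add: F_def normal_curve_def Ym)
  fix v assume v: "tangent_to A S m v"
  have "components A k m v = (0, snd (components A k m v))"
    using tangent_components[OF m v] by (simp add: prod_eq_iff)
  moreover have "velocity A (F m) 0 = from_components A k m (V (0, ?x))"
    using normal_curve_geodesic(2)[where a="(0, ?x)" and \<alpha>="\<eta> / 8" and t=0, OF J] \<eta> by (simp add: F_def normal_curve_def Ym)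
  then have "components A k m (velocity A (F m) 0) = V (0, ?x)" using k S_in(2)[OF m] by simp
  ultimately show "g m (velocity A (F m) 0) v = 0"
    using g_components[OF k S_in(2)[OF m], of "velocity A (F m) 0" v] perp[OF x\<delta>] S_in(3)[OF m] by metis
next
  fix c' assume c': "slice_chart A S c'"
  then have cm: "c' \<in> maximal_atlas A" by (simp add: slice_chart_def)
  note ch' = maximal_is_chart[OF cm]
  let ?O = "{(y, t). (0, y) \<in> snd c' ` fst c' \<and> t \<in> {-(\<eta> / 8)<..<\<eta> / 8}} :: ((real ^ 'n) \<times> real) set"
  let ?f = "\<lambda>z. Y (snd z, snd (transition c' k (0, fst z)))"
  have "?O = (\<lambda>z. (0, fst z)) -` (snd c' ` fst c') \<inter> snd -` {-(\<eta> / 8)<..<\<eta> / 8}" by auto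
  moreover have "open \<dots>"
    by (intro open_Int open_vimage chart_open[OF ch'] open_greaterThanLessThan continuous_intros)
  ultimately have oO: "open ?O" by simp
  have pt: "(0, fst z) \<in> snd c' ` (fst c' \<inter> fst k)" "(snd z, snd (transition c' k (0, fst z))) \<in> ball 0 \<eta>" if z: "z \<in> ?O" for z
  proof -
    have z': "(0, fst z) \<in> snd c' ` fst c'" "\<bar>snd z\<bar> < \<eta> / 8" using z by auto
    define m where "m = chart_inv c' (0, fst z)"
    have m: "m \<in> fst c'" "snd c' m = (0, fst z)" using chart_inv_right[OF ch' z'(1)] by (auto simp: m_def)
    have mS: "m \<in> S" using c' m by (auto simp: slice_chart_def)
    show "(0, fst z) \<in> snd c' ` (fst c' \<inter> fst k)" using m S_in(2)[OF mS] by (metis IntI imageI)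
    show "(snd z, snd (transition c' k (0, fst z))) \<in> ball 0 \<eta>"
      using small_in_ball[OF z'(2) S_in(4)[OF mS]] by (simp add: transition_def m_def)
  qed
  have "smooth_on ?O (\<lambda>z. transition c' k (0, fst z))"
  proof (rule smooth_on_compose[OF oO overlap_open[OF cm k] smooth_transition[OF cm k]])
    show "smooth_on ?O (\<lambda>z. (0, fst z))" by (intro smooth_on_Pair smooth_on_const smooth_on_fst smooth_on_id oO)
    show "(\<lambda>z. (0, fst z)) ` ?O \<subseteq> snd c' ` (fst c' \<inter> fst k)" by (rule image_subsetI) (rule pt(1))
  qed
  then have "smooth_on ?O (\<lambda>z. (snd z, snd (transition c' k (0, fst z))))"
    by (intro smooth_on_Pair smooth_on_snd smooth_on_id oO)
  moreover have "open \<Omega>" by (intro open_Times open_ball open_greaterThanLessThan)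
  ultimately have "smooth_on ?O ?f"
    using in_\<Omega>(3)[OF pt(2)] by (intro smooth_on_compose[OF oO _ sY]) blast+
  then have "smooth_into A ?O (\<lambda>z. chart_inv k (?f z))"
    by (rule smooth_into_chart_inv[OF k oO]) (use Y_in[OF pt(2)] in blast)
  then show "smooth_into A ?O (\<lambda>(y, t). F (chart_inv c' (0, y)) t)"
    by (simp add: F_def normal_curve_def transition_def case_prod_beta')
qed

context
  fixes a :: "real \<times> (real ^ 'n)"
  assumes a: "a \<in> ball 0 (\<eta> / 16)"
begin

lemma a_small: "\<bar>fst a\<bar> < \<eta> / 16" "norm (snd a) < \<eta> / 16"
  using a norm_fst_le[of "fst a" "snd a"] norm_snd_le[of "snd a" "fst a"] by auto

lemma J_small: "t \<in> {-(\<eta> / 16)<..<\<eta> / 16} \<Longrightarrow> (t + fst a, snd a) \<in> ball 0 \<eta>"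
proof (rule small_in_ball[OF _ a_small(2)])
  assume "t \<in> {-(\<eta> / 16)<..<\<eta> / 16}"
  then show "\<bar>t + fst a\<bar> < \<eta> / 8"
    using a_small(1) unfolding greaterThanLessThan_iff abs_less_iff by linarith
qed

text \<open>The geodesic of the flow \<open>c\<close> that starts at \<open>state (lift a z)\<close> has as initial velocity the
  vector with components \<open>frame_vector (lift a z)\<close>, which is the Temple vector; by uniqueness of
  geodesics its end point is the value of the exponential map.\<close>

lemma temple_map_eq:
  assumes z: "z \<in> C"
  shows "temple_vector A (normal_curve a) (frame_along a) z \<in> exp_domain A g (normal_curve a (fst z))"
    and "temple_map A g (normal_curve a) (frame_along a) z = chart_inv k (K (lift a z))"
proof -
  have z': "fst z \<in> {-(\<eta> / 16)<..<\<eta> / 16}" using z by (auto simp: cylinder_def)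
  let ?q = "state (lift a z)" and ?m = "normal_curve a (fst z)"
  have L: "lift a z \<in> ball 0 \<eta>" by (rule lift_in_ball[OF a_small z])
  note q = state_in[OF L]
  have fst_q: "fst ?q = Y (fst z + fst a, snd a)" by (simp add: state_def lift_def)
  have m: "?m \<in> fst k" unfolding normal_curve_def by (rule Y_chart(1)[OF J_small[OF z']])
  note lin = from_components_linear[OF k m]
  have tv: "temple_vector A (normal_curve a) (frame_along a) z = from_components A k ?m (snd ?q)"
    using normal_curve_geodesic(2)[OF J_small z']
    by (simp add: temple_vector_def case_prod_beta' frame_along_def state_def frame_vector_def lift_def
        linear_add[OF lin] linear_sum[OF lin] linear_cmul[OF lin])
  define cY where "cY s = fst (c (s, ?q))" for s
  define cV where "cV s = snd (c (s, ?q))" for s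
  have ode: "cY s \<in> snd k ` fst k" "(cY has_vector_derivative cV s) (at s)"
    "(cV has_vector_derivative - christoffel A g k (cY s) (cV s) (cV s)) (at s)" if "s \<in> {-2<..<2}" for s
  proof -
    note o = odec[OF that q, THEN conjunct1] odec[OF that q, THEN conjunct2]
    show "cY s \<in> snd k ` fst k" using o(1) by (simp only: cY_def)
    show "(cY has_vector_derivative cV s) (at s)"
      using bounded_linear.has_vector_derivative[OF bounded_linear_fst o(2)]
      by (simp add: cY_def[abs_def] cV_def spray_def)
    show "(cV has_vector_derivative - christoffel A g k (cY s) (cV s) (cV s)) (at s)"
      using bounded_linear.has_vector_derivative[OF bounded_linear_snd o(2)]
      by (simp add: cY_def cV_def[abs_def] spray_def \<Gamma>k)
  qed
  have scY: "smooth_on {-2<..<2} cY"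
  proof -
    have o: "open ({-2<..<2::real} \<times> ball (0 :: 'n model, 0 :: 'n model) \<epsilon>)" by (intro open_Times open_ball open_greaterThanLessThan)
    have "smooth_on {-2<..<2} (\<lambda>s. c (s, ?q))"
      by (rule smooth_on_compose[OF open_greaterThanLessThan o sc])
        (use q in \<open>auto simp del: mem_ball intro!: smooth_on_Pair\<close>)
    then show ?thesis unfolding cY_def by (rule smooth_on_fst[OF open_greaterThanLessThan])
  qed
  note geo = geodesic_chartI[OF k open_greaterThanLessThan _ ode(1) scY ode(2,3)]
  have c_q: "cY 0 = Y (fst z + fst a, snd a)" "cV 0 = snd ?q" using c0[OF q] fst_q by (simp_all add: cY_def cV_def)
  have "exp_rel A g ?m (temple_vector A (normal_curve a) (frame_along a) z) (chart_inv k (K (lift a z)))"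
    unfolding exp_rel_def
  proof (intro exI conjI)
    show "geodesic A g {-2<..<2} (\<lambda>s. chart_inv k (cY s))" by (rule geo(1)) (simp_all add: is_interval_1)
    show "chart_inv k (cY 0) = ?m" by (simp add: c_q normal_curve_def)
    have "velocity A (\<lambda>s. chart_inv k (cY s)) 0 = from_components A k (chart_inv k (cY 0)) (cV 0)"
      by (rule geo(2)) (simp_all add: is_interval_1)
    then show "velocity A (\<lambda>s. chart_inv k (cY s)) 0 = temple_vector A (normal_curve a) (frame_along a) z"
      by (simp add: tv c_q normal_curve_def)
    show "chart_inv k (cY 1) = chart_inv k (K (lift a z))" by (simp add: cY_def K_def)
  qed auto
  from exp_map_eq[OF this]
  show "temple_vector A (normal_curve a) (frame_along a) z \<in> exp_domain A g ?m"
    "temple_map A g (normal_curve a) (frame_along a) z = chart_inv k (K (lift a z))"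
    by (simp_all add: temple_map_def)
qed

lemma P_in: "(\<lambda>z. K (lift a z)) ` C \<subseteq> snd k ` fst k"
  using K_in[OF lift_in_ball[OF a_small]] by blast

lemma temple_homeomorphism:
  "\<exists>\<Psi>. homeomorphism C (temple_map A g (normal_curve a) (frame_along a) ` C) (temple_map A g (normal_curve a) (frame_along a)) \<Psi>"
proof -
  let ?P = "\<lambda>z. K (lift a z)" and ?f = "temple_map A g (normal_curve a) (frame_along a)"
  have "homeomorphism (snd k ` fst k) (fst k) (chart_inv k) (snd k)"
    using isc homeomorphism_symD unfolding is_chart_def by blast
  then have "homeomorphism (?P ` C) (chart_inv k ` ?P ` C) (chart_inv k) (snd k)"
    by (rule homeomorphism_of_subsets[OF _ P_in]) auto
  from homeomorphism_compose[OF P_homeomorphism[OF a_small] this]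
  have "homeomorphism C (chart_inv k ` ?P ` C) (chart_inv k \<circ> ?P) (inv_into C ?P \<circ> snd k)" .
  moreover have "?f ` C = chart_inv k ` ?P ` C"
    using temple_map_eq(2) by (simp add: image_image cong: image_cong)
  ultimately have "homeomorphism C (?f ` C) ?f (inv_into C ?P \<circ> snd k)"
    by (rule homeomorphism_cong[OF _ refl]) (simp_all add: temple_map_eq(2))
  then show ?thesis by blast
qed

lemma temple_chart_at:
  "temple_chart A g T (chart_inv k (Y a)) (normal_curve a) (frame_along a) (\<eta> / 16) (\<eta> / 16)"
proof -
  have ab: "a \<in> ball 0 \<eta>" using a \<eta> by simp
  have n0: "normal_curve a 0 = chart_inv k (Y a)" by (simp add: normal_curve_def)
  have f0: "frame_along a i 0 = from_components A k (chart_inv k (Y a)) (E i a)" for i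
    by (simp add: frame_along_def n0)
  have v0: "velocity A (normal_curve a) 0 = from_components A k (chart_inv k (Y a)) (V a)"
    using normal_curve_geodesic(2)[where \<alpha>="\<eta> / 16" and t=0, OF J_small] \<eta> by (simp add: n0)
  note o' = in_\<Omega>(1,2)[OF ab]
  have rel: "gc k (Y a) (V a) (V a) = -1" "gc k (Y a) (V a) (E i a) = 0" "gc k (Y a) (E i a) (E j a) = (if i = j then 1 else 0)" for i j
    using VV[OF o'] VE[OF o'] EE[OF o'] by simp_all
  note lin = from_components_linear[OF k Y_chart(1)[OF ab]]
  have sum0: "frame_along a i 0 + velocity A (normal_curve a) 0 = from_components A k (chart_inv k (Y a)) (E i a + V a)" for i
    by (simp add: f0 v0 linear_add[OF lin])
  have null: "future_null g T (chart_inv k (Y a)) (frame_along a i 0 + velocity A (normal_curve a) 0)" for i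
  proof -
    have gT: "g (chart_inv k (Y a)) (from_components A k (chart_inv k (Y a)) (E i a + V a)) (T (chart_inv k (Y a))) < 0"
      unfolding g_from_components_T[OF ab] by (rule future_E[OF ab])
    have "from_components A k (chart_inv k (Y a)) (E i a + V a) \<noteq> 0"
    proof
      assume "from_components A k (chart_inv k (Y a)) (E i a + V a) = 0"
      then show False using gT bilinear_lzero[OF g_bilinear] by simp
    qed
    moreover have "gc k (Y a) (E i a + V a) (E i a + V a) = 0"
    proof -
      note l = G_linear(1)[OF Y_in[OF ab]] G_linear(2)[OF Y_in[OF ab]]
      have "gc k (Y a) (E i a) (V a) = 0" using rel(2)[of i] sym[OF Y_in[OF ab]] by metis
      then show ?thesis using rel(1) rel(2)[of i] rel(3)[of i i] by (simp add: linear_add[OF l(1)] linear_add[OF l(2)])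
    qed
    ultimately show ?thesis unfolding future_null_def sum0 g_from_components using gT by simp
  qed
  have Csub: "(\<lambda>z. K (lift a z)) ` (C - axis_C) \<subseteq> snd k ` fst k" using P_in by blast
  have inj: "inj_on (\<lambda>z. K (lift a z)) (C - axis_C)" by (rule inj_on_subset[OF P_inj[OF a_small]]) blast
  have "diffeomorphism_onto_image A (C - axis_C) (temple_map A g (normal_curve a) (frame_along a))"
    by (rule diffeomorphism_onto_image_chartI[OF k open_C(2)[OF a_small] P_smooth[OF a_small] Csub inj
          P_open[OF a_small] P_inverse_smooth[OF a_small] temple_map_eq(2)]) blast
  then show ?thesis
    unfolding temple_chart_def
    using \<eta> normal_curve_unit_future[OF J_small] n0 frame_along_parallel[OF J_small] null temple_homeomorphism temple_map_eq(1) rel(3)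
    by (simp add: f0 g_from_components)
qed

end

text \<open>For a point \<open>q\<close> of this ball the image of the Temple map at \<open>q\<close> contains, in coordinates,
  the ball of radius \<open>\<eta>/64\<close> around \<open>q\<close> and so the whole of the ball of radius \<open>\<eta>/128\<close> around the
  origin.\<close>

definition U :: "'m set" where "U = chart_inv k ` ball 0 (\<eta> / 128)"

lemma base_points_cover:
  assumes "(y :: 'n model) \<in> ball 0 (\<eta> / 32)" obtains a where "a \<in> ball 0 (\<eta> / 16)" "Y a = y"
proof -
  obtain a where "a \<in> ball 0 (\<eta> / 16)" "y = K (a, 0)" using covers_by_base_points assms K_zero by auto
  then show ?thesis using that[of a] K_base[of a] \<eta> by simp
qed

lemma ball_in_chart: "ball 0 (\<eta> / 32) \<subseteq> snd k ` fst k"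
proof
  fix y :: "'n model" assume "y \<in> ball 0 (\<eta> / 32)"
  then obtain a where "a \<in> ball 0 (\<eta> / 16)" "Y a = y" using base_points_cover by blast
  then show "y \<in> snd k ` fst k" using Y_in[of a] \<eta> by simp
qed

lemma U_open: "open U" "p \<in> U"
proof -
  have "ball (0 :: 'n model) (\<eta> / 128) \<subseteq> ball 0 (\<eta> / 32)" using \<eta> by auto
  then show "open U" unfolding U_def using ball_in_chart by (intro chart_inv_image_open[OF isc open_ball]) blast
  have "chart_inv k 0 = p" using chart_inv_left[OF isc p(1)] p(2) by simp
  then show "p \<in> U" unfolding U_def using \<eta> by (metis centre_in_ball image_eqI zero_less_divide_iff zero_less_numeral)
qed

lemma p_in_S: "p \<in> S" using p \<eta> by (simp add: S_def)

lemma covering_temple_chart: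
  assumes q: "q \<in> U"
  shows "\<exists>x\<in>S. \<exists>\<tau> \<epsilon> r e. {\<tau> - \<epsilon><..<\<tau> + \<epsilon>} \<subseteq> {-(\<eta> / 8)<..<\<eta> / 8} \<and>
      temple_chart A g T q (\<lambda>t. F x (t + \<tau>)) e \<epsilon> r \<and>
      U \<subseteq> temple_map A g (\<lambda>t. F x (t + \<tau>)) e ` cylinder \<epsilon> r"
proof -
  obtain y where y: "y \<in> ball 0 (\<eta> / 128)" "q = chart_inv k y" using q by (auto simp: U_def)
  obtain a where a: "a \<in> ball 0 (\<eta> / 16)" "Y a = y" using base_points_cover[of y] y \<eta> by auto
  note sm = a_small[OF a(1)]
  have x\<delta>: "snd a \<in> ball 0 \<delta>" using sm(2) \<eta>\<delta> \<eta> by simp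
  define x where "x = chart_inv k (0, snd a)"
  have "(0, snd a) \<in> snd k ` fst k"
    using Y_in[of "(0, snd a)"] Y0[OF x\<delta>] sm(2) \<eta> by (simp add: norm_Pair)
  from chart_inv_right[OF isc this] have x: "snd k x = (0, snd a)" "x \<in> fst k" by (auto simp: x_def)
  have xS: "x \<in> S" using x sm by (simp add: S_def)
  have F: "(\<lambda>t. F x (t + fst a)) = normal_curve a" by (rule ext) (simp add: F_def normal_curve_def x)
  have cov: "U \<subseteq> temple_map A g (normal_curve a) (frame_along a) ` C"
  proof
    fix u assume "u \<in> U"
    then obtain w where w: "w \<in> ball 0 (\<eta> / 128)" "u = chart_inv k w" by (auto simp: U_def)
    have ab: "a \<in> ball 0 \<eta>" using a(1) \<eta> by simp
    have "lift a 0 = (a, 0)" by (simp add: lift_def zero_prod_def)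
    then have "K (lift a 0) = y" using K_base[OF ab] a(2) by simp
    moreover have "dist y w < \<eta> / 64" using y(1) w(1) dist_triangle2[of y w 0] by simp
    ultimately have "w \<in> (\<lambda>z. K (lift a z)) ` C" using P_covers[OF sm] by auto
    then obtain z where "z \<in> C" "w = K (lift a z)" by blast
    then show "u \<in> temple_map A g (normal_curve a) (frame_along a) ` C"
      using temple_map_eq(2)[OF a(1)] w(2) by (metis image_eqI)
  qed
  show ?thesis
  proof (intro bexI[OF _ xS] exI conjI)
    show "{fst a - \<eta> / 16<..<fst a + \<eta> / 16} \<subseteq> {-(\<eta> / 8)<..<\<eta> / 8}" using sm(1) by auto
    show "temple_chart A g T q (\<lambda>t. F x (t + fst a)) (frame_along a) (\<eta> / 16) (\<eta> / 16)"
      unfolding F using temple_chart_at[OF a(1)] a(2) y(2) by simp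
    show "U \<subseteq> temple_map A g (\<lambda>t. F x (t + fst a)) (frame_along a) ` cylinder (\<eta> / 16) (\<eta> / 16)"
      unfolding F by (rule cov)
  qed
qed

end

text \<open>Applied to a metric that is Minkowskian at \<open>y0\<close> and to spacelike coordinate vectors \<open>u\<close>:
  how far \<open>B y u u\<close> can drop below \<open>|u|\<^sup>2\<close> is controlled by the entries of \<open>B y - B y0\<close>.\<close>

lemma positive_on_neighbourhood:
  fixes B :: "'e::euclidean_space \<Rightarrow> 'e \<Rightarrow> 'e \<Rightarrow> real"
  assumes D: "open D" "y0 \<in> D" and B: "\<And>y. y \<in> D \<Longrightarrow> bilinear (B y)" "\<And>u v. continuous_on D (\<lambda>y. B y u v)"
  obtains N where "open N" "y0 \<in> N" "N \<subseteq> D" "\<And>y u. y \<in> N \<Longrightarrow> B y0 u u = (norm u)\<^sup>2 \<Longrightarrow> u \<noteq> 0 \<Longrightarrow> B y u u > 0"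
proof -
  define d where "d y = (\<Sum>b\<in>Basis. \<Sum>b'\<in>Basis. \<bar>B y b b' - B y0 b b'\<bar>)" for y
  have "continuous_on D (\<lambda>y. 1 - d y)" unfolding d_def by (intro continuous_intros B(2))
  from open_positive_set[OF D(1) this] have o: "open {y \<in> D. 0 < 1 - d y}" .
  have "B y u u > 0" if y: "y \<in> D" "d y < 1" and u: "B y0 u u = (norm u)\<^sup>2" "u \<noteq> 0" for y u
  proof -
    have ex: "B y u u = (\<Sum>b\<in>Basis. \<Sum>b'\<in>Basis. (u \<bullet> b) * ((u \<bullet> b') * B y b b'))" if "y \<in> D" for y
    proof -
      have l: "linear (\<lambda>u. B y u v)" "linear (B y v)" for v using B(1)[OF that] by (auto simp: bilinear_def)
      have "B y u u = (\<Sum>b\<in>Basis. (u \<bullet> b) *\<^sub>R B y b u)" by (rule linear_basis_sum[OF l(1)])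
      also have "\<dots> = (\<Sum>b\<in>Basis. (u \<bullet> b) *\<^sub>R (\<Sum>b'\<in>Basis. (u \<bullet> b') *\<^sub>R B y b b'))"
        by (rule sum.cong[OF refl]) (simp only: linear_basis_sum[OF l(2), symmetric])
      finally show ?thesis by (simp add: sum_distrib_left)
    qed
    have "B y0 u u - B y u u = (\<Sum>b\<in>Basis. \<Sum>b'\<in>Basis. (u \<bullet> b) * ((u \<bullet> b') * (B y0 b b' - B y b b')))"
      unfolding ex[OF D(2)] ex[OF y(1)] by (simp add: sum_subtractf right_diff_distrib)
    also have "\<dots> \<le> (\<Sum>b\<in>Basis. \<Sum>b'\<in>Basis. (norm u)\<^sup>2 * \<bar>B y b b' - B y0 b b'\<bar>)"
    proof (intro sum_mono)
      fix b b' :: 'e assume b: "b \<in> Basis" "b' \<in> Basis"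
      have "(u \<bullet> b) * ((u \<bullet> b') * (B y0 b b' - B y b b')) \<le> \<bar>u \<bullet> b\<bar> * (\<bar>u \<bullet> b'\<bar> * \<bar>B y b b' - B y0 b b'\<bar>)"
        by (metis abs_ge_self abs_minus_commute abs_mult)
      also have "\<dots> \<le> norm u * (norm u * \<bar>B y b b' - B y0 b b'\<bar>)"
        using b by (intro mult_mono mult_right_mono Basis_le_norm mult_nonneg_nonneg) auto
      finally show "(u \<bullet> b) * ((u \<bullet> b') * (B y0 b b' - B y b b')) \<le> (norm u)\<^sup>2 * \<bar>B y b b' - B y0 b b'\<bar>"
        by (simp add: power2_eq_square mult.assoc)
    qed
    also have "\<dots> = (norm u)\<^sup>2 * d y" by (simp add: d_def sum_distrib_left)
    also have "\<dots> < (norm u)\<^sup>2 * 1" using y(2) u(2) by (intro mult_strict_left_mono) auto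
    finally show ?thesis using u(1) by simp
  qed
  moreover have "d y0 = 0" by (simp add: d_def)
  ultimately show ?thesis using that[of "{y \<in> D. 0 < 1 - d y}"] o D(2) by auto
qed

context spacetime
begin

text \<open>The requirements that \<open>temple_kernel\<close> does not settle are strict inequalities between
  continuous quantities that hold at \<open>p\<close>. With \<open>w\<close> the components of the time orientation at
  \<open>p\<close>, so that \<open>|snd w| < fst w\<close>, the one for the null vectors \<open>E i + V\<close> is
  \<open>snd w $ i < fst w\<close>.\<close>

lemma ex_temple_setup:
  "\<exists>k \<delta> Y V E \<epsilon> c \<eta>. temple_setup A g T k \<delta> Y V E \<epsilon> c p \<eta>"
proof -
  obtain k where k: "k \<in> maximal_atlas A" "p \<in> fst k" "snd k p = 0"
    and met: "\<And>u v. gc k 0 u v = - (fst u * fst v) + snd u \<bullet> snd v"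
    and Tp: "norm (snd (components A k p (T p))) < fst (components A k p (T p))"
    and Tc: "continuous_on (fst k) (\<lambda>x. components A k x (T x))"
    using minkowski_chart[of p] by blast
  note isc = maximal_is_chart[OF k(1)]
  let ?D = "snd k ` fst k"
  have zD: "0 \<in> ?D" using k by force
  have ip: "chart_inv k 0 = p" using chart_inv_left[OF isc k(2)] k(3) by simp
  interpret M: minkowski_at_origin ?D "gc k"
    unfolding minkowski_at_origin_def minkowski_at_origin_axioms_def using local_metric[OF k(1)] zD met by blast
  obtain \<delta> Y V E where frame: "adapted_frame ?D (gc k) \<delta> Y V E"
    using M.ex_adapted_frame by blast
  obtain \<epsilon> c where "temple_data ?D (gc k) \<delta> Y V E \<epsilon> c"
    by (rule M.local_exponential[OF zD])
      (rule that, rule temple_data.intro[OF frame], rule temple_data_axioms.intro; assumption)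
  then interpret N: temple_data ?D "gc k" \<delta> Y V E \<epsilon> c .
  let ?\<Omega> = "{-\<delta><..<\<delta>} \<times> ball (0 :: real ^ 'n) \<delta>"
  have o\<Omega>: "open ?\<Omega>" by (intro open_Times open_ball open_greaterThanLessThan)
  have z\<Omega>: "0 \<in> ?\<Omega>" using N.\<delta> by (simp add: zero_prod_def)
  have Y\<Omega>: "Y ` ?\<Omega> \<subseteq> ?D" using N.odeY by auto
  define That where "That y = components A k (chart_inv k y) (T (chart_inv k y))" for y
  have cT: "continuous_on ?D That"
    unfolding That_def by (rule continuous_on_compose2[OF Tc chart_continuous(2)[OF isc]]) (use chart_inv_right[OF isc] in blast)
  have cTY: "continuous_on ?\<Omega> (\<lambda>a. That (Y a))"
    by (rule continuous_on_compose2[OF cT smooth_on_continuous[OF N.sY] Y\<Omega>])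
  have cont: "continuous_on ?\<Omega> (\<lambda>a. - gc k (Y a) (W a) (That (Y a)))" if W: "smooth_on ?\<Omega> W" for W
  proof -
    have "smooth_on ?\<Omega> (\<lambda>a. M.flat (Y a) (W a))"
      unfolding M.flat_def
      by (intro smooth_on_sum smooth_on_scaleR smooth_on_const o\<Omega> M.smooth_G_fields N.sY Y\<Omega> W)
    then have "continuous_on ?\<Omega> (\<lambda>a. - (M.flat (Y a) (W a) \<bullet> That (Y a)))"
      by (intro continuous_intros cTY smooth_on_continuous)
    then show ?thesis
      by (rule continuous_on_eq) (simp add: M.flat_inner[OF subsetD[OF Y\<Omega> imageI]])
  qed
  define B0 where "B0 = {a \<in> ?\<Omega>. 0 < - gc k (Y a) (V a) (That (Y a))}"
  define B1 where "B1 i = {a \<in> ?\<Omega>. 0 < - gc k (Y a) (E i a + V a) (That (Y a))}" for i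
  have oB: "open B0" "open (B1 i)" for i
    unfolding B0_def B1_def by (intro open_positive_set o\<Omega> cont N.sV smooth_on_add N.sE)+
  obtain B2 where B2: "open B2" "0 \<in> B2" "B2 \<subseteq> ?D"
    "\<And>y u. y \<in> B2 \<Longrightarrow> gc k 0 u u = (norm u)\<^sup>2 \<Longrightarrow> u \<noteq> 0 \<Longrightarrow> gc k y u u > 0"
    using positive_on_neighbourhood[OF M.open_D zD M.bil smooth_on_continuous[OF M.smooth]] by blast
  have Y0: "Y 0 = 0" using N.Y0[of 0] N.\<delta> by (simp add: zero_prod_def)
  have VE0: "V 0 = (1, 0)" "E i 0 = (0, axis i 1)" for i using N.V0 N.E0 by (simp_all add: zero_prod_def)
  have T0: "That 0 = components A k p (T p)" by (simp add: That_def ip)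
  let ?w = "components A k p (T p)"
  have pos: "0 < fst ?w" using Tp norm_ge_zero[of "snd ?w"] by linarith
  have "snd ?w $ i < fst ?w" for i using component_le_norm_cart[of "snd ?w" i] Tp by linarith
  then have z: "0 \<in> B0" "0 \<in> B1 i" for i
    using z\<Omega> pos by (simp_all add: B0_def B1_def Y0 T0 met VE0 inner_axis')
  let ?B = "B0 \<inter> (\<Inter>i\<in>UNIV. B1 i) \<inter> B2"
  have "open ?B" "0 \<in> ?B" using oB B2(1,2) z by (auto intro!: open_Int open_INT)
  from N.temple_kernel[OF this] obtain \<eta> where \<eta>: "\<eta> \<le> \<delta>" "near_additive N.K \<eta>" "ball 0 \<eta> \<subseteq> ?B"
    "\<And>q. q \<in> ball 0 \<eta> \<Longrightarrow> N.state q \<in> ball (0, 0) \<epsilon>" by blast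
  have "temple_setup A g T k \<delta> Y V E \<epsilon> c p \<eta>"
  proof (intro temple_setup.intro temple_setup_axioms.intro)
    fix a :: "'n model" assume "a \<in> ball 0 \<eta>"
    then have "a \<in> ?B" using \<eta>(3) by blast
    then show "gc k (Y a) (V a) (components A k (chart_inv k (Y a)) (T (chart_inv k (Y a)))) < 0"
      "gc k (Y a) (E i a + V a) (components A k (chart_inv k (Y a)) (T (chart_inv k (Y a)))) < 0" for i
      by (auto simp: B0_def B1_def That_def)
  next
    fix x w :: "real ^ 'n" assume "(0 :: real, x) \<in> ball 0 \<eta>" and w: "w \<noteq> 0"
    then have "(0, x) \<in> B2" using \<eta>(3) by blast
    moreover have "gc k 0 (0, w) (0, w) = (norm (0 :: real, w))\<^sup>2" by (simp add: met norm_Pair power2_norm_eq_inner)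
    ultimately show "gc k (0, x) (0, w) (0, w) > 0" using B2(4)[of "(0, x)" "(0, w)"] w by (simp add: zero_prod_def)
  qed (assumption | rule k \<eta> spacetime_axioms N.temple_data_axioms)+
  then show ?thesis by blast
qed

end

theorem theorem1p1:
  fixes A :: "('m::{t2_space, second_countable_topology}, 'n::finite) chart set"
    and g :: "('m, 'n) metric_field"
    and T :: "('m, 'n) vector_field"
    and p :: 'm
  assumes "spacetime A g T"
  shows "\<exists>U S \<delta> F. open U \<and> p \<in> U \<and>
           spacelike_hypersurface A g S \<and> p \<in> S \<and> normal_geodesic_family A g T S \<delta> F \<and>
           (\<forall>q\<in>U. \<exists>x\<in>S. \<exists>\<tau> \<epsilon> r e.
              {\<tau> - \<epsilon><..<\<tau> + \<epsilon>} \<subseteq> {-\<delta><..<\<delta>} \<and>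
              temple_chart A g T q (\<lambda>t. F x (t + \<tau>)) e \<epsilon> r \<and>
              U \<subseteq> temple_map A g (\<lambda>t. F x (t + \<tau>)) e ` cylinder \<epsilon> r)"
proof -
  obtain k \<delta> Y V E \<epsilon> c \<eta> where "temple_setup A g T k \<delta> Y V E \<epsilon> c p \<eta>"
    using spacetime.ex_temple_setup[OF assms, of p] by blast
  then interpret temple_setup A g T k \<delta> Y V E \<epsilon> c p \<eta> .
  show ?thesis
    by (intro exI[of _ U] exI[of _ S] exI[of _ "\<eta> / 8"] exI[of _ F] conjI ballI
        U_open S_spacelike p_in_S F_normal_family covering_temple_chart)
qed

end
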